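(* Let $G$ be a $p$-adic Lie group and let $W$ be a $\mathfrak{LA}$-acyclic $\mathbb{Q}_p$-Banach space representation of $G$. Then $W$ is strongly $\mathfrak{LA}$-acyclic.
   Context: Fix a compact open subgroup $G_0$ of $G$ equipped with an integer valued, saturated $p$-valuation, and let $G_n=G_0^{p^n}$. $\mathscr{C}^{\mathrm{an}}(G_n,\mathbb{Q}_p)$ is the Banach space of $\mathbb{Q}_p$-valued analytic functions on $G_n$ with the left translation action of $G_n$. For a $\mathbb{Q}_p$-Banach space representation $W$ of $G$ (continuous action), $G_n$ acts diagonally on $W\widehat\otimes_{\mathbb{Q}_p}\mathscr{C}^{\mathrm{an}}(G_n,\mathbb{Q}_p)$, and restriction of functions gives maps $H^i_{\mathrm{cont}}(G_n,W\widehat\otimes\mathscr{C}^{\mathrm{an}}(G_n,\mathbb{Q}_p))\to H^i_{\mathrm{cont}}(G_m,W\widehat\otimes\mathscr{C}^{\mathrm{an}}(G_m,\mathbb{Q}_p))$ for $m\ge n$ (continuous group cohomology). $W$ is $\mathfrak{LA}$-acyclic if $\varinjlim_nH^i_{\mathrm{cont}}(G_n,W\widehat\otimes_{\mathbb{Q}_p}\mathscr{C}^{\mathrm{an}}(G_n,\mathbb{Q}_p))=0$ for all $i\ge1$. $W$ is strongly $\mathfrak{LA}$-acyclic if for every $i\ge1$ this direct system is essentially zero: for every $n\ge0$ there is $m\ge n$ such that the transition map $H^i_{\mathrm{cont}}(G_n,W\widehat\otimes_{\mathbb{Q}_p}\mathscr{C}^{\mathrm{an}}(G_n,\mathbb{Q}_p))\to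 H^i_{\mathrm{cont}}(G_m,W\widehat\otimes_{\mathbb{Q}_p}\mathscr{C}^{\mathrm{an}}(G_m,\mathbb{Q}_p))$ is zero. Neither notion depends on the choice of $G_0$. *)

theory Defs
  imports "HOL-Analysis.Analysis" "HOL-Algebra.Coset" "HOL-Library.Function_Algebras"
begin

section \<open>Non-archimedean fields and Banach spaces\<close>

text \<open>The library reserves \<open>norm\<close> for real normed spaces.\<close>
class ultrametric_group = ab_group_add + metric_space +
  fixes unorm :: "'a \<Rightarrow> real"
  assumes dist_unorm: "dist x y = unorm (x - y)"
    and unorm_add_le_max: "unorm (x + y) \<le> max (unorm x) (unorm y)"

class ultrametric_field = ultrametric_group + field_char_0 +
  assumes unorm_mult: "unorm (x * y) = unorm x * unorm y"

lemma unorm_dist: "unorm (x :: 'a::ultrametric_group) = dist x 0"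
  by (simp add: dist_unorm)

lemma unorm_minus: "unorm (- x) = unorm (x :: 'a::ultrametric_group)"
  by (metis diff_0 diff_zero dist_commute dist_unorm)

instance ultrametric_group \<subseteq> topological_ab_group_add
proof
  have sub: "((\<lambda>z. f z + g z) \<longlongrightarrow> a + b) F"
    if f: "(f \<longlongrightarrow> a) F" and g: "(g \<longlongrightarrow> b) F"
    for f g :: "'c \<Rightarrow> 'a" and a b F
  proof (rule tendstoI)
    fix e :: real assume e: "0 < e"
    from tendstoD[OF f e] tendstoD[OF g e]
    show "\<forall>\<^sub>F z in F. dist (f z + g z) (a + b) < e"
    proof eventually_elim
      case (elim z)
      have "dist (f z + g z) (a + b) = unorm ((f z - a) + (g z - b))"
        by (simp add: dist_unorm algebra_simps)
      also have "\<dots> \<le> max (unorm (f z - a)) (unorm (g z - b))" by (rule unorm_add_le_max)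
      also have "\<dots> < e" using elim by (simp add: dist_unorm)
      finally show ?case .
    qed
  qed
  fix a b :: 'a
  show "LIM x (nhds a \<times>\<^sub>F nhds b). fst x + snd x :> nhds (a + b)"
    by (rule sub) (auto intro: filterlim_fst filterlim_snd)
  show "(uminus \<longlongrightarrow> - a) (nhds a)"
  proof (rule tendstoI)
    fix e :: real assume e: "0 < e"
    have "\<forall>\<^sub>F z in nhds a. dist z a < e" using e by (auto simp: eventually_nhds_metric)
    then show "\<forall>\<^sub>F z in nhds a. dist (- z) (- a) < e"
    proof eventually_elim
      case (elim z)
      have "dist (- z) (- a) = unorm (- (z - a))" by (simp add: dist_unorm algebra_simps)
      then show ?case using elim by (simp only: unorm_minus dist_unorm)
    qed
  qed
qed

text \<open>
  The field \<open>'k\<close> is \<open>\<rat>\<^sub>p\<close>: the completion of \<open>\<rat>\<close> for the \<open>p\<close>-adic absolute value. An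
  ultrametric multiplicative norm on \<open>\<rat>\<close> with \<open>\<parallel>p\<parallel> = 1/p\<close> is the \<open>p\<close>-adic absolute value (an
  integer prime to \<open>p\<close> has norm 1 by a Bezout relation), so the properties below determine
  \<open>'k\<close> up to a unique isometric isomorphism.
\<close>
definition is_Qp :: "nat \<Rightarrow> 'k::{ultrametric_field,complete_space} itself \<Rightarrow> bool" where
  "is_Qp p K \<longleftrightarrow> prime p \<and> unorm (of_nat p :: 'k) = 1 / real p \<and> closure \<rat> = (UNIV :: 'k set)"

text \<open>The \<open>p\<close>-adic valuation on \<open>\<rat>\<^sub>p\<close>, normalised by \<open>v(p) = 1\<close>.\<close>
definition padic_val :: "nat \<Rightarrow> 'k::ultrametric_field \<Rightarrow> ereal" where
  "padic_val p x = (if x = 0 then \<infinity> else ereal (- log (real p) (unorm x)))"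

definition banach_space ::
  "('k::{ultrametric_field,complete_space} \<Rightarrow> 'w::{ultrametric_group,complete_space} \<Rightarrow> 'w) \<Rightarrow> bool" where
  "banach_space smul \<longleftrightarrow> vector_space smul \<and> (\<forall>a w. unorm (smul a w) = unorm a * unorm w)"


section \<open>\<open>p\<close>-adic Lie groups\<close>

definition multi_indices :: "nat \<Rightarrow> (nat \<Rightarrow> nat) set" where
  "multi_indices d = {..<d} \<rightarrow>\<^sub>E UNIV"

definition monomial :: "nat \<Rightarrow> (nat \<Rightarrow> nat) \<Rightarrow> (nat \<Rightarrow> 'k::comm_monoid_mult) \<Rightarrow> 'k" where
  "monomial d \<alpha> x = (\<Prod>i<d. x i ^ \<alpha> i)"

definition null_family :: "'i set \<Rightarrow> ('i \<Rightarrow> real) \<Rightarrow> bool" where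
  "null_family I c \<longleftrightarrow> (\<forall>e>0. finite {i \<in> I. e \<le> \<bar>c i\<bar>})"

definition affine_space :: "nat \<Rightarrow> (nat \<Rightarrow> 'k::topological_space) topology" where
  "affine_space d = product_topology (\<lambda>_. euclidean) {..<d}"

definition locally_analytic ::
  "nat \<Rightarrow> (nat \<Rightarrow> 'k) set \<Rightarrow> ((nat \<Rightarrow> 'k::ultrametric_field) \<Rightarrow> 'k) \<Rightarrow> bool" where
  "locally_analytic d V f \<longleftrightarrow>
     (\<forall>a\<in>V. \<exists>r>0. \<exists>c. null_family (multi_indices d) (\<lambda>\<alpha>. unorm (c \<alpha>) * r ^ (\<Sum>i<d. \<alpha> i)) \<and>
        (\<forall>x \<in> {..<d} \<rightarrow>\<^sub>E UNIV. (\<forall>i<d. unorm (x i - a i) \<le> r) \<longrightarrow>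
           x \<in> V \<and>
           ((\<lambda>\<alpha>. c \<alpha> * monomial d \<alpha> (\<lambda>i. x i - a i)) has_sum f x) (multi_indices d)))"

definition locally_analytic_map ::
  "nat \<Rightarrow> nat \<Rightarrow> (nat \<Rightarrow> 'k) set \<Rightarrow> ((nat \<Rightarrow> 'k::ultrametric_field) \<Rightarrow> nat \<Rightarrow> 'k) \<Rightarrow> bool" where
  "locally_analytic_map d e V F \<longleftrightarrow> (\<forall>i<e. locally_analytic d V (\<lambda>x. F x i))"

definition padic_chart ::
  "'g topology \<Rightarrow> nat \<Rightarrow> 'g set \<Rightarrow> ('g \<Rightarrow> nat \<Rightarrow> 'k::ultrametric_field) \<Rightarrow> bool" where
  "padic_chart T d U \<phi> \<longleftrightarrow> openin T U \<and> openin (affine_space d) (\<phi> ` U) \<and>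
     homeomorphic_map (subtopology T U) (subtopology (affine_space d) (\<phi> ` U)) \<phi>"

definition padic_atlas ::
  "'g topology \<Rightarrow> nat \<Rightarrow> ('g set \<times> ('g \<Rightarrow> nat \<Rightarrow> 'k::ultrametric_field)) set \<Rightarrow> bool" where
  "padic_atlas T d A \<longleftrightarrow>
     (\<forall>(U, \<phi>) \<in> A. padic_chart T d U \<phi>) \<and> (\<Union>(U, \<phi>) \<in> A. U) = topspace T \<and>
     (\<forall>(U, \<phi>) \<in> A. \<forall>(V, \<psi>) \<in> A.
        locally_analytic_map d d (\<phi> ` (U \<inter> V)) (\<lambda>x. \<psi> (inv_into U \<phi> x)))"

definition topological_group :: "('g, 'm) monoid_scheme \<Rightarrow> 'g topology \<Rightarrow> bool" where
  "topological_group G T \<longleftrightarrow> group G \<and> topspace T = carrier G \<and>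
     continuous_map (prod_topology T T) T (\<lambda>(x, y). x \<otimes>\<^bsub>G\<^esub> y) \<and>
     continuous_map T T (\<lambda>x. inv\<^bsub>G\<^esub> x)"

text \<open>
  A point of \<open>K\<^sup>d \<times> K\<^sup>d\<close> is encoded as a point of \<open>K\<^sup>2\<^sup>d\<close>, with components
  \<open>fst_half d\<close> and \<open>snd_half d\<close>.
\<close>
definition fst_half :: "nat \<Rightarrow> (nat \<Rightarrow> 'k) \<Rightarrow> nat \<Rightarrow> 'k" where
  "fst_half d x = restrict x {..<d}"

definition snd_half :: "nat \<Rightarrow> (nat \<Rightarrow> 'k) \<Rightarrow> nat \<Rightarrow> 'k" where
  "snd_half d x = restrict (\<lambda>i. x (d + i)) {..<d}"

definition padic_lie_group ::
  "'k::ultrametric_field itself \<Rightarrow> ('g, 'm) monoid_scheme \<Rightarrow> 'g topology \<Rightarrow> bool" where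
  "padic_lie_group K G T \<longleftrightarrow> topological_group G T \<and> Hausdorff_space T \<and>
     (\<exists>d. \<exists>A :: ('g set \<times> ('g \<Rightarrow> nat \<Rightarrow> 'k)) set. padic_atlas T d A \<and>
        (\<forall>(U, \<phi>) \<in> A. \<forall>(V, \<psi>) \<in> A. \<forall>(W, \<theta>) \<in> A.
           locally_analytic_map (2 * d) d
             {x \<in> {..<2 * d} \<rightarrow>\<^sub>E UNIV. fst_half d x \<in> \<phi> ` U \<and> snd_half d x \<in> \<psi> ` V \<and>
                inv_into U \<phi> (fst_half d x) \<otimes>\<^bsub>G\<^esub> inv_into V \<psi> (snd_half d x) \<in> W}
             (\<lambda>x. \<theta> (inv_into U \<phi> (fst_half d x) \<otimes>\<^bsub>G\<^esub> inv_into V \<psi> (snd_half d x)))) \<and>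
        (\<forall>(U, \<phi>) \<in> A. \<forall>(V, \<psi>) \<in> A.
           locally_analytic_map d d {x \<in> \<phi> ` U. inv\<^bsub>G\<^esub> (inv_into U \<phi> x) \<in> V}
             (\<lambda>x. \<psi> (inv\<^bsub>G\<^esub> (inv_into U \<phi> x)))))"

text \<open>A Banach space representation: an action by linear maps with \<open>G \<times> W \<rightarrow> W\<close> continuous.\<close>
definition banach_representation ::
  "('g, 'm) monoid_scheme \<Rightarrow> 'g topology \<Rightarrow>
   ('k::{ultrametric_field,complete_space} \<Rightarrow> 'w::{ultrametric_group,complete_space} \<Rightarrow> 'w) \<Rightarrow>
   ('g \<Rightarrow> 'w \<Rightarrow> 'w) \<Rightarrow> bool" where
  "banach_representation G T smul \<rho> \<longleftrightarrow> banach_space smul \<and>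
     (\<forall>g \<in> carrier G. Vector_Spaces.linear smul smul (\<rho> g)) \<and>
     (\<forall>w. \<rho> \<one>\<^bsub>G\<^esub> w = w) \<and>
     (\<forall>g \<in> carrier G. \<forall>h \<in> carrier G. \<forall>w. \<rho> (g \<otimes>\<^bsub>G\<^esub> h) w = \<rho> g (\<rho> h w)) \<and>
     continuous_map (prod_topology T euclidean) euclidean (\<lambda>(g, w). \<rho> g w)"


section \<open>\<open>p\<close>-valuations\<close>

text \<open>A \<open>p\<close>-valuation (in the sense of Lazard) on the subgroup \<open>H\<close>, defining its topology.\<close>
definition p_valuation ::
  "nat \<Rightarrow> ('g, 'm) monoid_scheme \<Rightarrow> 'g topology \<Rightarrow> 'g set \<Rightarrow> ('g \<Rightarrow> ereal) \<Rightarrow> bool" where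
  "p_valuation p G T H \<omega> \<longleftrightarrow>
     (\<forall>g\<in>H. \<omega> g = \<infinity> \<longleftrightarrow> g = \<one>\<^bsub>G\<^esub>) \<and>
     (\<forall>g\<in>H. \<omega> g > ereal (1 / (real p - 1))) \<and>
     (\<forall>g\<in>H. \<forall>h\<in>H. \<omega> (inv\<^bsub>G\<^esub> g \<otimes>\<^bsub>G\<^esub> h) \<ge> min (\<omega> g) (\<omega> h)) \<and>
     (\<forall>g\<in>H. \<forall>h\<in>H. \<omega> (g \<otimes>\<^bsub>G\<^esub> h \<otimes>\<^bsub>G\<^esub> inv\<^bsub>G\<^esub> g \<otimes>\<^bsub>G\<^esub> inv\<^bsub>G\<^esub> h) \<ge> \<omega> g + \<omega> h) \<and>
     (\<forall>g\<in>H. \<omega> (g [^]\<^bsub>G\<^esub> p) = \<omega> g + 1) \<and>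
     (\<forall>\<nu>::real. openin (subtopology T H) {g\<in>H. \<omega> g \<ge> ereal \<nu>}) \<and>
     (\<forall>U. openin (subtopology T H) U \<and> \<one>\<^bsub>G\<^esub> \<in> U \<longrightarrow> (\<exists>\<nu>::real. {g\<in>H. \<omega> g \<ge> ereal \<nu>} \<subseteq> U))"

definition integer_valued :: "('g, 'm) monoid_scheme \<Rightarrow> 'g set \<Rightarrow> ('g \<Rightarrow> ereal) \<Rightarrow> bool" where
  "integer_valued G H \<omega> \<longleftrightarrow> (\<forall>g \<in> H - {\<one>\<^bsub>G\<^esub>}. \<exists>k::int. \<omega> g = ereal (of_int k))"

definition saturated :: "nat \<Rightarrow> ('g, 'm) monoid_scheme \<Rightarrow> 'g set \<Rightarrow> ('g \<Rightarrow> ereal) \<Rightarrow> bool" where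
  "saturated p G H \<omega> \<longleftrightarrow>
     (\<forall>g\<in>H. \<omega> g > ereal (real p / (real p - 1)) \<longrightarrow> (\<exists>h\<in>H. g = h [^]\<^bsub>G\<^esub> p))"

text \<open>The power \<open>g\<^sup>x\<close> for \<open>x \<in> \<int>\<^sub>p\<close>, the limit of \<open>g\<^sup>n\<close> as \<open>n \<in> \<nat>\<close> tends to \<open>x\<close>.\<close>
definition zp_pow ::
  "('g, 'm) monoid_scheme \<Rightarrow> 'g topology \<Rightarrow> 'g \<Rightarrow> 'k::ultrametric_field \<Rightarrow> 'g" where
  "zp_pow G T g x =
     (THE y. \<forall>n :: nat \<Rightarrow> nat. (\<lambda>k. of_nat (n k)) \<longlonglongrightarrow> x \<longrightarrow>
        limitin T (\<lambda>k. g [^]\<^bsub>G\<^esub> n k) y sequentially)"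

text \<open>\<open>\<int>\<^sub>p\<^sup>d\<close> and the ordered product of the powers \<open>b i\<close> to the \<open>x i\<close>, \<open>i = 0, \<dots>, d - 1\<close>.\<close>
definition Zp_box :: "nat \<Rightarrow> (nat \<Rightarrow> 'k::ultrametric_field) set" where
  "Zp_box d = {..<d} \<rightarrow>\<^sub>E {x. unorm x \<le> 1}"

definition basis_product ::
  "('g, 'm) monoid_scheme \<Rightarrow> 'g topology \<Rightarrow> nat \<Rightarrow> (nat \<Rightarrow> 'g) \<Rightarrow> (nat \<Rightarrow> 'k::ultrametric_field) \<Rightarrow> 'g" where
  "basis_product G T d b x = foldr (\<lambda>i y. zp_pow G T (b i) (x i) \<otimes>\<^bsub>G\<^esub> y) [0..<d] \<one>\<^bsub>G\<^esub>"

definition ordered_basis ::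
  "'k::ultrametric_field itself \<Rightarrow> nat \<Rightarrow> ('g, 'm) monoid_scheme \<Rightarrow> 'g topology \<Rightarrow> 'g set \<Rightarrow>
   ('g \<Rightarrow> ereal) \<Rightarrow> nat \<Rightarrow> (nat \<Rightarrow> 'g) \<Rightarrow> bool" where
  "ordered_basis K p G T H \<omega> d b \<longleftrightarrow>
     (\<forall>i<d. b i \<in> H - {\<one>\<^bsub>G\<^esub>}) \<and>
     homeomorphic_map (subtopology (affine_space d) (Zp_box d :: (nat \<Rightarrow> 'k) set))
       (subtopology T H) (basis_product G T d b) \<and>
     (\<forall>x \<in> (Zp_box d :: (nat \<Rightarrow> 'k) set).
        \<omega> (basis_product G T d b x) = (INF i\<in>{..<d}. \<omega> (b i) + padic_val p (x i)))"

text \<open>The subgroup \<open>G\<^sub>n\<close> of \<open>p\<^sup>n\<close>-th powers of elements of \<open>H = G\<^sub>0\<close>.\<close>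
definition power_subgroup :: "nat \<Rightarrow> ('g, 'm) monoid_scheme \<Rightarrow> 'g set \<Rightarrow> nat \<Rightarrow> 'g set" where
  "power_subgroup p G H n = (\<lambda>g. g [^]\<^bsub>G\<^esub> (p ^ n)) ` H"


section \<open>Analytic functions on \<open>G\<^sub>n\<close>\<close>

text \<open>
  The coordinates of an ordered basis identify \<open>(p\<^sup>n\<int>\<^sub>p)\<^sup>d\<close> with \<open>G\<^sub>n\<close>; a function on \<open>G\<^sub>n\<close> is analytic
  if on \<open>\<int>\<^sub>p\<^sup>d\<close> it is given, in the coordinates rescaled by \<open>p\<^sup>n\<close>, by a power series with
  coefficients tending to 0. Functions on \<open>G\<^sub>n\<close> are extended by 0 outside \<open>G\<^sub>n\<close>.
\<close>
definition analytic_expansion ::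
  "nat \<Rightarrow> ('g, 'm) monoid_scheme \<Rightarrow> 'g topology \<Rightarrow> nat \<Rightarrow> (nat \<Rightarrow> 'g) \<Rightarrow> nat \<Rightarrow>
   ('g \<Rightarrow> 'k::ultrametric_field) \<Rightarrow> ((nat \<Rightarrow> nat) \<Rightarrow> 'k) \<Rightarrow> bool" where
  "analytic_expansion p G T d b n f a \<longleftrightarrow>
     null_family (multi_indices d) (\<lambda>\<alpha>. unorm (a \<alpha>)) \<and>
     (\<forall>x \<in> Zp_box d. ((\<lambda>\<alpha>. a \<alpha> * monomial d \<alpha> x) has_sum
        f (basis_product G T d b (\<lambda>i. of_nat (p ^ n) * x i))) (multi_indices d))"

definition analytic_functions ::
  "nat \<Rightarrow> ('g, 'm) monoid_scheme \<Rightarrow> 'g topology \<Rightarrow> 'g set \<Rightarrow> nat \<Rightarrow> (nat \<Rightarrow> 'g) \<Rightarrow> nat \<Rightarrow>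
   ('g \<Rightarrow> 'k::ultrametric_field) set" where
  "analytic_functions p G T H d b n =
     {f. (\<forall>x. x \<notin> power_subgroup p G H n \<longrightarrow> f x = 0) \<and> (\<exists>a. analytic_expansion p G T d b n f a)}"

text \<open>
  The norm is the maximum of the norms of the coefficients (which are uniquely determined, so
  that the infimum runs over the upper bounds of a single family).
\<close>
definition analytic_norm ::
  "nat \<Rightarrow> ('g, 'm) monoid_scheme \<Rightarrow> 'g topology \<Rightarrow> nat \<Rightarrow> (nat \<Rightarrow> 'g) \<Rightarrow> nat \<Rightarrow>
   ('g \<Rightarrow> 'k::ultrametric_field) \<Rightarrow> real" where
  "analytic_norm p G T d b n f =
     Inf {r. \<exists>a. analytic_expansion p G T d b n f a \<and> (\<forall>\<alpha> \<in> multi_indices d. unorm (a \<alpha>) \<le> r)}"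


section \<open>Completed tensor products\<close>

text \<open>
  Let \<open>F\<close> be a space of \<open>K\<close>-valued functions on a set, with norm \<open>N\<close>. The tensor \<open>\<Sum> w\<^sub>i \<otimes> f\<^sub>i\<close> is
  identified with the \<open>W\<close>-valued function \<open>x \<mapsto> \<Sum> f\<^sub>i(x) w\<^sub>i\<close>; this is injective on the algebraic
  tensor product \<open>W \<otimes> F\<close>. A list of pairs \<open>(w, f)\<close> represents a finite sum of pure tensors.
\<close>
definition tensor_sum ::
  "('k \<Rightarrow> 'w \<Rightarrow> 'w) \<Rightarrow> ('w \<times> ('g \<Rightarrow> 'k)) list \<Rightarrow> 'g \<Rightarrow> 'w::comm_monoid_add" where
  "tensor_sum smul L = (\<lambda>x. \<Sum>(w, f)\<leftarrow>L. smul (f x) w)"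

definition algebraic_tensor ::
  "('k \<Rightarrow> 'w \<Rightarrow> 'w::comm_monoid_add) \<Rightarrow> ('g \<Rightarrow> 'k) set \<Rightarrow> ('g \<Rightarrow> 'w) set" where
  "algebraic_tensor smul F = {tensor_sum smul L | L. snd ` set L \<subseteq> F}"

text \<open>The projective tensor norm: the infimum of \<open>max \<parallel>w\<^sub>i\<parallel> \<parallel>f\<^sub>i\<parallel>\<close> over representations \<open>\<Sum> w\<^sub>i \<otimes> f\<^sub>i\<close>.\<close>
definition tensor_norm ::
  "('k \<Rightarrow> 'w \<Rightarrow> 'w::ultrametric_group) \<Rightarrow> ('g \<Rightarrow> 'k) set \<Rightarrow> (('g \<Rightarrow> 'k) \<Rightarrow> real) \<Rightarrow>
   ('g \<Rightarrow> 'w) \<Rightarrow> real" where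
  "tensor_norm smul F N h =
     Inf {r. 0 \<le> r \<and> (\<exists>L. snd ` set L \<subseteq> F \<and> h = tensor_sum smul L \<and>
            (\<forall>(w, f) \<in> set L. unorm w * N f \<le> r))}"

text \<open>
  The completion of \<open>W \<otimes> F\<close> for this norm is again realised by functions: the class of a Cauchy
  sequence of tensors is the pointwise limit of the sequence. For \<open>F = C\<^sup>a\<^sup>n(G\<^sub>n, \<rat>\<^sub>p)\<close> this is
  injective on the completion, since \<open>F\<close> has the monomials as an orthonormal basis, an element of
  the completion is a series \<open>\<Sum> w\<^sub>\<alpha> \<otimes> x\<^sup>\<alpha>\<close> with \<open>w\<^sub>\<alpha> \<rightarrow> 0\<close>, and \<open>\<Sum> x\<^sup>\<alpha> w\<^sub>\<alpha> = 0\<close> on \<open>\<int>\<^sub>p\<^sup>d\<close> forces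
  all \<open>w\<^sub>\<alpha> = 0\<close>.
\<close>
definition tensor_approx ::
  "('k \<Rightarrow> 'w \<Rightarrow> 'w::ultrametric_group) \<Rightarrow> ('g \<Rightarrow> 'k) set \<Rightarrow> (('g \<Rightarrow> 'k) \<Rightarrow> real) \<Rightarrow>
   (nat \<Rightarrow> 'g \<Rightarrow> 'w) \<Rightarrow> ('g \<Rightarrow> 'w) \<Rightarrow> bool" where
  "tensor_approx smul F N s h \<longleftrightarrow>
     (\<forall>k. s k \<in> algebraic_tensor smul F) \<and>
     (\<forall>e>0. \<exists>M. \<forall>k\<ge>M. \<forall>l\<ge>M. tensor_norm smul F N (s k - s l) < e) \<and>
     (\<forall>x. (\<lambda>k. s k x) \<longlonglongrightarrow> h x)"

definition completed_tensor ::
  "('k \<Rightarrow> 'w \<Rightarrow> 'w::ultrametric_group) \<Rightarrow> ('g \<Rightarrow> 'k) set \<Rightarrow> (('g \<Rightarrow> 'k) \<Rightarrow> real) \<Rightarrow>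
   ('g \<Rightarrow> 'w) set" where
  "completed_tensor smul F N = {h. \<exists>s. tensor_approx smul F N s h}"

definition completed_tensor_norm ::
  "('k \<Rightarrow> 'w \<Rightarrow> 'w::ultrametric_group) \<Rightarrow> ('g \<Rightarrow> 'k) set \<Rightarrow> (('g \<Rightarrow> 'k) \<Rightarrow> real) \<Rightarrow>
   ('g \<Rightarrow> 'w) \<Rightarrow> real" where
  "completed_tensor_norm smul F N h =
     Inf {r. \<exists>s. tensor_approx smul F N s h \<and> (\<lambda>k. tensor_norm smul F N (s k)) \<longlonglongrightarrow> r}"

text \<open>
  The diagonal action of \<open>S\<close> on \<open>W\<close>-valued functions on \<open>S\<close>, which sends \<open>w \<otimes> f\<close> to
  \<open>g w \<otimes> f(g\<^sup>-\<^sup>1 \<cdot>)\<close>.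
\<close>
definition diagonal_action ::
  "('g, 'm) monoid_scheme \<Rightarrow> ('g \<Rightarrow> 'w \<Rightarrow> 'w) \<Rightarrow> 'g set \<Rightarrow> 'g \<Rightarrow> ('g \<Rightarrow> 'w::zero) \<Rightarrow> 'g \<Rightarrow> 'w" where
  "diagonal_action G \<rho> S g h = (\<lambda>x. if x \<in> S then \<rho> g (h (inv\<^bsub>G\<^esub> g \<otimes>\<^bsub>G\<^esub> x)) else 0)"

definition restrict_zero :: "'g set \<Rightarrow> ('g \<Rightarrow> 'w::zero) \<Rightarrow> 'g \<Rightarrow> 'w" where
  "restrict_zero S h = (\<lambda>x. if x \<in> S then h x else 0)"


section \<open>Continuous group cohomology\<close>

text \<open>
  Inhomogeneous cochains of a subgroup \<open>S\<close> of \<open>G\<close> with values in a normed module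
  \<open>M\<close> with norm \<open>N\<close> and action \<open>act\<close>. An element of \<open>S\<^sup>i\<close> is an extensional function on
  \<open>{..<i}\<close>; cochains are extended by 0 outside \<open>S\<^sup>i\<close>.
\<close>
definition tuples :: "'g set \<Rightarrow> nat \<Rightarrow> (nat \<Rightarrow> 'g) set" where
  "tuples S i = {..<i} \<rightarrow>\<^sub>E S"

definition cochains ::
  "'g topology \<Rightarrow> 'g set \<Rightarrow> 'v set \<Rightarrow> ('v \<Rightarrow> real) \<Rightarrow> nat \<Rightarrow> ((nat \<Rightarrow> 'g) \<Rightarrow> 'v::ab_group_add) set" where
  "cochains T S M N i =
     {f. (\<forall>\<sigma> \<in> tuples S i. f \<sigma> \<in> M) \<and> (\<forall>\<sigma>. \<sigma> \<notin> tuples S i \<longrightarrow> f \<sigma> = 0) \<and>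
         (\<forall>\<sigma> \<in> tuples S i. \<forall>e>0. \<exists>U. openin (product_topology (\<lambda>_. subtopology T S) {..<i}) U \<and>
            \<sigma> \<in> U \<and> (\<forall>\<tau>\<in>U. N (f \<tau> - f \<sigma>) < e))}"

text \<open>\<open>(g\<^sub>0, \<dots>, g\<^sub>i) \<mapsto> (g\<^sub>0, \<dots>, g\<^sub>j g\<^sub>j\<^sub>+\<^sub>1, \<dots>, g\<^sub>i)\<close>\<close>
definition merge_at ::
  "('g, 'm) monoid_scheme \<Rightarrow> nat \<Rightarrow> nat \<Rightarrow> (nat \<Rightarrow> 'g) \<Rightarrow> nat \<Rightarrow> 'g" where
  "merge_at G i j \<sigma> =
     (\<lambda>l\<in>{..<i}. if l < j then \<sigma> l else if l = j then \<sigma> j \<otimes>\<^bsub>G\<^esub> \<sigma> (Suc j) else \<sigma> (Suc l))"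

definition alternate :: "nat \<Rightarrow> 'v::ab_group_add \<Rightarrow> 'v" where
  "alternate k v = (if even k then v else - v)"

definition coboundary ::
  "('g, 'm) monoid_scheme \<Rightarrow> 'g set \<Rightarrow> ('g \<Rightarrow> 'v \<Rightarrow> 'v) \<Rightarrow> nat \<Rightarrow>
   ((nat \<Rightarrow> 'g) \<Rightarrow> 'v::ab_group_add) \<Rightarrow> (nat \<Rightarrow> 'g) \<Rightarrow> 'v" where
  "coboundary G S act i f = (\<lambda>\<sigma>. if \<sigma> \<in> tuples S (Suc i)
     then act (\<sigma> 0) (f (\<lambda>l\<in>{..<i}. \<sigma> (Suc l)))
          + (\<Sum>j<i. alternate (Suc j) (f (merge_at G i j \<sigma>)))
          + alternate (Suc i) (f (restrict \<sigma> {..<i}))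
     else 0)"

definition cocycles ::
  "('g, 'm) monoid_scheme \<Rightarrow> 'g topology \<Rightarrow> 'g set \<Rightarrow> 'v set \<Rightarrow> ('v \<Rightarrow> real) \<Rightarrow> ('g \<Rightarrow> 'v \<Rightarrow> 'v) \<Rightarrow>
   nat \<Rightarrow> ((nat \<Rightarrow> 'g) \<Rightarrow> 'v::ab_group_add) set" where
  "cocycles G T S M N act i = {f \<in> cochains T S M N i. coboundary G S act i f = 0}"

definition coboundaries ::
  "('g, 'm) monoid_scheme \<Rightarrow> 'g topology \<Rightarrow> 'g set \<Rightarrow> 'v set \<Rightarrow> ('v \<Rightarrow> real) \<Rightarrow> ('g \<Rightarrow> 'v \<Rightarrow> 'v) \<Rightarrow>
   nat \<Rightarrow> ((nat \<Rightarrow> 'g) \<Rightarrow> 'v::ab_group_add) set" where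
  "coboundaries G T S M N act i =
     (case i of 0 \<Rightarrow> {0} | Suc j \<Rightarrow> coboundary G S act j ` cochains T S M N j)"

definition additive_group :: "'a::ab_group_add set \<Rightarrow> 'a monoid" where
  "additive_group A = \<lparr>carrier = A, mult = (+), one = 0\<rparr>"

definition continuous_cohomology ::
  "('g, 'm) monoid_scheme \<Rightarrow> 'g topology \<Rightarrow> 'g set \<Rightarrow> 'v set \<Rightarrow> ('v \<Rightarrow> real) \<Rightarrow> ('g \<Rightarrow> 'v \<Rightarrow> 'v) \<Rightarrow>
   nat \<Rightarrow> ((nat \<Rightarrow> 'g) \<Rightarrow> 'v::ab_group_add) set monoid" where
  "continuous_cohomology G T S M N act i =
     additive_group (cocycles G T S M N act i) Mod coboundaries G T S M N act i"

text \<open>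
  The direct limit (over \<open>\<nat>\<close>) of groups \<open>A n\<close> along transition maps \<open>t n m\<close> (\<open>n \<le> m\<close>), as a set,
  and its neutral element.
\<close>
definition direct_limit_rel ::
  "(nat \<Rightarrow> 'c monoid) \<Rightarrow> (nat \<Rightarrow> nat \<Rightarrow> 'c \<Rightarrow> 'c) \<Rightarrow> ((nat \<times> 'c) \<times> (nat \<times> 'c)) set" where
  "direct_limit_rel A t = {((n, x), (m, y)). x \<in> carrier (A n) \<and> y \<in> carrier (A m) \<and>
     (\<exists>k. n \<le> k \<and> m \<le> k \<and> t n k x = t m k y)}"

definition direct_limit ::
  "(nat \<Rightarrow> 'c monoid) \<Rightarrow> (nat \<Rightarrow> nat \<Rightarrow> 'c \<Rightarrow> 'c) \<Rightarrow> (nat \<times> 'c) set set" where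
  "direct_limit A t = (SIGMA n:UNIV. carrier (A n)) // direct_limit_rel A t"

definition direct_limit_zero ::
  "(nat \<Rightarrow> 'c monoid) \<Rightarrow> (nat \<Rightarrow> nat \<Rightarrow> 'c \<Rightarrow> 'c) \<Rightarrow> (nat \<times> 'c) set" where
  "direct_limit_zero A t = direct_limit_rel A t `` {(0, \<one>\<^bsub>A 0\<^esub>)}"


section \<open>\<open>LA\<close>-acyclicity\<close>

text \<open>
  In this section \<open>H\<close> is the compact open subgroup \<open>G\<^sub>0\<close>, with ordered basis \<open>b\<^sub>0, \<dots>, b\<^sub>d\<^sub>-\<^sub>1\<close>.
\<close>

definition W_analytic ::
  "nat \<Rightarrow> ('g, 'm) monoid_scheme \<Rightarrow> 'g topology \<Rightarrow> 'g set \<Rightarrow> nat \<Rightarrow> (nat \<Rightarrow> 'g) \<Rightarrow>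
   ('k::ultrametric_field \<Rightarrow> 'w \<Rightarrow> 'w::ultrametric_group) \<Rightarrow> nat \<Rightarrow> ('g \<Rightarrow> 'w) set" where
  "W_analytic p G T H d b smul n =
     completed_tensor smul (analytic_functions p G T H d b n) (analytic_norm p G T d b n)"

definition W_analytic_norm ::
  "nat \<Rightarrow> ('g, 'm) monoid_scheme \<Rightarrow> 'g topology \<Rightarrow> 'g set \<Rightarrow> nat \<Rightarrow> (nat \<Rightarrow> 'g) \<Rightarrow>
   ('k::ultrametric_field \<Rightarrow> 'w \<Rightarrow> 'w::ultrametric_group) \<Rightarrow> nat \<Rightarrow> ('g \<Rightarrow> 'w) \<Rightarrow> real" where
  "W_analytic_norm p G T H d b smul n =
     completed_tensor_norm smul (analytic_functions p G T H d b n) (analytic_norm p G T d b n)"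

definition la_cohomology ::
  "nat \<Rightarrow> ('g, 'm) monoid_scheme \<Rightarrow> 'g topology \<Rightarrow> 'g set \<Rightarrow> nat \<Rightarrow> (nat \<Rightarrow> 'g) \<Rightarrow>
   ('k::ultrametric_field \<Rightarrow> 'w \<Rightarrow> 'w::ultrametric_group) \<Rightarrow> ('g \<Rightarrow> 'w \<Rightarrow> 'w) \<Rightarrow> nat \<Rightarrow> nat \<Rightarrow>
   ((nat \<Rightarrow> 'g) \<Rightarrow> 'g \<Rightarrow> 'w) set monoid" where
  "la_cohomology p G T H d b smul \<rho> i n =
     continuous_cohomology G T (power_subgroup p G H n)
       (W_analytic p G T H d b smul n) (W_analytic_norm p G T H d b smul n)
       (diagonal_action G \<rho> (power_subgroup p G H n)) i"

text \<open>
  The transition maps: restriction of cochains to \<open>G\<^sub>m\<^sup>i\<close> and of their values to \<open>G\<^sub>m\<close>, and the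
  induced map on classes, which sends \<open>z + B\<^sup>i(G\<^sub>n)\<close> to \<open>z|\<^sub>m + B\<^sup>i(G\<^sub>m)\<close>.
\<close>
definition restrict_cochain ::
  "'g set \<Rightarrow> nat \<Rightarrow> ((nat \<Rightarrow> 'g) \<Rightarrow> 'g \<Rightarrow> 'w) \<Rightarrow> (nat \<Rightarrow> 'g) \<Rightarrow> 'g \<Rightarrow> 'w::zero" where
  "restrict_cochain S i f = (\<lambda>\<sigma>. if \<sigma> \<in> tuples S i then restrict_zero S (f \<sigma>) else (\<lambda>_. 0))"

definition la_transition ::
  "nat \<Rightarrow> ('g, 'm) monoid_scheme \<Rightarrow> 'g topology \<Rightarrow> 'g set \<Rightarrow> nat \<Rightarrow> (nat \<Rightarrow> 'g) \<Rightarrow>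
   ('k::ultrametric_field \<Rightarrow> 'w \<Rightarrow> 'w::ultrametric_group) \<Rightarrow> ('g \<Rightarrow> 'w \<Rightarrow> 'w) \<Rightarrow> nat \<Rightarrow> nat \<Rightarrow> nat \<Rightarrow>
   ((nat \<Rightarrow> 'g) \<Rightarrow> 'g \<Rightarrow> 'w) set \<Rightarrow> ((nat \<Rightarrow> 'g) \<Rightarrow> 'g \<Rightarrow> 'w) set" where
  "la_transition p G T H d b smul \<rho> i n m X =
     {restrict_cochain (power_subgroup p G H m) i z + c | z c. z \<in> X \<and>
        c \<in> coboundaries G T (power_subgroup p G H m)
              (W_analytic p G T H d b smul m) (W_analytic_norm p G T H d b smul m)
              (diagonal_action G \<rho> (power_subgroup p G H m)) i}"

definition LA_acyclic ::
  "nat \<Rightarrow> ('g, 'm) monoid_scheme \<Rightarrow> 'g topology \<Rightarrow> 'g set \<Rightarrow> nat \<Rightarrow> (nat \<Rightarrow> 'g) \<Rightarrow>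
   ('k::ultrametric_field \<Rightarrow> 'w \<Rightarrow> 'w::ultrametric_group) \<Rightarrow> ('g \<Rightarrow> 'w \<Rightarrow> 'w) \<Rightarrow> bool" where
  "LA_acyclic p G T H d b smul \<rho> \<longleftrightarrow>
     (\<forall>i\<ge>1. direct_limit (la_cohomology p G T H d b smul \<rho> i) (la_transition p G T H d b smul \<rho> i)
        = {direct_limit_zero (la_cohomology p G T H d b smul \<rho> i)
             (la_transition p G T H d b smul \<rho> i)})"

definition strongly_LA_acyclic ::
  "nat \<Rightarrow> ('g, 'm) monoid_scheme \<Rightarrow> 'g topology \<Rightarrow> 'g set \<Rightarrow> nat \<Rightarrow> (nat \<Rightarrow> 'g) \<Rightarrow>
   ('k::ultrametric_field \<Rightarrow> 'w \<Rightarrow> 'w::ultrametric_group) \<Rightarrow> ('g \<Rightarrow> 'w \<Rightarrow> 'w) \<Rightarrow> bool" where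
  "strongly_LA_acyclic p G T H d b smul \<rho> \<longleftrightarrow>
     (\<forall>i\<ge>1. \<forall>n. \<exists>m\<ge>n. \<forall>X \<in> carrier (la_cohomology p G T H d b smul \<rho> i n).
        la_transition p G T H d b smul \<rho> i n m X = \<one>\<^bsub>la_cohomology p G T H d b smul \<rho> i m\<^esub>)"

end

theory Submission
  imports Defs "HOL-Number_Theory.Cong"
begin

text \<open>
  Write \<open>G\<^sub>n\<close> for the subgroup of \<open>p\<^sup>n\<close>-th powers and \<open>A\<^sub>n\<close> for the completed tensor product of \<open>W\<close> with
  the analytic functions on \<open>G\<^sub>n\<close>. Acyclicity kills each class of degree \<open>i = j + 1\<close> on \<open>G\<^sub>n\<close> at a stage
  \<open>m\<close> that depends on the class. Baire's theorem makes the stage uniform. Let \<open>Z\<close> be the space of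
  continuous \<open>i\<close>-cocycles of \<open>G\<^sub>n\<close> with values in \<open>A\<^sub>n\<close>; as \<open>G\<^sub>n\<close> is compact, it is a Banach space for
  the supremum norm. For \<open>m \<ge> n\<close> let \<open>E\<^sub>m\<close> consist of the pairs \<open>(z, c)\<close> of a cocycle \<open>z \<in> Z\<close> and a
  \<open>j\<close>-cochain \<open>c\<close> of \<open>G\<^sub>m\<close> with values in \<open>A\<^sub>m\<close> such that \<open>z\<close> restricts to the coboundary of \<open>c\<close>. This is
  a closed linear relation between Banach spaces, and acyclicity says that the projections of the
  \<open>E\<^sub>m\<close> to \<open>Z\<close> cover \<open>Z\<close>. Hence for one \<open>m\<close> and some bound \<open>r\<close> the set of \<open>z\<close> that have a partner of norm
  at most \<open>r\<close> is dense in some ball, and the successive approximation of the open mapping theorem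
  shows that \<open>E\<^sub>m\<close> projects onto \<open>Z\<close> (\<open>closed_relations_cover_imp_onto\<close>). So every cocycle of \<open>G\<^sub>n\<close> becomes
  a coboundary on this \<open>G\<^sub>m\<close> (\<open>uniform_vanishing\<close>).

  The work lies in showing that the spaces are complete and the relations closed. Both rest on one
  inequality: the norm of a function bounds its values. Since the coboundary and restriction are
  given by formulas in the values of a cochain, convergence in norm then implies convergence of
  every term, and closedness follows from uniqueness of limits. The same inequality lets a Cauchy
  sequence of tensors converge pointwise, which gives the completeness of \<open>A\<^sub>n\<close>
  (\<open>dominated_tensor.V_complete\<close>).

  For an analytic function on \<open>G\<^sub>n\<close> the norm is read off from a power series on \<open>\<int>\<^sub>p\<^sup>d\<close>, so that the
  inequality (\<open>analytic_dominated\<close>) requires the points with coordinates in \<open>p\<^sup>n\<int>\<^sub>p\<close> to fill \<open>G\<^sub>n\<close>. This is where the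
  \<open>p\<close>-valuation \<open>\<omega>\<close> enters. Saturation gives \<open>G\<^sub>n = {g. \<omega> g > n + 1/(p - 1)}\<close>, and the claim follows
  from the bound \<open>\<omega> (b i) \<le> p/(p - 1)\<close> on the members of the basis (\<open>basis_val_le\<close>): a basis
  element of larger valuation would be a \<open>p\<close>-th power, which is incompatible with the formula for
  \<open>\<omega>\<close> in coordinates.
\<close>

section \<open>Banach spaces over an ultrametric field\<close>

lemma unorm_nonneg: "0 \<le> unorm (x :: 'a::ultrametric_group)"
  by (simp add: unorm_dist)

lemma unorm_zero: "unorm (0 :: 'a::ultrametric_group) = 0"
  by (simp add: unorm_dist)

lemma unorm_eq_0_iff: "unorm (x :: 'a::ultrametric_group) = 0 \<longleftrightarrow> x = 0"
  by (simp add: unorm_dist)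

lemma unorm_pos: "x \<noteq> 0 \<Longrightarrow> 0 < unorm (x :: 'a::ultrametric_group)"
  using unorm_nonneg[of x] unorm_eq_0_iff[of x] by linarith

lemma unorm_one: "unorm (1 :: 'a::ultrametric_field) = 1"
proof -
  have "unorm (1::'a) * unorm (1::'a) = unorm (1::'a)" by (simp flip: unorm_mult)
  moreover have "unorm (1::'a) \<noteq> 0" by (simp add: unorm_eq_0_iff)
  ultimately show ?thesis by simp
qed

lemma unorm_power: "unorm (x ^ n :: 'a::ultrametric_field) = unorm x ^ n"
  by (induction n) (simp_all add: unorm_one unorm_mult)

lemma unorm_inverse: "unorm (inverse x :: 'a::ultrametric_field) = inverse (unorm x)"
proof (cases "x = 0")
  case False
  then have "unorm x * unorm (inverse x) = 1" by (simp flip: unorm_mult add: unorm_one)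
  then show ?thesis by (metis inverse_unique)
qed (simp add: unorm_zero)

lemma ultrametric_chain_less:
  fixes \<delta> :: "nat \<Rightarrow> nat \<Rightarrow> real"
  assumes "\<And>i j k. \<delta> i k \<le> max (\<delta> i j) (\<delta> j k)" "\<And>i j. \<delta> i j = \<delta> j i" "\<And>i. \<delta> i i = 0"
    and "0 < e" "\<And>k. K \<le> k \<Longrightarrow> \<delta> (Suc k) k < e" and kl: "K \<le> k" "K \<le> l"
  shows "\<delta> k l < e"
proof -
  have *: "\<delta> k K < e" if "K \<le> k" for k
    using that
  proof (induction k rule: dec_induct)
    case base
    then show ?case using assms(3,4) by simp
  next
    case (step k)
    then show ?case using assms(1)[of "Suc k" K k] assms(5)[of k] by simp
  qed
  show ?thesis using *[OF kl(1)] *[OF kl(2)] assms(1)[of k l K] assms(2)[of K l] by simp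
qed

lemma vector_space_pointwise:
  assumes "vector_space sc"
  shows "vector_space (\<lambda>a (h :: 'x \<Rightarrow> 'v::ab_group_add) x. sc (a :: 'k::field) (h x))"
proof -
  interpret vector_space sc by fact
  show ?thesis
    by unfold_locales (simp_all add: fun_eq_iff scale_right_distrib scale_left_distrib)
qed

text \<open>
  A Banach space is carried by a subset of a larger vector space, because the spaces of cochains and
  of functions below are subsets of function types. Over an ultrametric field a sequence is Cauchy
  as soon as its consecutive differences tend to 0, so completeness is stated for such sequences.
\<close>
locale banach_subspace = vector_space sc
  for sc :: "'k::ultrametric_field \<Rightarrow> 'v::ab_group_add \<Rightarrow> 'v" +
  fixes M :: "'v set" and N :: "'v \<Rightarrow> real"
  assumes zero_mem: "0 \<in> M"
    and add_mem: "u \<in> M \<Longrightarrow> v \<in> M \<Longrightarrow> u + v \<in> M"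
    and scale_mem: "v \<in> M \<Longrightarrow> sc a v \<in> M"
    and nonneg: "v \<in> M \<Longrightarrow> 0 \<le> N v"
    and eq_zero: "v \<in> M \<Longrightarrow> N v = 0 \<Longrightarrow> v = 0"
    and add_le_max: "u \<in> M \<Longrightarrow> v \<in> M \<Longrightarrow> N (u + v) \<le> max (N u) (N v)"
    and norm_scale_le: "v \<in> M \<Longrightarrow> N (sc a v) \<le> unorm a * N v"
    and complete: "(\<And>k. s k \<in> M) \<Longrightarrow> (\<lambda>k. N (s (Suc k) - s k)) \<longlonglongrightarrow> 0 \<Longrightarrow>
      \<exists>v\<in>M. (\<lambda>k. N (s k - v)) \<longlonglongrightarrow> 0"
begin

lemma norm_scale:
  assumes v: "v \<in> M" shows "N (sc a v) = unorm a * N v"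
proof (cases "a = 0")
  case True
  then show ?thesis
    using norm_scale_le[OF v, of 0] nonneg[OF zero_mem] by (simp add: unorm_zero)
next
  case False
  then have a: "0 < unorm a" by (rule unorm_pos)
  have "N v \<le> inverse (unorm a) * N (sc a v)"
    using norm_scale_le[OF scale_mem[OF v], of "inverse a" a] False by (simp add: unorm_inverse)
  then have "unorm a * N v \<le> N (sc a v)" using a by (simp add: field_simps)
  then show ?thesis using norm_scale_le[OF v, of a] by simp
qed

lemma minus_mem: "v \<in> M \<Longrightarrow> - v \<in> M"
  using scale_mem[of v "- 1"] by simp

lemma diff_mem: "u \<in> M \<Longrightarrow> v \<in> M \<Longrightarrow> u - v \<in> M"
  using add_mem[of u "- v"] minus_mem by simp

lemma norm_zero: "N 0 = 0"
  using norm_scale[OF zero_mem, of 0] by (simp add: unorm_zero)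

lemma norm_minus: "v \<in> M \<Longrightarrow> N (- v) = N v"
  using norm_scale[of v "- 1"] by (simp add: unorm_minus unorm_one)

lemma norm_minus_commute: "u \<in> M \<Longrightarrow> v \<in> M \<Longrightarrow> N (u - v) = N (v - u)"
  using norm_minus[OF diff_mem, of v u] by simp

lemma diff_le_max: "u \<in> M \<Longrightarrow> v \<in> M \<Longrightarrow> N (u - v) \<le> max (N u) (N v)"
  using add_le_max[of u "- v"] minus_mem[of v] norm_minus[of v] by simp

lemma dist_le_max: "u \<in> M \<Longrightarrow> v \<in> M \<Longrightarrow> w \<in> M \<Longrightarrow> N (u - w) \<le> max (N (u - v)) (N (v - w))"
  using add_le_max[of "u - v" "v - w"] by (simp add: diff_mem)

lemma closed_subspace:
  assumes M': "M' \<subseteq> M" "0 \<in> M'" "\<And>u v. u \<in> M' \<Longrightarrow> v \<in> M' \<Longrightarrow> u + v \<in> M'"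
      "\<And>a v. v \<in> M' \<Longrightarrow> sc a v \<in> M'"
    and closed: "\<And>s v. (\<And>k. s k \<in> M') \<Longrightarrow> v \<in> M \<Longrightarrow> (\<lambda>k. N (s k - v)) \<longlonglongrightarrow> 0 \<Longrightarrow> v \<in> M'"
  shows "banach_subspace sc M' N"
proof
  fix s assume s: "\<And>k. s k \<in> M'" "(\<lambda>k. N (s (Suc k) - s k)) \<longlonglongrightarrow> 0"
  then obtain v where "v \<in> M" "(\<lambda>k. N (s k - v)) \<longlonglongrightarrow> 0"
    using complete[of s] M'(1) by blast
  then show "\<exists>v\<in>M'. (\<lambda>k. N (s k - v)) \<longlonglongrightarrow> 0" using closed s(1) by blast
qed (use M' in \<open>auto intro!: nonneg eq_zero add_le_max norm_scale_le simp: subset_iff\<close>)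

sublocale metric: Metric_space M "\<lambda>u v. if u \<in> M \<and> v \<in> M then N (u - v) else 0"
proof
  fix u v w assume "u \<in> M" "v \<in> M" "w \<in> M"
  then show "(if u \<in> M \<and> w \<in> M then N (u - w) else 0)
      \<le> (if u \<in> M \<and> v \<in> M then N (u - v) else 0) + (if v \<in> M \<and> w \<in> M then N (v - w) else 0)"
    using dist_le_max[of u v w] nonneg[OF diff_mem, of u v] nonneg[OF diff_mem, of v w] by auto
qed (auto simp: nonneg diff_mem norm_minus_commute norm_zero dest: eq_zero[OF diff_mem, rotated 2])

lemma mcomplete: "metric.mcomplete"
  unfolding metric.mcomplete_def
proof (intro allI impI)
  fix s assume s: "metric.MCauchy s"
  then have mem: "s k \<in> M" for k by (auto simp: metric.MCauchy_def)
  have "(\<lambda>k. N (s (Suc k) - s k)) \<longlonglongrightarrow> 0"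
  proof (rule LIMSEQ_I)
    fix e :: real assume "0 < e"
    then obtain K where "\<forall>n n'. K \<le> n \<longrightarrow> K \<le> n' \<longrightarrow> N (s n - s n') < e"
      using s mem by (auto simp: metric.MCauchy_def)
    then have "norm (N (s (Suc k) - s k) - 0) < e" if "k \<ge> K" for k
      using that nonneg[OF diff_mem[OF mem mem]] by simp
    then show "\<exists>K. \<forall>k\<ge>K. norm (N (s (Suc k) - s k) - 0) < e" by blast
  qed
  then obtain v where "v \<in> M" "(\<lambda>k. N (s k - v)) \<longlonglongrightarrow> 0"
    using complete[of s] mem by blast
  then show "\<exists>v. limitin metric.mtopology s v sequentially"
    by (auto simp: metric.limitin_metric_dist_null mem)
qed

end

section \<open>Closed linear relations between Banach spaces\<close>

text \<open>
  The second half of the open mapping theorem, for a relation in place of a map. The density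
  hypothesis scales: a vector \<open>z\<close> of norm below \<open>e q\<^sup>k\<close>, with \<open>q\<close> the norm of \<open>t\<close>, is approximated up
  to \<open>e q\<^sup>k\<^sup>+\<^sup>1\<close> by a vector with a partner of norm at most \<open>r q\<^sup>k\<close>. Iterating, the partners form a convergent
  series, and closedness relates \<open>z\<close> to its sum.
\<close>
lemma closed_relation_onto:
  fixes sc :: "'k::ultrametric_field \<Rightarrow> 'v::ab_group_add \<Rightarrow> 'v"
    and sd :: "'k \<Rightarrow> 'u::ab_group_add \<Rightarrow> 'u"
  assumes Z: "banach_subspace sc Z NZ" and C: "banach_subspace sd C NC"
    and t: "t \<noteq> 0" "unorm (t :: 'k) < 1"
    and R_add: "\<And>z z' c c'. R z c \<Longrightarrow> R z' c' \<Longrightarrow> R (z + z') (c + c')"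
    and R_scale: "\<And>a z c. R z c \<Longrightarrow> R (sc a z) (sd a c)"
    and R_zero: "R 0 0"
    and R_closed: "\<And>f g z c. (\<And>k. f k \<in> Z) \<Longrightarrow> (\<And>k. g k \<in> C) \<Longrightarrow> (\<And>k. R (f k) (g k)) \<Longrightarrow>
        z \<in> Z \<Longrightarrow> c \<in> C \<Longrightarrow> (\<lambda>k. NZ (f k - z)) \<longlonglongrightarrow> 0 \<Longrightarrow> (\<lambda>k. NC (g k - c)) \<longlonglongrightarrow> 0 \<Longrightarrow> R z c"
    and e: "0 < e"
    and dense: "\<And>z \<delta>. z \<in> Z \<Longrightarrow> NZ z < e \<Longrightarrow> 0 < \<delta> \<Longrightarrow>
        \<exists>a\<in>Z. \<exists>c\<in>C. NC c \<le> r \<and> R a c \<and> NZ (z - a) < \<delta>"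
    and z: "z \<in> Z"
  shows "\<exists>c\<in>C. R z c"
proof -
  interpret Z: banach_subspace sc Z NZ by fact
  interpret C: banach_subspace sd C NC by fact
  define q where "q = unorm t"
  have q: "0 < q" "q < 1"
    using t unorm_pos[of t] by (auto simp: q_def)
  have cancel: "sc (t ^ k) (sc (inverse (t ^ k)) v) = v" "sc (inverse (t ^ k)) (sc (t ^ k) v) = v"
    for k v using t(1) by simp_all
  have step: "\<exists>a\<in>Z. \<exists>c\<in>C. NC c \<le> q ^ k * r \<and> R a c \<and> NZ (z - a) < e * q ^ Suc k"
    if z: "z \<in> Z" "NZ z < e * q ^ k" for z k
  proof -
    have "NZ (sc (inverse (t ^ k)) z) < e"
      using z q by (simp add: Z.norm_scale unorm_inverse unorm_power flip: q_def)
        (simp add: field_simps)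
    from dense[OF Z.scale_mem[OF z(1)] this, of "e * q"] e q
    obtain a c where ac: "a \<in> Z" "c \<in> C" "NC c \<le> r" "R a c"
        "NZ (sc (inverse (t ^ k)) z - a) < e * q" by auto
    have "NZ (z - sc (t ^ k) a) = NZ (sc (t ^ k) (sc (inverse (t ^ k)) z - a))"
      by (simp only: Z.scale_right_diff_distrib cancel)
    also have "\<dots> = q ^ k * NZ (sc (inverse (t ^ k)) z - a)"
      using z ac by (simp only: Z.norm_scale Z.diff_mem Z.scale_mem unorm_power q_def)
    also have "\<dots> < q ^ k * (e * q)" using ac(5) q by simp
    finally have "NZ (z - sc (t ^ k) a) < e * q ^ Suc k" by (simp add: mult_ac)
    moreover have "NC (sd (t ^ k) c) \<le> q ^ k * r"
      using ac q by (simp add: C.norm_scale unorm_power flip: q_def)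
    ultimately show ?thesis
      using Z.scale_mem[OF ac(1)] C.scale_mem[OF ac(2)] R_scale[OF ac(4)] by blast
  qed
  have ball: "\<exists>c\<in>C. R z c" if z: "z \<in> Z" "NZ z < e" for z
  proof -
    \<comment> \<open>\<open>y\<close> is the part of \<open>z\<close> that remains after \<open>k\<close> steps, \<open>x\<close> the sum of the partners found so far\<close>
    define P where "P = (\<lambda>k (y, x). y \<in> Z \<and> x \<in> C \<and> NZ y < e * q ^ k \<and> R (z - y) x)"
    define Q where "Q = (\<lambda>k (y :: 'v, x) (y' :: 'v, x'). NC (x' - x) \<le> q ^ k * r)"
    have "\<exists>f. \<forall>k. P k (f k) \<and> Q k (f k) (f (Suc k))"
    proof (rule dependent_nat_choice)
      have "P 0 (z, 0)" using z R_zero by (simp add: P_def C.zero_mem)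
      then show "\<exists>s. P 0 s" ..
      fix s k assume "P k s"
      then obtain y x where s: "s = (y, x)" "y \<in> Z" "x \<in> C" "NZ y < e * q ^ k" "R (z - y) x"
        by (cases s) (auto simp: P_def)
      from step[OF s(2,4)] obtain a c where ac: "a \<in> Z" "c \<in> C" "NC c \<le> q ^ k * r" "R a c"
        "NZ (y - a) < e * q ^ Suc k" by auto
      have "R (z - (y - a)) (x + c)" using R_add[OF s(5) ac(4)] by (simp add: algebra_simps)
      then have "P (Suc k) (y - a, x + c) \<and> Q k s (y - a, x + c)"
        using s ac by (simp add: P_def Q_def Z.diff_mem C.add_mem)
      then show "\<exists>s'. P (Suc k) s' \<and> Q k s s'" ..
    qed
    then obtain f where f: "P k (f k)" "Q k (f k) (f (Suc k))" for k by blast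
    define y x where "y k = fst (f k)" and "x k = snd (f k)" for k
    have yx: "y k \<in> Z" "x k \<in> C" "NZ (y k) < e * q ^ k" "R (z - y k) (x k)"
        "NC (x (Suc k) - x k) \<le> q ^ k * r" for k
      using f[of k] by (auto simp: y_def x_def P_def Q_def case_prod_beta)
    have pow: "(\<lambda>k. q ^ k) \<longlonglongrightarrow> 0" using q by (simp add: LIMSEQ_realpow_zero)
    have "(\<lambda>k. NC (x (Suc k) - x k)) \<longlonglongrightarrow> 0"
    proof (rule real_tendsto_sandwich[OF _ _ tendsto_const])
      show "(\<lambda>k. q ^ k * r) \<longlonglongrightarrow> 0" using tendsto_mult_right[OF pow, of r] by simp
    qed (use yx(2,5) in \<open>auto simp: C.nonneg C.diff_mem\<close>)
    then obtain c where c: "c \<in> C" "(\<lambda>k. NC (x k - c)) \<longlonglongrightarrow> 0"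
      using C.complete[of x] yx(2) by blast
    have "(\<lambda>k. NZ (y k)) \<longlonglongrightarrow> 0"
    proof (rule real_tendsto_sandwich[OF _ _ tendsto_const])
      show "(\<lambda>k. e * q ^ k) \<longlonglongrightarrow> 0" using tendsto_mult_left[OF pow, of e] by simp
    qed (use yx(1) less_imp_le[OF yx(3)] in \<open>auto simp: Z.nonneg\<close>)
    then have "(\<lambda>k. NZ ((z - y k) - z)) \<longlonglongrightarrow> 0" by (simp add: Z.norm_minus yx(1))
    from R_closed[OF _ yx(2) yx(4) z(1) c(1) this c(2)] show ?thesis
      using z(1) yx(1) c(1) Z.diff_mem by blast
  qed
  have "(\<lambda>k. q ^ k * NZ z) \<longlonglongrightarrow> 0"
    using tendsto_mult_right[OF LIMSEQ_realpow_zero, of q "NZ z"] q by simp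
  then have "\<forall>\<^sub>F k in sequentially. q ^ k * NZ z < e" using e by (simp add: order_tendstoD)
  then obtain k where "q ^ k * NZ z < e" by (auto simp: eventually_sequentially)
  then have "NZ (sc (t ^ k) z) < e" using z by (simp add: Z.norm_scale unorm_power q_def)
  from ball[OF Z.scale_mem[OF z] this] obtain c where "c \<in> C" "R (sc (t ^ k) z) c" by blast
  then show ?thesis using R_scale[of "sc (t ^ k) z" c "inverse (t ^ k)"] C.scale_mem cancel(2) by auto
qed

text \<open>
  By Baire's theorem the closure of one of the countably many sets
  \<open>A (m, r) = {z. z has a partner of norm at most r for R m}\<close> contains a ball. These sets are
  subgroups by the ultrametric inequality, so the closure also contains the ball of the same radius
  around 0, which is the density hypothesis of \<open>closed_relation_onto\<close>.
\<close>
lemma closed_relations_cover_imp_onto: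
  fixes sc :: "'k::ultrametric_field \<Rightarrow> 'v::ab_group_add \<Rightarrow> 'v"
    and sd :: "'k \<Rightarrow> 'u::ab_group_add \<Rightarrow> 'u" and C :: "nat \<Rightarrow> 'u set"
  assumes Z: "banach_subspace sc Z NZ" and C: "\<And>m. banach_subspace sd (C m) (NC m)"
    and t: "t \<noteq> 0" "unorm (t :: 'k) < 1"
    and R_add: "\<And>m z z' c c'. R m z c \<Longrightarrow> R m z' c' \<Longrightarrow> R m (z + z') (c + c')"
    and R_scale: "\<And>m a z c. R m z c \<Longrightarrow> R m (sc a z) (sd a c)"
    and R_zero: "\<And>m. R m 0 0"
    and R_closed: "\<And>m f g z c. (\<And>k. f k \<in> Z) \<Longrightarrow> (\<And>k. g k \<in> C m) \<Longrightarrow> (\<And>k. R m (f k) (g k)) \<Longrightarrow>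
        z \<in> Z \<Longrightarrow> c \<in> C m \<Longrightarrow> (\<lambda>k. NZ (f k - z)) \<longlonglongrightarrow> 0 \<Longrightarrow> (\<lambda>k. NC m (g k - c)) \<longlonglongrightarrow> 0 \<Longrightarrow> R m z c"
    and cover: "\<And>z. z \<in> Z \<Longrightarrow> \<exists>m. \<exists>c\<in>C m. R m z c"
  shows "\<exists>m. \<forall>z\<in>Z. \<exists>c\<in>C m. R m z c"
proof -
  interpret Z: banach_subspace sc Z NZ by fact
  interpret C: banach_subspace sd "C m" "NC m" for m by fact
  define A where "A = (\<lambda>(m, r). {z \<in> Z. \<exists>c\<in>C m. NC m c \<le> real r \<and> R m z c})"
  have A_diff: "u - v \<in> A mr" if uv: "u \<in> A mr" "v \<in> A mr" for u v mr
  proof -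
    obtain m r where mr: "mr = (m, r)" by (cases mr)
    from uv obtain c c' where c: "u \<in> Z" "v \<in> Z" "c \<in> C m" "c' \<in> C m" "NC m c \<le> real r"
      "NC m c' \<le> real r" "R m u c" "R m v c'" by (auto simp: A_def mr)
    have "R m (u - v) (c - c')" using R_add[OF c(7) R_scale[OF c(8), of "- 1"]] by simp
    moreover have "NC m (c - c') \<le> real r" using C.diff_le_max[OF c(3,4)] c(5,6) by simp
    ultimately show ?thesis using c by (auto simp: A_def mr intro!: Z.diff_mem C.diff_mem)
  qed
  let ?cl = "(closure_of) Z.metric.mtopology"
  have Z_eq: "\<Union>(range (\<lambda>mr. ?cl (A mr))) = Z"
  proof (intro equalityI subsetI)
    fix z assume z: "z \<in> Z"
    then obtain m c where c: "c \<in> C m" "R m z c" using cover by blast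
    obtain r where "NC m c \<le> real r" using real_arch_simple by blast
    then have "z \<in> A (m, r)" using z c by (auto simp: A_def)
    moreover have "A (m, r) \<subseteq> topspace Z.metric.mtopology" by (auto simp: A_def)
    ultimately show "z \<in> \<Union>(range (\<lambda>mr. ?cl (A mr)))"
      using closure_of_subset by blast
  qed (use closure_of_subset_topspace[of Z.metric.mtopology] in fastforce)
  have "\<exists>mr. Z.metric.mtopology interior_of (?cl (A mr)) \<noteq> {}"
  proof (rule ccontr)
    assume "\<not> ?thesis"
    then have "Z.metric.mtopology interior_of
        \<Union>(range (\<lambda>mr. ?cl (A mr))) = {}"
      by (intro Z.metric.metric_Baire_category_alt Z.mcomplete) auto
    then show False
      using Z.zero_mem interior_of_topspace[of Z.metric.mtopology] by (simp add: Z_eq)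
  qed
  then obtain mr z0 where z0: "z0 \<in> Z.metric.mtopology interior_of (?cl (A mr))"
    by blast
  obtain m r where mr: "mr = (m, r)" by (cases mr)
  from z0 obtain e where e: "z0 \<in> Z" "0 < e" "Z.metric.mball z0 e \<subseteq> ?cl (A mr)"
    by (auto simp: Z.metric.metric_interior_of)
  have approx: "\<exists>a\<in>A mr. NZ (z - a) < \<delta>" if "z \<in> Z" "NZ (z - z0) < e" "0 < \<delta>" for z \<delta>
  proof -
    have "z \<in> ?cl (A mr)"
      using that e Z.norm_minus_commute[of z z0] by auto
    then obtain a where "a \<in> A mr" "a \<in> Z.metric.mball z \<delta>"
      using \<open>0 < \<delta>\<close> unfolding Z.metric.metric_closure_of by blast
    then show ?thesis using \<open>z \<in> Z\<close> by (auto split: if_splits)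
  qed
  have "\<exists>c\<in>C m. R m z c" if z: "z \<in> Z" for z
  proof (rule closed_relation_onto[OF Z C t R_add R_scale R_zero R_closed e(2) _ z])
    fix z \<delta> assume z: "z \<in> Z" "NZ z < e" "0 < (\<delta>::real)"
    obtain a where a: "a \<in> A mr" "NZ ((z0 + z) - a) < \<delta>"
      using approx[of "z0 + z" \<delta>] z e by (auto simp: Z.add_mem)
    obtain a' where a': "a' \<in> A mr" "NZ (z0 - a') < \<delta>"
      using approx[of z0 \<delta>] z e by (auto simp: Z.norm_zero)
    have mem: "a \<in> Z" "a' \<in> Z" using a a' by (auto simp: A_def mr)
    have "NZ (z - (a - a')) = NZ (((z0 + z) - a) - (z0 - a'))" by (simp add: algebra_simps)
    also have "\<dots> < \<delta>"
      using Z.diff_le_max[of "(z0 + z) - a" "z0 - a'"] a a' mem z(1) e(1)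
      by (simp add: Z.diff_mem Z.add_mem)
    finally show "\<exists>a\<in>Z. \<exists>c\<in>C m. NC m c \<le> real r \<and> R m a c \<and> NZ (z - a) < \<delta>"
      using A_diff[OF a(1) a'(1)] by (auto simp: A_def mr)
  qed
  then show ?thesis by blast
qed

section \<open>Completed tensor products with function spaces\<close>

text \<open>
  The single hypothesis that the norm on \<open>F\<close> bounds the values makes the completion of \<open>W \<otimes> F\<close>,
  realised by functions, a Banach space.
\<close>
locale dominated_tensor =
  fixes smul :: "'k::{ultrametric_field,complete_space} \<Rightarrow> 'w::{ultrametric_group,complete_space} \<Rightarrow> 'w"
    and F :: "('g \<Rightarrow> 'k) set" and NF :: "('g \<Rightarrow> 'k) \<Rightarrow> real"
  assumes banach: "banach_space smul"
    and dominated: "f \<in> F \<Longrightarrow> unorm (f x) \<le> NF f"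
begin

abbreviation "A \<equiv> algebraic_tensor smul F"
abbreviation "tn \<equiv> tensor_norm smul F NF"
abbreviation "V \<equiv> completed_tensor smul F NF"
abbreviation "NV \<equiv> completed_tensor_norm smul F NF"
abbreviation "approx \<equiv> tensor_approx smul F NF"
abbreviation "fscale \<equiv> \<lambda>a (h :: 'g \<Rightarrow> 'w) x. smul a (h x)"

sublocale vector_space smul using banach by (simp add: banach_space_def)

sublocale pw: vector_space fscale
  by (rule vector_space_pointwise) (rule vector_space_axioms)

lemma add_fscale_minus_one: "u + fscale (- 1) v = u - v"
  by (simp add: fun_eq_iff)

lemma unorm_smul: "unorm (smul a w) = unorm a * unorm w"
  using banach by (simp add: banach_space_def)

lemma tensor_sum_append: "tensor_sum smul (L @ L') = tensor_sum smul L + tensor_sum smul L'"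
  by (simp add: tensor_sum_def fun_eq_iff)

lemma tensor_sum_scale:
  "tensor_sum smul (map (\<lambda>(w, f). (smul a w, f)) L) = fscale a (tensor_sum smul L)"
  by (induction L) (auto simp: tensor_sum_def fun_eq_iff scale_right_distrib mult_ac)

lemma tensor_sum_Nil: "tensor_sum smul [] = 0"
  by (simp add: tensor_sum_def fun_eq_iff)

lemma unorm_tensor_sum_le:
  assumes "snd ` set L \<subseteq> F" "\<forall>(w, f)\<in>set L. unorm w * NF f \<le> r" "0 \<le> r"
  shows "unorm (tensor_sum smul L x) \<le> r"
  using assms(1,2)
proof (induction L)
  case (Cons wf L)
  obtain w f where wf: "wf = (w, f)" by (cases wf)
  have "unorm (smul (f x) w) \<le> unorm w * NF f"
    using dominated[of f x] Cons.prems by (simp add: wf unorm_smul mult.commute mult_left_mono unorm_nonneg)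
  moreover have "tensor_sum smul (wf # L) x = smul (f x) w + tensor_sum smul L x"
    by (simp add: tensor_sum_def wf)
  ultimately show ?case
    using unorm_add_le_max[of "smul (f x) w" "tensor_sum smul L x"] Cons by (auto simp: wf)
qed (simp add: tensor_sum_Nil unorm_zero assms(3))

lemma A_zero: "0 \<in> A"
  unfolding algebraic_tensor_def using tensor_sum_Nil by (auto intro!: exI[of _ "[]"])

lemma A_add: "u \<in> A \<Longrightarrow> v \<in> A \<Longrightarrow> u + v \<in> A"
  unfolding algebraic_tensor_def
  by clarsimp (metis tensor_sum_append image_Un le_sup_iff set_append)

lemma A_scale:
  assumes "u \<in> A" shows "fscale a u \<in> A"
proof -
  obtain L where "u = tensor_sum smul L" "snd ` set L \<subseteq> F"
    using assms by (auto simp: algebraic_tensor_def)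
  then have "fscale a u = tensor_sum smul (map (\<lambda>(w, f). (smul a w, f)) L)"
      "snd ` set (map (\<lambda>(w, f). (smul a w, f)) L) \<subseteq> F"
    by (auto simp: tensor_sum_scale)
  then show ?thesis unfolding algebraic_tensor_def by blast
qed

lemma A_diff: "u \<in> A \<Longrightarrow> v \<in> A \<Longrightarrow> u - v \<in> A"
  using A_add[of u "fscale (- 1) v"] A_scale[of v "- 1"] by (simp only: add_fscale_minus_one)

lemma tn_le:
  assumes "snd ` set L \<subseteq> F" "\<forall>(w, f)\<in>set L. unorm w * NF f \<le> r" "0 \<le> r"
  shows "tn (tensor_sum smul L) \<le> r"
  unfolding tensor_norm_def
  by (rule cInf_lower) (use assms in \<open>auto intro!: bdd_belowI[of _ 0]\<close>)

lemma tn_set_nonempty: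
  assumes "h \<in> A"
  shows "{r. 0 \<le> r \<and> (\<exists>L. snd ` set L \<subseteq> F \<and> h = tensor_sum smul L \<and>
            (\<forall>(w, f) \<in> set L. unorm w * NF f \<le> r))} \<noteq> {}"
proof -
  obtain L where L: "h = tensor_sum smul L" "snd ` set L \<subseteq> F"
    using assms by (auto simp: algebraic_tensor_def)
  define r where "r = Max (insert 0 ((\<lambda>(w, f). unorm w * NF f) ` set L))"
  have "0 \<le> r" "\<forall>(w, f) \<in> set L. unorm w * NF f \<le> r"
    by (auto simp: r_def intro!: Max_ge)
  then show ?thesis using L by blast
qed

lemma tn_lessE:
  assumes "h \<in> A" "tn h < r"
  obtains L where "snd ` set L \<subseteq> F" "h = tensor_sum smul L" "\<forall>(w, f)\<in>set L. unorm w * NF f \<le> r" "0 \<le> r"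
proof -
  obtain r' L where "r' < r" "0 \<le> r'" "snd ` set L \<subseteq> F" "h = tensor_sum smul L"
      "\<forall>(w, f) \<in> set L. unorm w * NF f \<le> r'"
    using cInf_lessD[OF tn_set_nonempty[OF assms(1)]] assms(2) unfolding tensor_norm_def by blast
  then show ?thesis by (intro that[of L]) force+
qed

lemma tn_nonneg: "h \<in> A \<Longrightarrow> 0 \<le> tn h"
  unfolding tensor_norm_def by (intro cInf_greatest tn_set_nonempty) auto

lemma tn_add:
  assumes "u \<in> A" "v \<in> A"
  shows "tn (u + v) \<le> max (tn u) (tn v)"
proof (rule dense_ge)
  fix r assume "max (tn u) (tn v) < r"
  then have r: "tn u < r" "tn v < r" by auto
  obtain L where L: "snd ` set L \<subseteq> F" "u = tensor_sum smul L" "\<forall>(w, f)\<in>set L. unorm w * NF f \<le> r" "0 \<le> r"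
    using tn_lessE[OF assms(1) r(1)] .
  obtain L' where L': "snd ` set L' \<subseteq> F" "v = tensor_sum smul L'" "\<forall>(w, f)\<in>set L'. unorm w * NF f \<le> r" "0 \<le> r"
    using tn_lessE[OF assms(2) r(2)] .
  have "tn (tensor_sum smul (L @ L')) \<le> r"
    by (rule tn_le) (use L L' in auto)
  then show "tn (u + v) \<le> r" using L L' by (simp add: tensor_sum_append)
qed

lemma tn_scale:
  assumes u: "u \<in> A"
  shows "tn (fscale a u) \<le> unorm a * tn u"
proof (cases "a = 0")
  case True
  have "tn (tensor_sum smul []) \<le> 0" by (rule tn_le) auto
  then show ?thesis using True by (simp add: tensor_sum_Nil unorm_zero zero_fun_def)
next
  case False
  then have a: "0 < unorm a" by (rule unorm_pos)
  show ?thesis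
  proof (rule dense_ge)
    fix r assume r: "unorm a * tn u < r"
    then have "tn u < r / unorm a" using a by (simp add: field_simps)
    then obtain L where L: "snd ` set L \<subseteq> F" "u = tensor_sum smul L"
        "\<forall>(w, f)\<in>set L. unorm w * NF f \<le> r / unorm a" "0 \<le> r / unorm a"
      using tn_lessE[OF u] by blast
    have "0 \<le> r" using L(4) a by (simp add: field_simps zero_le_divide_iff)
    have "tn (tensor_sum smul (map (\<lambda>(w, f). (smul a w, f)) L)) \<le> r"
    proof (rule tn_le)
      show "\<forall>(w, f)\<in>set (map (\<lambda>(w, f). (smul a w, f)) L). unorm w * NF f \<le> r"
        using L(3) a by (fastforce simp: unorm_smul field_simps)
    qed (use L(1) \<open>0 \<le> r\<close> in auto)
    then show "tn (fscale a u) \<le> r" by (simp only: tensor_sum_scale L(2))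
  qed
qed

lemma tn_zero: "tn 0 = 0"
  using tn_scale[OF A_zero, of 0] tn_nonneg[OF A_zero] by (simp add: zero_fun_def unorm_zero)

lemma tn_commute: "u \<in> A \<Longrightarrow> v \<in> A \<Longrightarrow> tn (u - v) = tn (v - u)"
  using tn_scale[OF A_diff, of u v "- 1"] tn_scale[OF A_diff, of v u "- 1"]
  by (simp add: unorm_minus unorm_one fun_diff_def)

lemma tn_diff_le:
  assumes "u \<in> A" "v \<in> A" shows "tn u \<le> max (tn v) (tn (u - v))"
  using tn_add[OF assms(2) A_diff[OF assms]] by simp

lemma tn_dist:
  assumes "u \<in> A" "v \<in> A" shows "\<bar>tn u - tn v\<bar> \<le> tn (u - v)"
  using tn_diff_le[OF assms] tn_diff_le[OF assms(2,1)] tn_commute[OF assms] tn_nonneg[OF A_diff[OF assms]]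
    tn_nonneg[OF assms(1)] tn_nonneg[OF assms(2)]
  by (auto simp: abs_if max_def split: if_splits)

lemma unorm_le_tn:
  assumes "u \<in> A" shows "unorm (u x) \<le> tn u"
proof (rule dense_ge)
  fix r assume "tn u < r"
  then show "unorm (u x) \<le> r" using tn_lessE[OF assms] unorm_tensor_sum_le by metis
qed

lemma approx_mem: "approx s h \<Longrightarrow> s k \<in> A"
  by (simp add: tensor_approx_def)

lemma approx_V: "approx s h \<Longrightarrow> h \<in> V"
  by (auto simp: completed_tensor_def)

lemma approx_const: "u \<in> A \<Longrightarrow> approx (\<lambda>k. u) u"
  by (simp add: tensor_approx_def tn_zero)

lemma A_subset_V: "u \<in> A \<Longrightarrow> u \<in> V"
  using approx_const approx_V by blast

lemma approx_shift: "approx s h \<Longrightarrow> approx (\<lambda>k. s (k + K)) h"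
  unfolding tensor_approx_def
  by (auto intro: LIMSEQ_ignore_initial_segment) (meson trans_le_add1)

lemma approx_cauchy: "approx s h \<Longrightarrow> 0 < e \<Longrightarrow> \<exists>M. \<forall>k\<ge>M. \<forall>l\<ge>M. tn (s k - s l) < e"
  by (simp add: tensor_approx_def)

lemma approx_add:
  assumes s: "approx s h" and t: "approx t g"
  shows "approx (\<lambda>k. s k + t k) (h + g)"
  unfolding tensor_approx_def
proof (intro conjI allI impI)
  show "s k + t k \<in> A" for k using assms by (simp add: A_add approx_mem)
  show "(\<lambda>k. (s k + t k) x) \<longlonglongrightarrow> (h + g) x" for x
    using assms by (simp add: tensor_approx_def tendsto_add)
  fix e :: real assume e: "0 < e"
  obtain M1 M2 where M: "\<forall>k\<ge>M1. \<forall>l\<ge>M1. tn (s k - s l) < e" "\<forall>k\<ge>M2. \<forall>l\<ge>M2. tn (t k - t l) < e"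
    using approx_cauchy[OF s e] approx_cauchy[OF t e] by blast
  have "tn (s k + t k - (s l + t l)) < e" if "k \<ge> max M1 M2" "l \<ge> max M1 M2" for k l
  proof -
    have "tn ((s k - s l) + (t k - t l)) \<le> max (tn (s k - s l)) (tn (t k - t l))"
      using assms by (intro tn_add A_diff) (auto simp: approx_mem)
    also have "\<dots> < e" using M that by simp
    finally show ?thesis by (simp add: algebra_simps)
  qed
  then show "\<exists>M. \<forall>k\<ge>M. \<forall>l\<ge>M. tn (s k + t k - (s l + t l)) < e" by blast
qed

lemma tendsto_smul:
  assumes "f \<longlonglongrightarrow> w" shows "(\<lambda>k. smul a (f k)) \<longlonglongrightarrow> smul a w"
proof -
  have "(\<lambda>k. unorm a * dist (f k) w) \<longlonglongrightarrow> unorm a * 0"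
    by (intro tendsto_mult_left) (rule iffD1[OF tendsto_dist_iff assms])
  then show ?thesis
    by (subst tendsto_dist_iff) (simp add: dist_unorm unorm_smul flip: scale_right_diff_distrib)
qed

lemma approx_scale:
  assumes s: "approx s h"
  shows "approx (\<lambda>k. fscale a (s k)) (fscale a h)"
  unfolding tensor_approx_def
proof (intro conjI allI impI)
  show "fscale a (s k) \<in> A" for k using assms by (simp add: A_scale approx_mem)
  show "(\<lambda>k. fscale a (s k) x) \<longlonglongrightarrow> fscale a h x" for x
    using assms by (simp add: tensor_approx_def tendsto_smul)
  fix e :: real assume e: "0 < e"
  define e' where "e' = e / (unorm a + 1)"
  have pos: "0 < unorm a + 1" using unorm_nonneg[of a] by simp
  then have "0 < e'" using e by (simp add: e'_def)
  then obtain M where M: "\<forall>k\<ge>M. \<forall>l\<ge>M. tn (s k - s l) < e'"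
    using approx_cauchy[OF s] by blast
  have "tn (fscale a (s k) - fscale a (s l)) < e" if "k \<ge> M" "l \<ge> M" for k l
  proof -
    have mem: "s k - s l \<in> A" using s by (simp add: A_diff approx_mem)
    have "tn (fscale a (s k) - fscale a (s l)) = tn (fscale a (s k - s l))"
      by (simp only: pw.scale_right_diff_distrib)
    also have "\<dots> \<le> unorm a * tn (s k - s l)" by (rule tn_scale[OF mem])
    also have "\<dots> \<le> (unorm a + 1) * tn (s k - s l)" using tn_nonneg[OF mem] by (simp add: algebra_simps)
    also have "\<dots> < (unorm a + 1) * e'" using M that pos by simp
    also have "\<dots> = e" using pos by (simp add: e'_def)
    finally show ?thesis .
  qed
  then show "\<exists>M. \<forall>k\<ge>M. \<forall>l\<ge>M. tn (fscale a (s k) - fscale a (s l)) < e" by blast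
qed

lemma approx_diff:
  assumes "approx s h" "approx t g"
  shows "approx (\<lambda>k. s k - t k) (h - g)"
proof -
  have "approx (\<lambda>k. s k + fscale (- 1) (t k)) (h + fscale (- 1) g)"
    by (rule approx_add[OF assms(1) approx_scale[OF assms(2)]])
  then show ?thesis by (simp only: add_fscale_minus_one)
qed

lemma V_zero: "0 \<in> V"
  by (rule A_subset_V[OF A_zero])

lemma VE: assumes "h \<in> V" obtains s where "approx s h"
  using assms unfolding completed_tensor_def by auto

lemma V_add: assumes "u \<in> V" "v \<in> V" shows "u + v \<in> V"
proof -
  obtain s where s: "approx s u" using VE[OF assms(1)] .
  obtain t where t: "approx t v" using VE[OF assms(2)] .
  show ?thesis by (rule approx_V[OF approx_add[OF s t]])
qed

lemma V_scale: assumes "u \<in> V" shows "fscale a u \<in> V"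
proof -
  obtain s where s: "approx s u" using VE[OF assms] .
  show ?thesis by (rule approx_V[OF approx_scale[OF s]])
qed

lemma V_diff: assumes "u \<in> V" "v \<in> V" shows "u - v \<in> V"
proof -
  obtain s where s: "approx s u" using VE[OF assms(1)] .
  obtain t where t: "approx t v" using VE[OF assms(2)] .
  show ?thesis by (rule approx_V[OF approx_diff[OF s t]])
qed

lemma tn_convergent:
  assumes "approx s h" obtains r where "(\<lambda>k. tn (s k)) \<longlonglongrightarrow> r" "0 \<le> r"
proof -
  have "Cauchy (\<lambda>k. tn (s k))"
  proof (rule metric_CauchyI)
    fix e :: real assume "0 < e"
    then obtain M where "\<forall>k\<ge>M. \<forall>l\<ge>M. tn (s k - s l) < e" using approx_cauchy[OF assms] by blast
    then have "\<forall>k\<ge>M. \<forall>l\<ge>M. dist (tn (s k)) (tn (s l)) < e"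
      using order.strict_trans1[OF tn_dist[OF approx_mem[OF assms] approx_mem[OF assms]]]
      by (simp add: dist_real_def)
    then show "\<exists>M. \<forall>k\<ge>M. \<forall>l\<ge>M. dist (tn (s k)) (tn (s l)) < e" by blast
  qed
  then obtain r where r: "(\<lambda>k. tn (s k)) \<longlonglongrightarrow> r" by (auto simp: Cauchy_convergent_iff convergent_def)
  moreover have "0 \<le> r" using r tn_nonneg[OF approx_mem[OF assms]] by (simp add: LIMSEQ_le_const)
  ultimately show ?thesis by (rule that)
qed

lemma NV_bdd: "bdd_below {r. \<exists>s. approx s h \<and> (\<lambda>k. tn (s k)) \<longlonglongrightarrow> r}"
  by (rule bdd_belowI[of _ 0]) (auto intro: LIMSEQ_le_const simp: tn_nonneg approx_mem)

lemma NV_set_nonempty: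
  assumes "h \<in> V" shows "{r. \<exists>s. approx s h \<and> (\<lambda>k. tn (s k)) \<longlonglongrightarrow> r} \<noteq> {}"
proof -
  obtain s where s: "approx s h" using VE[OF assms] .
  obtain r where "(\<lambda>k. tn (s k)) \<longlonglongrightarrow> r" using tn_convergent[OF s] .
  then show ?thesis using s by auto
qed

lemma NV_le:
  assumes "approx s h" "\<And>k. K \<le> k \<Longrightarrow> tn (s k) \<le> r"
  shows "NV h \<le> r"
proof -
  obtain l where l: "(\<lambda>k. tn (s k)) \<longlonglongrightarrow> l" using tn_convergent[OF assms(1)] by blast
  have "NV h \<le> l" unfolding completed_tensor_norm_def
    by (rule cInf_lower[OF _ NV_bdd]) (use l assms in blast)
  also have "l \<le> r" using LIMSEQ_le_const2[OF l] assms(2) by blast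
  finally show ?thesis .
qed

lemma NV_lessE:
  assumes "h \<in> V" "NV h < r"
  obtains s where "approx s h" "\<And>k. tn (s k) < r"
proof -
  obtain l s where l: "l < r" "approx s h" "(\<lambda>k. tn (s k)) \<longlonglongrightarrow> l"
    using cInf_lessD[OF NV_set_nonempty[OF assms(1)]] assms(2) unfolding completed_tensor_norm_def by blast
  then obtain K where "\<And>k. k \<ge> K \<Longrightarrow> tn (s k) < r"
    using order_tendstoD(2)[OF l(3,1)] by (auto simp: eventually_sequentially)
  then show ?thesis using that[of "\<lambda>k. s (k + K)"] approx_shift[OF l(2)] by simp
qed

lemma NV_nonneg: "h \<in> V \<Longrightarrow> 0 \<le> NV h"
  unfolding completed_tensor_norm_def
  by (intro cInf_greatest NV_set_nonempty) (auto intro: LIMSEQ_le_const simp: tn_nonneg approx_mem)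

lemma NV_zero: "NV 0 = 0"
  using NV_le[OF approx_const[OF A_zero], of 0 0] NV_nonneg[OF V_zero] by (simp add: tn_zero)

lemma NV_add:
  assumes "u \<in> V" "v \<in> V"
  shows "NV (u + v) \<le> max (NV u) (NV v)"
proof (rule dense_ge)
  fix r assume "max (NV u) (NV v) < r"
  then have "NV u < r" "NV v < r" by auto
  then obtain s t where st: "approx s u" "\<And>k. tn (s k) < r" "approx t v" "\<And>k. tn (t k) < r"
    using NV_lessE assms by metis
  have "tn (s k + t k) \<le> r" for k
    using tn_add[OF approx_mem[OF st(1)] approx_mem[OF st(3)], of k k] st(2,4)[of k] by simp
  then show "NV (u + v) \<le> r" using NV_le[OF approx_add[OF st(1,3)]] by blast
qed

lemma NV_scale:
  assumes "u \<in> V"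
  shows "NV (fscale a u) \<le> unorm a * NV u"
proof (cases "a = 0")
  case True
  then show ?thesis using NV_zero by (simp add: unorm_zero zero_fun_def)
next
  case False
  then have a: "0 < unorm a" by (rule unorm_pos)
  show ?thesis
  proof (rule dense_ge)
    fix r assume r: "unorm a * NV u < r"
    then have "NV u < r / unorm a" using a by (simp add: field_simps)
    then obtain s where s: "approx s u" "\<And>k. tn (s k) < r / unorm a"
      using NV_lessE[OF assms] by blast
    have "tn (fscale a (s k)) \<le> r" for k
      using order_trans[OF tn_scale[OF approx_mem[OF s(1)], of a k], of r] s(2)[of k] a
      by (simp add: field_simps)
    then show "NV (fscale a u) \<le> r" using NV_le[OF approx_scale[OF s(1)]] by blast
  qed
qed

lemma unorm_le_NV:
  assumes "u \<in> V" shows "unorm (u x) \<le> NV u"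
proof (rule dense_ge)
  fix r assume "NV u < r"
  then obtain s where s: "approx s u" "\<And>k. tn (s k) < r" using NV_lessE[OF assms] by blast
  have "(\<lambda>k. s k x) \<longlonglongrightarrow> u x" using s(1) by (simp add: tensor_approx_def)
  then have "(\<lambda>k. unorm (s k x)) \<longlonglongrightarrow> unorm (u x)" unfolding unorm_dist by (intro tendsto_dist) auto
  moreover have "unorm (s k x) \<le> r" for k
    using unorm_le_tn[OF approx_mem[OF s(1)], of k x] s(2)[of k] by simp
  ultimately show "unorm (u x) \<le> r" by (auto intro: LIMSEQ_le_const2)
qed

text \<open>
  The approximating tensor can be chosen with tensor norm below any bound for the completed norm.
  This control is what makes the partial sums in \<open>V_complete\<close> Cauchy for the tensor norm itself.
\<close>
lemma A_dense:
  assumes "h \<in> V" "NV h < r" "0 < e"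
  obtains u where "u \<in> A" "tn u < r" "NV (h - u) \<le> e"
proof -
  obtain s where s: "approx s h" "\<And>k. tn (s k) < r" using NV_lessE[OF assms(1,2)] by blast
  then obtain K where K: "\<forall>k\<ge>K. \<forall>l\<ge>K. tn (s k - s l) < e" using approx_cauchy assms(3) by blast
  have "approx (\<lambda>k. s k - s K) (h - s K)"
    using approx_diff[OF s(1) approx_const] approx_mem[OF s(1)] by blast
  then have "NV (h - s K) \<le> e" by (rule NV_le[of _ _ K]) (use K in \<open>auto intro: less_imp_le\<close>)
  then show ?thesis using that[of "s K"] s approx_mem[OF s(1)] by blast
qed

lemma approx_of_Suc_diffs:
  assumes S: "\<And>k. S k \<in> A" and lim: "(\<lambda>k. tn (S (Suc k) - S k)) \<longlonglongrightarrow> 0"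
  obtains v where "approx S v" "(\<lambda>k. NV (S k - v)) \<longlonglongrightarrow> 0"
proof -
  have cauchy: "\<exists>M. \<forall>k\<ge>M. \<forall>l\<ge>M. tn (S k - S l) < e" if e: "0 < e" for e
  proof -
    obtain M where M: "\<And>k. k \<ge> M \<Longrightarrow> tn (S (Suc k) - S k) < e"
      using order_tendstoD(2)[OF lim e] by (auto simp: eventually_sequentially)
    have "tn (S k - S l) < e" if "M \<le> k" "M \<le> l" for k l
    proof (rule ultrametric_chain_less[where \<delta> = "\<lambda>k l. tn (S k - S l)"])
      show "tn (S i - S k) \<le> max (tn (S i - S j)) (tn (S j - S k))" for i j k
        using tn_add[OF A_diff[OF S S] A_diff[OF S S], of i j j k] by simp
    qed (use M e that S in \<open>auto simp: tn_zero tn_commute\<close>)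
    then show ?thesis by blast
  qed
  have "convergent (\<lambda>k. S k x)" for x
  proof -
    have "Cauchy (\<lambda>k. S k x)"
    proof (rule metric_CauchyI)
      fix e :: real assume "0 < e"
      then obtain M where M: "\<forall>k\<ge>M. \<forall>l\<ge>M. tn (S k - S l) < e" using cauchy by blast
      have "dist (S k x) (S l x) < e" if "k \<ge> M" "l \<ge> M" for k l
        using unorm_le_tn[OF A_diff[OF S S], of k l x] M that by (fastforce simp: dist_unorm)
      then show "\<exists>M. \<forall>k\<ge>M. \<forall>l\<ge>M. dist (S k x) (S l x) < e" by blast
    qed
    then show ?thesis by (rule Cauchy_convergent)
  qed
  then obtain v where v: "\<And>x. (\<lambda>k. S k x) \<longlonglongrightarrow> v x" unfolding convergent_def by metis
  have ap: "approx S v" using S cauchy v by (simp add: tensor_approx_def)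
  have "(\<lambda>k. NV (S k - v)) \<longlonglongrightarrow> 0"
  proof (rule LIMSEQ_I)
    fix e :: real assume "0 < e"
    then obtain M where M: "\<forall>k\<ge>M. \<forall>l\<ge>M. tn (S k - S l) < e / 2" using cauchy[of "e / 2"] by auto
    have "norm (NV (S k - v) - 0) < e" if "k \<ge> M" for k
    proof -
      have "approx (\<lambda>l. S k - S l) (S k - v)" by (intro approx_diff approx_const S ap)
      moreover from this have "NV (S k - v) \<le> e / 2"
        by (rule NV_le[of _ _ M]) (use M that in \<open>auto intro: less_imp_le\<close>)
      ultimately show ?thesis using NV_nonneg[OF approx_V] \<open>0 < e\<close> by fastforce
    qed
    then show "\<exists>M. \<forall>k\<ge>M. norm (NV (S k - v) - 0) < e" by blast
  qed
  then show ?thesis using ap that by blast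
qed

text \<open>
  The completed norm of a tensor is at most its tensor norm; a comparison in the other direction
  would amount to the injectivity of the completion into functions. The proof therefore never
  bounds a tensor norm by a completed norm: it builds tensors \<open>S k\<close> step by step so that
  \<open>S (k + 1) - S k\<close> is small in tensor norm while \<open>S k\<close> stays close to \<open>h k - h 0\<close> in the
  completed norm.
\<close>
lemma V_complete:
  assumes h: "\<And>k. h k \<in> V" and lim: "(\<lambda>k. NV (h (Suc k) - h k)) \<longlonglongrightarrow> 0"
  shows "\<exists>v\<in>V. (\<lambda>k. NV (h k - v)) \<longlonglongrightarrow> 0"
proof -
  define \<epsilon> :: "nat \<Rightarrow> real" where "\<epsilon> k = (1/2) ^ k" for k
  have \<epsilon>: "0 < \<epsilon> k" "\<epsilon> \<longlonglongrightarrow> 0" for k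
    unfolding \<epsilon>_def by (simp_all add: LIMSEQ_realpow_zero)
  \<comment> \<open>bounds the tensor norm of the \<open>k\<close>-th correction; the extra \<open>\<epsilon> k\<close> makes the bound in \<open>A_dense\<close> strict\<close>
  define \<eta> where "\<eta> k = max (\<epsilon> k) (NV (h (Suc k) - h k)) + \<epsilon> k" for k
  have "\<exists>S. \<forall>k. (S k \<in> A \<and> NV (h k - h 0 - S k) \<le> \<epsilon> k) \<and> tn (S (Suc k) - S k) \<le> \<eta> k"
  proof (rule dependent_nat_choice)
    show "\<exists>S. S \<in> A \<and> NV (h 0 - h 0 - S) \<le> \<epsilon> 0"
      using A_zero by (intro exI[of _ 0]) (simp add: NV_zero \<epsilon>_def)
    fix S k assume S: "S \<in> A \<and> NV (h k - h 0 - S) \<le> \<epsilon> k"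
    define g where "g = h (Suc k) - h 0 - S"
    have S_V: "S \<in> V" using S by (simp add: A_subset_V)
    have g: "g \<in> V" using S_V h by (simp add: g_def V_diff)
    have g_eq: "g = (h k - h 0 - S) + (h (Suc k) - h k)" by (simp add: g_def)
    have "NV g \<le> max (NV (h k - h 0 - S)) (NV (h (Suc k) - h k))"
      unfolding g_eq by (intro NV_add V_diff h S_V)
    also have "\<dots> \<le> max (\<epsilon> k) (NV (h (Suc k) - h k))" using S by (intro max.mono) auto
    finally have "NV g \<le> max (\<epsilon> k) (NV (h (Suc k) - h k))" .
    then have "NV g < \<eta> k" using \<epsilon>(1)[of k] by (simp add: \<eta>_def)
    then obtain u where "u \<in> A" "tn u < \<eta> k" "NV (g - u) \<le> \<epsilon> (Suc k)"
      using A_dense[OF g _ \<epsilon>(1)] by metis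
    then show "\<exists>S'. (S' \<in> A \<and> NV (h (Suc k) - h 0 - S') \<le> \<epsilon> (Suc k)) \<and> tn (S' - S) \<le> \<eta> k"
      using S by (intro exI[of _ "S + u"]) (simp add: A_add g_def algebra_simps)
  qed
  then obtain S where S: "\<And>k. S k \<in> A" "\<And>k. NV (h k - h 0 - S k) \<le> \<epsilon> k"
      "\<And>k. tn (S (Suc k) - S k) \<le> \<eta> k" by blast
  have "\<eta> \<longlonglongrightarrow> max 0 0 + 0" unfolding \<eta>_def by (intro tendsto_intros \<epsilon>(2) lim)
  then have \<eta>_lim: "\<eta> \<longlonglongrightarrow> 0" by simp
  have "(\<lambda>k. tn (S (Suc k) - S k)) \<longlonglongrightarrow> 0"
    by (rule real_tendsto_sandwich[OF _ _ tendsto_const \<eta>_lim])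
      (use S in \<open>auto simp: tn_nonneg A_diff\<close>)
  then obtain v where v: "approx S v" "(\<lambda>k. NV (S k - v)) \<longlonglongrightarrow> 0"
    by (rule approx_of_Suc_diffs[of S, OF S(1)])
  have mem: "v \<in> V" "h 0 + v \<in> V" "S k \<in> V" for k
    using approx_V[OF v(1)] S h by (auto intro: V_add A_subset_V)
  have lim0: "(\<lambda>k. max (\<epsilon> k) (NV (S k - v))) \<longlonglongrightarrow> max 0 0" by (intro tendsto_intros \<epsilon>(2) v)
  have bound: "NV (h k - (h 0 + v)) \<le> max (\<epsilon> k) (NV (S k - v))" for k
  proof -
    have eq: "h k - (h 0 + v) = (h k - h 0 - S k) + (S k - v)" by (simp add: algebra_simps)
    have "NV (h k - (h 0 + v)) \<le> max (NV (h k - h 0 - S k)) (NV (S k - v))"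
      unfolding eq by (intro NV_add V_diff h mem)
    then show ?thesis using S(2)[of k] by simp
  qed
  have "(\<lambda>k. NV (h k - (h 0 + v))) \<longlonglongrightarrow> 0"
    by (rule real_tendsto_sandwich[OF _ _ tendsto_const lim0[simplified]])
      (simp_all add: bound NV_nonneg V_diff h mem)
  then show ?thesis using mem by blast
qed

lemma banach_subspace_V: "banach_subspace fscale V NV"
proof
  show "u = 0" if "u \<in> V" "NV u = 0" for u
  proof
    fix x
    have "unorm (u x) = 0" using unorm_le_NV[OF that(1), of x] that(2) unorm_nonneg[of "u x"] by simp
    then show "u x = 0 x" by (simp add: unorm_eq_0_iff)
  qed
qed (use V_complete in \<open>auto intro: V_zero V_add V_scale NV_nonneg NV_add NV_scale\<close>)

end

lemma restrict_zero_apply: "restrict_zero S h x = (if x \<in> S then h x else 0)"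
  by (simp add: restrict_zero_def)

lemma restrict_zero_diff: "restrict_zero S (h - h' :: 'g \<Rightarrow> 'w::ab_group_add) = restrict_zero S h - restrict_zero S h'"
  by (simp add: restrict_zero_def fun_eq_iff)

text \<open>
  Restriction of functions is compatible with all steps of the construction of the completed tensor
  product, and each step preserves the property of not increasing norms.
\<close>
locale tensor_restriction = V: dominated_tensor smul F NF + V': dominated_tensor smul F' NF'
  for smul :: "'k::{ultrametric_field,complete_space} \<Rightarrow> 'w::{ultrametric_group,complete_space} \<Rightarrow> 'w"
    and F :: "('g \<Rightarrow> 'k) set" and NF :: "('g \<Rightarrow> 'k) \<Rightarrow> real"
    and F' :: "('g \<Rightarrow> 'k) set" and NF' :: "('g \<Rightarrow> 'k) \<Rightarrow> real" +
  fixes S :: "'g set"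
  assumes restrict_mem: "f \<in> F \<Longrightarrow> restrict_zero S f \<in> F'"
    and restrict_le: "f \<in> F \<Longrightarrow> NF' (restrict_zero S f) \<le> NF f"
begin

lemma restrict_tensor_sum:
  "restrict_zero S (tensor_sum smul L) = tensor_sum smul (map (\<lambda>(w, f). (w, restrict_zero S f)) L)"
proof
  fix x
  show "restrict_zero S (tensor_sum smul L) x
      = tensor_sum smul (map (\<lambda>(w, f). (w, restrict_zero S f)) L) x"
    by (induction L) (auto simp: tensor_sum_def restrict_zero_def)
qed

lemma restrict_A:
  assumes "h \<in> V.A" shows "restrict_zero S h \<in> V'.A"
proof -
  obtain L where L: "h = tensor_sum smul L" "snd ` set L \<subseteq> F"
    using assms by (auto simp: algebraic_tensor_def)
  have "snd ` set (map (\<lambda>(w, f). (w, restrict_zero S f)) L) \<subseteq> F'" using L(2) restrict_mem by force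
  then show ?thesis unfolding L(1) restrict_tensor_sum algebraic_tensor_def by blast
qed

lemma restrict_tn:
  assumes h: "h \<in> V.A" shows "V'.tn (restrict_zero S h) \<le> V.tn h"
proof (rule dense_ge)
  fix r assume "V.tn h < r"
  from V.tn_lessE[OF h this] obtain L where L: "snd ` set L \<subseteq> F" "h = tensor_sum smul L"
      "\<forall>(w, f)\<in>set L. unorm w * NF f \<le> r" "0 \<le> r" .
  have "\<forall>(w, f)\<in>set (map (\<lambda>(w, f). (w, restrict_zero S f)) L). unorm w * NF' f \<le> r"
  proof clarsimp
    fix w f assume wf: "(w, f) \<in> set L"
    then have "f \<in> F" using L(1) by force
    then have "unorm w * NF' (restrict_zero S f) \<le> unorm w * NF f"
      by (intro mult_left_mono restrict_le unorm_nonneg)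
    then show "unorm w * NF' (restrict_zero S f) \<le> r" using L(3) wf by force
  qed
  moreover have "snd ` set (map (\<lambda>(w, f). (w, restrict_zero S f)) L) \<subseteq> F'" using L(1) restrict_mem by force
  ultimately show "V'.tn (restrict_zero S h) \<le> r"
    unfolding L(2) restrict_tensor_sum using L(4) by (intro V'.tn_le)
qed

lemma restrict_approx:
  assumes s: "V.approx s h" shows "V'.approx (\<lambda>k. restrict_zero S (s k)) (restrict_zero S h)"
  unfolding tensor_approx_def
proof (intro conjI allI impI)
  show "restrict_zero S (s k) \<in> V'.A" for k by (rule restrict_A[OF V.approx_mem[OF s]])
  show "(\<lambda>k. restrict_zero S (s k) x) \<longlonglongrightarrow> restrict_zero S h x" for x
    using s by (simp add: restrict_zero_apply tensor_approx_def)
  fix e :: real assume "0 < e"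
  then obtain M where M: "\<forall>k\<ge>M. \<forall>l\<ge>M. V.tn (s k - s l) < e" using V.approx_cauchy[OF s] by blast
  have "V'.tn (restrict_zero S (s k) - restrict_zero S (s l)) < e" if "M \<le> k" "M \<le> l" for k l
    using restrict_tn[OF V.A_diff[OF V.approx_mem[OF s, of k] V.approx_mem[OF s, of l]]] M that
    unfolding restrict_zero_diff by (meson order.strict_trans1)
  then show "\<exists>M. \<forall>k\<ge>M. \<forall>l\<ge>M. V'.tn (restrict_zero S (s k) - restrict_zero S (s l)) < e" by blast
qed

lemma restrict_V:
  assumes "h \<in> V.V" shows "restrict_zero S h \<in> V'.V"
proof -
  obtain s where "V.approx s h" using V.VE[OF assms] .
  then show ?thesis by (rule V'.approx_V[OF restrict_approx])
qed

lemma restrict_NV: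
  assumes h: "h \<in> V.V" shows "V'.NV (restrict_zero S h) \<le> V.NV h"
proof (rule dense_ge)
  fix r assume "V.NV h < r"
  then obtain s where s: "V.approx s h" "\<And>k. V.tn (s k) < r" using V.NV_lessE[OF h] by blast
  have "V'.tn (restrict_zero S (s k)) \<le> r" for k
    using restrict_tn[OF V.approx_mem[OF s(1)], of k] s(2)[of k] by simp
  then show "V'.NV (restrict_zero S h) \<le> r" by (intro V'.NV_le[OF restrict_approx[OF s(1)]])
qed

end

section \<open>Continuous cochains on a compact group\<close>

definition sup_norm :: "('v \<Rightarrow> real) \<Rightarrow> 'x set \<Rightarrow> ('x \<Rightarrow> 'v) \<Rightarrow> real" where
  "sup_norm N X f = (SUP \<sigma>\<in>X. N (f \<sigma>))"

text \<open>
  Compactness makes continuous cochains bounded, so that the supremum of the norms of their values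
  is a norm. Completeness is the usual argument for uniform limits of continuous functions.
\<close>
locale compact_cochains = banach_subspace sc M N
  for sc :: "'k::ultrametric_field \<Rightarrow> 'v::ab_group_add \<Rightarrow> 'v" and M N +
  fixes T :: "'g topology" and S :: "'g set" and i :: nat
  assumes compact: "compactin T S" and nonempty: "S \<noteq> {}"
begin

abbreviation "X \<equiv> tuples S i"
abbreviation "P \<equiv> product_topology (\<lambda>_. subtopology T S) {..<i}"
abbreviation "C \<equiv> cochains T S M N i"

lemma topspace_P: "topspace P = X"
  using compactin_subset_topspace[OF compact] by (simp add: tuples_def Int_absorb1)

lemma X_nonempty: "X \<noteq> {}"
  using nonempty by (auto simp: tuples_def PiE_eq_empty_iff)

lemma compactin_X: "compactin P X"
proof -
  have "compact_space P"
    using compact by (simp add: compact_space_product_topology compact_space_subtopology)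
  then show ?thesis unfolding compact_space_def topspace_P .
qed

lemma cochain_mem: "f \<in> C \<Longrightarrow> f \<sigma> \<in> M"
  using zero_mem by (cases "\<sigma> \<in> X") (auto simp: cochains_def)

lemma cochain_outside: "f \<in> C \<Longrightarrow> \<sigma> \<notin> X \<Longrightarrow> f \<sigma> = 0"
  by (simp add: cochains_def)

lemma cochain_continuous:
  assumes "f \<in> C" "\<sigma> \<in> X" "0 < e"
  obtains U where "openin P U" "\<sigma> \<in> U" "\<And>\<tau>. \<tau> \<in> U \<Longrightarrow> N (f \<tau> - f \<sigma>) < e"
  using assms unfolding cochains_def by blast

lemma cochainI:
  assumes "\<And>\<sigma>. \<sigma> \<in> X \<Longrightarrow> f \<sigma> \<in> M" "\<And>\<sigma>. \<sigma> \<notin> X \<Longrightarrow> f \<sigma> = 0"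
    and "\<And>\<sigma> e. \<sigma> \<in> X \<Longrightarrow> 0 < e \<Longrightarrow> \<exists>U. openin P U \<and> \<sigma> \<in> U \<and> (\<forall>\<tau>\<in>U. N (f \<tau> - f \<sigma>) < e)"
  shows "f \<in> C"
  using assms unfolding cochains_def by blast

lemma cochain_bdd:
  assumes f: "f \<in> C" shows "bdd_above ((\<lambda>\<sigma>. N (f \<sigma>)) ` X)"
proof -
  define \<U> where "\<U> = {U. openin P U \<and> bdd_above ((\<lambda>\<sigma>. N (f \<sigma>)) ` U)}"
  have "X \<subseteq> \<Union>\<U>"
  proof
    fix \<sigma> assume "\<sigma> \<in> X"
    then obtain U where U: "openin P U" "\<sigma> \<in> U" "\<And>\<tau>. \<tau> \<in> U \<Longrightarrow> N (f \<tau> - f \<sigma>) < 1"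
      using cochain_continuous[OF f _ zero_less_one] by blast
    have "N (f \<tau>) \<le> max 1 (N (f \<sigma>))" if "\<tau> \<in> U" for \<tau>
      using add_le_max[of "f \<tau> - f \<sigma>" "f \<sigma>"] U(3)[OF that] f
      by (simp add: diff_mem cochain_mem)
    then have "bdd_above ((\<lambda>\<sigma>. N (f \<sigma>)) ` U)" by (intro bdd_aboveI2)
    then have "U \<in> \<U>" using U(1) by (simp add: \<U>_def)
    then show "\<sigma> \<in> \<Union>\<U>" using U(2) by blast
  qed
  then obtain \<F> where \<F>: "finite \<F>" "\<F> \<subseteq> \<U>" "X \<subseteq> \<Union>\<F>"
    using compactin_X unfolding compactin_def \<U>_def
    by (metis (mono_tags, lifting) mem_Collect_eq)
  have "bdd_above (\<Union>U\<in>\<F>. (\<lambda>\<sigma>. N (f \<sigma>)) ` U)"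
    using \<F>(1,2) by (auto simp: \<U>_def)
  then show ?thesis by (rule bdd_above_mono) (use \<F>(3) in blast)
qed

lemma norm_le_sup_norm:
  assumes "f \<in> C" shows "N (f \<sigma>) \<le> sup_norm N X f"
proof -
  have *: "N (f \<sigma>) \<le> sup_norm N X f" if "\<sigma> \<in> X" for \<sigma>
    unfolding sup_norm_def by (rule cSUP_upper[OF that cochain_bdd[OF assms]])
  show ?thesis
  proof (cases "\<sigma> \<in> X")
    case False
    obtain \<tau> where "\<tau> \<in> X" using X_nonempty by blast
    then show ?thesis
      using *[of \<tau>] False nonneg[OF cochain_mem[OF assms], of \<tau>] cochain_outside[OF assms False]
      by (simp add: norm_zero)
  qed (rule *)
qed

lemma sup_norm_le: "(\<And>\<sigma>. \<sigma> \<in> X \<Longrightarrow> N (f \<sigma>) \<le> r) \<Longrightarrow> sup_norm N X f \<le> r"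
  unfolding sup_norm_def by (intro cSUP_least X_nonempty)

lemma sup_norm_nonneg: "f \<in> C \<Longrightarrow> 0 \<le> sup_norm N X f"
  using norm_le_sup_norm[of f undefined] nonneg[OF cochain_mem, of f undefined] by simp

lemma cochain_zero: "0 \<in> C"
  using openin_topspace[of P] unfolding topspace_P
  by (intro cochainI) (auto simp: zero_mem norm_zero)

lemma cochain_add:
  assumes f: "f \<in> C" and g: "g \<in> C" shows "f + g \<in> C"
proof (rule cochainI)
  fix \<sigma> and e :: real assume \<sigma>: "\<sigma> \<in> X" "0 < e"
  obtain U where U: "openin P U" "\<sigma> \<in> U" "\<And>\<tau>. \<tau> \<in> U \<Longrightarrow> N (f \<tau> - f \<sigma>) < e"
    using cochain_continuous[OF f \<sigma>] by blast
  obtain U' where U': "openin P U'" "\<sigma> \<in> U'" "\<And>\<tau>. \<tau> \<in> U' \<Longrightarrow> N (g \<tau> - g \<sigma>) < e"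
    using cochain_continuous[OF g \<sigma>] by blast
  have "N ((f + g) \<tau> - (f + g) \<sigma>) < e" if "\<tau> \<in> U \<inter> U'" for \<tau>
  proof -
    have "N ((f \<tau> - f \<sigma>) + (g \<tau> - g \<sigma>)) \<le> max (N (f \<tau> - f \<sigma>)) (N (g \<tau> - g \<sigma>))"
      using f g by (intro add_le_max diff_mem cochain_mem)
    also have "\<dots> < e" using U(3) U'(3) that by simp
    finally show ?thesis by (simp add: algebra_simps)
  qed
  then show "\<exists>U. openin P U \<and> \<sigma> \<in> U \<and> (\<forall>\<tau>\<in>U. N ((f + g) \<tau> - (f + g) \<sigma>) < e)"
    using U(1,2) U'(1,2) by (intro exI[of _ "U \<inter> U'"]) (simp add: openin_Int)
qed (use f g in \<open>auto simp: add_mem cochain_mem cochain_outside\<close>)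

lemma cochain_scale:
  assumes f: "f \<in> C" shows "(\<lambda>\<sigma>. sc a (f \<sigma>)) \<in> C"
proof (rule cochainI)
  fix \<sigma> and e :: real assume \<sigma>: "\<sigma> \<in> X" "0 < e"
  have pos: "0 < unorm a + 1" using unorm_nonneg[of a] by simp
  then have "0 < e / (unorm a + 1)" using \<sigma>(2) by simp
  then obtain U where U: "openin P U" "\<sigma> \<in> U" "\<And>\<tau>. \<tau> \<in> U \<Longrightarrow> N (f \<tau> - f \<sigma>) < e / (unorm a + 1)"
    using cochain_continuous[OF f \<sigma>(1)] by blast
  have "N (sc a (f \<tau>) - sc a (f \<sigma>)) < e" if "\<tau> \<in> U" for \<tau>
  proof -
    have mem: "f \<tau> - f \<sigma> \<in> M" using f by (intro diff_mem cochain_mem)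
    have "N (sc a (f \<tau>) - sc a (f \<sigma>)) = unorm a * N (f \<tau> - f \<sigma>)"
      by (simp only: norm_scale[OF mem] flip: scale_right_diff_distrib)
    also have "\<dots> \<le> (unorm a + 1) * N (f \<tau> - f \<sigma>)" using nonneg[OF mem] by (simp add: algebra_simps)
    also have "\<dots> < e" using U(3)[OF that] pos by (simp add: field_simps)
    finally show ?thesis .
  qed
  then show "\<exists>U. openin P U \<and> \<sigma> \<in> U \<and> (\<forall>\<tau>\<in>U. N (sc a (f \<tau>) - sc a (f \<sigma>)) < e)"
    using U(1,2) by blast
qed (use f in \<open>auto simp: scale_mem cochain_mem cochain_outside\<close>)

lemma cochain_diff: "f \<in> C \<Longrightarrow> g \<in> C \<Longrightarrow> f - g \<in> C"
proof -
  assume "f \<in> C" "g \<in> C"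
  then have "f + (\<lambda>\<sigma>. sc (- 1) (g \<sigma>)) \<in> C" by (intro cochain_add cochain_scale)
  moreover have "f + (\<lambda>\<sigma>. sc (- 1) (g \<sigma>)) = f - g" by (simp add: fun_eq_iff)
  ultimately show ?thesis by simp
qed

lemma cochain_complete:
  assumes s: "\<And>k. s k \<in> C" and lim: "(\<lambda>k. sup_norm N X (s (Suc k) - s k)) \<longlonglongrightarrow> 0"
  shows "\<exists>f\<in>C. (\<lambda>k. sup_norm N X (s k - f)) \<longlonglongrightarrow> 0"
proof -
  have s_mem: "s k \<sigma> \<in> M" for k \<sigma> by (rule cochain_mem[OF s])
  have le: "N (s (Suc k) \<sigma> - s k \<sigma>) \<le> sup_norm N X (s (Suc k) - s k)" for k \<sigma>
    using norm_le_sup_norm[OF cochain_diff[OF s s], of "Suc k" k \<sigma>] by simp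
  have "\<exists>v\<in>M. (\<lambda>k. N (s k \<sigma> - v)) \<longlonglongrightarrow> 0" for \<sigma>
  proof (rule complete[OF s_mem])
    show "(\<lambda>k. N (s (Suc k) \<sigma> - s k \<sigma>)) \<longlonglongrightarrow> 0"
      by (rule real_tendsto_sandwich[OF _ _ tendsto_const lim])
        (use le in \<open>auto simp: nonneg diff_mem s_mem\<close>)
  qed
  then obtain f0 where f0: "\<And>\<sigma>. f0 \<sigma> \<in> M" "\<And>\<sigma>. (\<lambda>k. N (s k \<sigma> - f0 \<sigma>)) \<longlonglongrightarrow> 0" by metis
  define f where "f \<sigma> = (if \<sigma> \<in> X then f0 \<sigma> else 0)" for \<sigma>
  have f_mem: "f \<sigma> \<in> M" for \<sigma> by (simp add: f_def f0 zero_mem)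
  have unif: "\<exists>K. \<forall>k\<ge>K. \<forall>\<sigma>\<in>X. N (s k \<sigma> - f \<sigma>) < e" if e: "0 < e" for e
  proof -
    obtain K where K: "\<And>k. k \<ge> K \<Longrightarrow> sup_norm N X (s (Suc k) - s k) < e"
      using order_tendstoD(2)[OF lim e] by (auto simp: eventually_sequentially)
    have "N (s k \<sigma> - f \<sigma>) < e" if k: "k \<ge> K" and \<sigma>: "\<sigma> \<in> X" for k \<sigma>
    proof -
      obtain L where L: "\<And>l. l \<ge> L \<Longrightarrow> N (s l \<sigma> - f \<sigma>) < e"
        using order_tendstoD(2)[OF f0(2) e, of \<sigma>] \<sigma> by (auto simp: eventually_sequentially f_def)
      define l where "l = max K L"
      have "N (s k \<sigma> - s l \<sigma>) < e"
        by (rule ultrametric_chain_less[where \<delta> = "\<lambda>k l. N (s k \<sigma> - s l \<sigma>)" and K = K])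
          (use order.strict_trans1[OF le K] e k in \<open>auto simp: norm_zero l_def
            intro: dist_le_max norm_minus_commute s_mem\<close>)
      then show ?thesis
        using dist_le_max[of "s k \<sigma>" "s l \<sigma>" "f \<sigma>", OF s_mem s_mem f_mem] L[of l] by (simp add: l_def)
    qed
    then show ?thesis by blast
  qed
  have "f \<in> C"
  proof (rule cochainI)
    fix \<sigma> and e :: real assume \<sigma>: "\<sigma> \<in> X" "0 < e"
    obtain K where K: "\<And>\<sigma>. \<sigma> \<in> X \<Longrightarrow> N (s K \<sigma> - f \<sigma>) < e" using unif[OF \<sigma>(2)] by blast
    obtain U where U: "openin P U" "\<sigma> \<in> U" "\<And>\<tau>. \<tau> \<in> U \<Longrightarrow> N (s K \<tau> - s K \<sigma>) < e"
      using cochain_continuous[OF s \<sigma>] by blast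
    have "N (f \<tau> - f \<sigma>) < e" if "\<tau> \<in> U" for \<tau>
    proof -
      have "\<tau> \<in> X" using openin_subset[OF U(1)] that unfolding topspace_P by blast
      then show ?thesis
        using dist_le_max[of "f \<tau>" "s K \<tau>" "f \<sigma>", OF f_mem s_mem f_mem]
          dist_le_max[of "s K \<tau>" "s K \<sigma>" "f \<sigma>", OF s_mem s_mem f_mem]
          norm_minus_commute[of "f \<tau>" "s K \<tau>", OF f_mem s_mem]
          K[of \<tau>] K[OF \<sigma>(1)] U(3)[OF that] by simp
    qed
    then show "\<exists>U. openin P U \<and> \<sigma> \<in> U \<and> (\<forall>\<tau>\<in>U. N (f \<tau> - f \<sigma>) < e)" using U(1,2) by blast
  qed (simp_all add: f_def f0)
  moreover have "(\<lambda>k. sup_norm N X (s k - f)) \<longlonglongrightarrow> 0"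
  proof (rule LIMSEQ_I)
    fix e :: real assume e: "0 < e"
    then obtain K where K: "\<And>k \<sigma>. k \<ge> K \<Longrightarrow> \<sigma> \<in> X \<Longrightarrow> N (s k \<sigma> - f \<sigma>) < e / 2"
      using unif[of "e / 2"] by auto
    have "norm (sup_norm N X (s k - f) - 0) < e" if "k \<ge> K" for k
    proof -
      have "sup_norm N X (s k - f) \<le> e / 2"
        by (rule sup_norm_le) (use K[OF that] in \<open>auto intro: less_imp_le\<close>)
      then show ?thesis using sup_norm_nonneg[OF cochain_diff[OF s \<open>f \<in> C\<close>]] e by simp
    qed
    then show "\<exists>K. \<forall>k\<ge>K. norm (sup_norm N X (s k - f) - 0) < e" by blast
  qed
  ultimately show ?thesis by blast
qed

lemma banach_subspace_cochains: "banach_subspace (\<lambda>a f \<sigma>. sc a (f \<sigma>)) C (sup_norm N X)"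
proof (rule banach_subspace.intro)
  show "vector_space (\<lambda>a (f :: (nat \<Rightarrow> 'g) \<Rightarrow> 'v) \<sigma>. sc a (f \<sigma>))"
    by (rule vector_space_pointwise) (rule vector_space_axioms)
  show "banach_subspace_axioms (\<lambda>a f \<sigma>. sc a (f \<sigma>)) C (sup_norm N X)"
  proof
    show "f = 0" if "f \<in> C" "sup_norm N X f = 0" for f
    proof
      fix \<sigma>
      have "N (f \<sigma>) = 0"
        using norm_le_sup_norm[OF that(1), of \<sigma>] that(2) nonneg[OF cochain_mem[OF that(1)], of \<sigma>] by simp
      then show "f \<sigma> = 0 \<sigma>" using eq_zero[OF cochain_mem[OF that(1)]] by simp
    qed
    show "sup_norm N X (f + g) \<le> max (sup_norm N X f) (sup_norm N X g)" if fg: "f \<in> C" "g \<in> C" for f g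
    proof (rule sup_norm_le)
      fix \<sigma>
      have "N (f \<sigma> + g \<sigma>) \<le> max (N (f \<sigma>)) (N (g \<sigma>))" using fg by (intro add_le_max cochain_mem)
      also have "\<dots> \<le> max (sup_norm N X f) (sup_norm N X g)"
        using norm_le_sup_norm fg by (intro max.mono)
      finally show "N ((f + g) \<sigma>) \<le> max (sup_norm N X f) (sup_norm N X g)" by simp
    qed
    show "sup_norm N X (\<lambda>\<sigma>. sc a (f \<sigma>)) \<le> unorm a * sup_norm N X f" if f: "f \<in> C" for f a
      by (rule sup_norm_le)
        (use f in \<open>auto simp: norm_scale cochain_mem intro!: mult_left_mono norm_le_sup_norm unorm_nonneg\<close>)
  qed (use cochain_complete in \<open>auto intro: cochain_zero cochain_add cochain_scale sup_norm_nonneg\<close>)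
qed

end

lemma restrict_cochain_mem:
  assumes f: "f \<in> cochains T S M N i" and S: "S' \<subseteq> S"
    and M: "\<And>h. h \<in> M \<Longrightarrow> restrict_zero S' h \<in> M'"
    and N: "\<And>h h'. h \<in> M \<Longrightarrow> h' \<in> M \<Longrightarrow> N' (restrict_zero S' (h - h')) \<le> N (h - h')"
  shows "restrict_cochain S' i (f :: (nat \<Rightarrow> 'g) \<Rightarrow> 'g \<Rightarrow> 'w::ab_group_add) \<in> cochains T S' M' N' i"
proof -
  let ?X = "tuples S i" and ?X' = "tuples S' i"
  have sub: "?X' \<subseteq> ?X" using S by (auto simp: tuples_def PiE_mono)
  have P': "product_topology (\<lambda>_. subtopology T S') {..<i}
      = subtopology (product_topology (\<lambda>_. subtopology T S) {..<i}) ?X'"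
    using S by (simp add: tuples_def subtopology_product_topology subtopology_subtopology Int_absorb1)
  have "\<exists>U. openin (product_topology (\<lambda>_. subtopology T S') {..<i}) U \<and> \<sigma> \<in> U \<and>
      (\<forall>\<tau>\<in>U. N' (restrict_cochain S' i f \<tau> - restrict_cochain S' i f \<sigma>) < e)"
    if \<sigma>: "\<sigma> \<in> ?X'" "0 < e" for \<sigma> e
  proof -
    have "\<sigma> \<in> ?X" using \<sigma>(1) sub by blast
    then have "\<exists>U. openin (product_topology (\<lambda>_. subtopology T S) {..<i}) U \<and> \<sigma> \<in> U \<and>
        (\<forall>\<tau>\<in>U. N (f \<tau> - f \<sigma>) < e)"
      using f \<sigma>(2) by (simp add: cochains_def)
    then obtain U where U: "openin (product_topology (\<lambda>_. subtopology T S) {..<i}) U" "\<sigma> \<in> U"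
        "\<And>\<tau>. \<tau> \<in> U \<Longrightarrow> N (f \<tau> - f \<sigma>) < e" by blast
    have "N' (restrict_cochain S' i f \<tau> - restrict_cochain S' i f \<sigma>) < e" if \<tau>: "\<tau> \<in> U \<inter> ?X'" for \<tau>
    proof -
      have "restrict_cochain S' i f \<tau> - restrict_cochain S' i f \<sigma> = restrict_zero S' (f \<tau> - f \<sigma>)"
        using \<tau> \<sigma> by (auto simp: restrict_cochain_def restrict_zero_def fun_eq_iff)
      moreover have "f \<tau> \<in> M" "f \<sigma> \<in> M" using f \<tau> \<sigma> sub by (auto simp: cochains_def)
      ultimately show ?thesis using N[of "f \<tau>" "f \<sigma>"] U(3)[of \<tau>] \<tau> by simp
    qed
    then show ?thesis
      using U(1,2) \<sigma>(1) by (intro exI[of _ "U \<inter> ?X'"]) (auto simp: P' openin_subtopology)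
  qed
  moreover have "restrict_cochain S' i f \<sigma> \<in> M'" if "\<sigma> \<in> ?X'" for \<sigma>
    using f that sub M by (auto simp: restrict_cochain_def cochains_def)
  ultimately show ?thesis
    by (auto simp: cochains_def restrict_cochain_def fun_eq_iff)
qed

lemma sum_apply: "(\<Sum>j\<in>J. F j) x = (\<Sum>j\<in>J. F j x :: 'w::comm_monoid_add)"
  by (induction J rule: infinite_finite_induct) simp_all

lemma alternate_apply: "alternate k h x = alternate k (h x)"
  by (simp add: alternate_def)

lemma alternate_zero: "alternate k 0 = 0"
  and alternate_add: "alternate k (u + v) = alternate k u + alternate k v"
  by (simp_all add: alternate_def)

lemma coboundary_apply:
  "coboundary G S (diagonal_action G \<rho> S) i f \<sigma> x =
    (if \<sigma> \<in> tuples S (Suc i) then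
       (if x \<in> S then \<rho> (\<sigma> 0) (f (\<lambda>l\<in>{..<i}. \<sigma> (Suc l)) (inv\<^bsub>G\<^esub> (\<sigma> 0) \<otimes>\<^bsub>G\<^esub> x)) else 0)
       + (\<Sum>j<i. alternate (Suc j) (f (merge_at G i j \<sigma>) x))
       + alternate (Suc i) (f (restrict \<sigma> {..<i}) x)
     else 0)"
  by (simp add: coboundary_def diagonal_action_def sum_apply alternate_apply)

lemma restrict_cochain_apply:
  "restrict_cochain S i f \<sigma> x = (if \<sigma> \<in> tuples S i \<and> x \<in> S then f \<sigma> x else 0)"
  by (simp add: restrict_cochain_def restrict_zero_def)

lemma tuple_faces:
  assumes S: "subgroup S G" and \<sigma>: "\<sigma> \<in> tuples S (Suc i)"
  shows "\<sigma> 0 \<in> S" "(\<lambda>l\<in>{..<i}. \<sigma> (Suc l)) \<in> tuples S i" "restrict \<sigma> {..<i} \<in> tuples S i"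
    and "j < i \<Longrightarrow> merge_at G i j \<sigma> \<in> tuples S i"
proof -
  have mem: "\<sigma> l \<in> S" if "l < Suc i" for l using \<sigma> that by (auto simp: tuples_def)
  then show "\<sigma> 0 \<in> S" "(\<lambda>l\<in>{..<i}. \<sigma> (Suc l)) \<in> tuples S i" "restrict \<sigma> {..<i} \<in> tuples S i"
    by (simp_all add: tuples_def restrict_PiE_iff)
  show "merge_at G i j \<sigma> \<in> tuples S i" if "j < i"
    using that mem subgroup.m_closed[OF S] by (simp add: tuples_def merge_at_def restrict_PiE_iff)
qed

text \<open>
  Restriction to a subgroup is a map of cochain complexes: the faces of a tuple in \<open>S'\<close> and the
  translates of a point of \<open>S'\<close> stay in \<open>S'\<close>, where restricted cochains keep their values.
\<close>
lemma restrict_coboundary: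
  assumes S: "subgroup S G" "subgroup S' G" "S' \<subseteq> S"
    and \<rho>: "\<And>g. g \<in> S' \<Longrightarrow> \<rho> g 0 = (0 :: 'w::ab_group_add)"
  shows "restrict_cochain S' (Suc i) (coboundary G S (diagonal_action G \<rho> S) i f)
    = coboundary G S' (diagonal_action G \<rho> S') i (restrict_cochain S' i f)"
proof (intro ext)
  fix \<sigma> x
  show "restrict_cochain S' (Suc i) (coboundary G S (diagonal_action G \<rho> S) i f) \<sigma> x
    = coboundary G S' (diagonal_action G \<rho> S') i (restrict_cochain S' i f) \<sigma> x"
  proof (cases "\<sigma> \<in> tuples S' (Suc i)")
    case True
    note faces = tuple_faces[OF S(2) True]
    have "\<sigma> \<in> tuples S (Suc i)" using True S(3) by (auto simp: tuples_def)
    moreover have "inv\<^bsub>G\<^esub> (\<sigma> 0) \<otimes>\<^bsub>G\<^esub> x \<in> S'" if "x \<in> S'"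
      using that faces(1) S(2) by (simp add: subgroup.m_closed subgroup.m_inv_closed)
    ultimately show ?thesis
      using True faces S(3) by (auto simp: coboundary_apply restrict_cochain_apply alternate_zero)
  qed (simp add: coboundary_apply restrict_cochain_apply)
qed

section \<open>Arithmetic of the \<open>p\<close>-adic numbers\<close>

locale padic_field =
  fixes p :: nat and K :: "'k::{ultrametric_field,complete_space} itself"
  assumes Qp: "is_Qp p K"
begin

lemma prime: "prime p" and unorm_p: "unorm (of_nat p :: 'k) = 1 / real p"
  and rationals_dense: "closure \<rat> = (UNIV :: 'k set)"
  using Qp by (auto simp: is_Qp_def)

lemma p_gt_1: "1 < p"
  by (rule prime_gt_1_nat[OF prime])

lemma unorm_of_nat_le_1: "unorm (of_nat n :: 'k) \<le> 1"
proof (induction n)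
  case (Suc n)
  have "unorm (1 + of_nat n :: 'k) \<le> max (unorm (1 :: 'k)) (unorm (of_nat n :: 'k))" by (rule unorm_add_le_max)
  then show ?case using Suc by (simp add: unorm_one)
qed (simp add: unorm_zero)

lemma unorm_of_int: "unorm (of_int a :: 'k) = unorm (of_nat (nat \<bar>a\<bar>) :: 'k)"
  by (cases "0 \<le> a") (simp_all add: unorm_minus)

lemma unorm_of_int_le_1: "unorm (of_int a :: 'k) \<le> 1"
  by (simp only: unorm_of_int unorm_of_nat_le_1)

text \<open>
  If \<open>n\<close> had norm below 1, a Bezout relation would write 1 as a sum of two elements of norm below 1.
\<close>
lemma unorm_of_nat_coprime:
  assumes "\<not> p dvd n" shows "unorm (of_nat n :: 'k) = 1"
proof (rule ccontr)
  assume "\<not> ?thesis"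
  then have n: "unorm (of_nat n :: 'k) < 1" using unorm_of_nat_le_1[of n] by simp
  have "coprime (int p) (int n)" using assms prime by (simp add: prime_imp_coprime)
  then obtain x y where "x * int p + y * int n = 1"
    using bezout_int[of "int p" "int n"] by (metis coprime_imp_gcd_eq_1)
  then have "(1 :: 'k) = of_int (x * int p + y * int n)" by simp
  also have "\<dots> = of_int x * of_nat p + of_int y * of_nat n" by simp
  finally have "unorm (1 :: 'k) \<le> max (unorm (of_int x * of_nat p :: 'k)) (unorm (of_int y * of_nat n :: 'k))"
    using unorm_add_le_max[of "of_int x * of_nat p :: 'k" "of_int y * of_nat n"] by simp
  also have "\<dots> \<le> max (unorm (of_nat p :: 'k)) (unorm (of_nat n :: 'k))"
    unfolding unorm_mult
    by (intro max.mono mult_left_le_one_le unorm_nonneg unorm_of_int_le_1)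
  also have "\<dots> < 1" using n p_gt_1 by (simp add: unorm_p)
  finally show False by (simp add: unorm_one)
qed

lemma unorm_of_nat_p_power: "unorm (of_nat (p ^ k) :: 'k) = (1 / real p) ^ k"
  by (simp add: unorm_power unorm_p)

lemma unorm_of_nat_eq:
  assumes "0 < n" obtains k where "p ^ k dvd n" "unorm (of_nat n :: 'k) = (1 / real p) ^ k"
proof -
  obtain k m where km: "n = m * p ^ k" "\<not> p dvd m"
    using prime_power_canonical[OF prime assms] by blast
  have "unorm (of_nat n :: 'k) = (1 / real p) ^ k"
    unfolding km(1) of_nat_mult unorm_mult unorm_of_nat_coprime[OF km(2)] unorm_of_nat_p_power by simp
  then show ?thesis using that[of k] km(1) by simp
qed

lemma unorm_of_int_eq:
  assumes "a \<noteq> 0" obtains k where "unorm (of_int a :: 'k) = (1 / real p) ^ k"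
proof -
  have "0 < nat \<bar>a\<bar>" using assms by simp
  then obtain k where "unorm (of_nat (nat \<bar>a\<bar>) :: 'k) = (1 / real p) ^ k" by (rule unorm_of_nat_eq)
  then show ?thesis by (intro that[of k]) (simp only: unorm_of_int)
qed

lemma unorm_of_nat_le_iff: "unorm (of_nat n :: 'k) \<le> (1 / real p) ^ l \<longleftrightarrow> p ^ l dvd n"
proof
  assume le: "unorm (of_nat n :: 'k) \<le> (1 / real p) ^ l"
  show "p ^ l dvd n"
  proof (cases "n = 0")
    case False
    then obtain k where k: "p ^ k dvd n" "unorm (of_nat n :: 'k) = (1 / real p) ^ k"
      using unorm_of_nat_eq by blast
    have "l \<le> k"
    proof (rule ccontr)
      assume "\<not> l \<le> k"
      then have "(1 / real p) ^ l < (1 / real p) ^ k"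
        using p_gt_1 by (intro power_strict_decreasing) auto
      then show False using le k(2) by simp
    qed
    then show ?thesis using k(1) by (meson dvd_trans le_imp_power_dvd)
  qed simp
next
  assume "p ^ l dvd n"
  then obtain m where n: "n = p ^ l * m" by (elim dvdE)
  show "unorm (of_nat n :: 'k) \<le> (1 / real p) ^ l"
    unfolding n of_nat_mult unorm_mult unorm_of_nat_p_power
    by (intro mult_left_le unorm_of_nat_le_1) simp
qed

lemma rational_approx:
  assumes "0 < e"
  obtains a b :: int where "0 < b" "coprime a b" "unorm (x - of_int a / of_int b :: 'k) < e"
proof -
  have "x \<in> closure \<rat>" by (simp add: rationals_dense)
  then obtain q where q: "q \<in> \<rat>" "dist q x < e" using assms by (meson closure_approachable)
  obtain a b where "0 < b" "coprime a b" "q = of_int a / of_int b" using Rats_cases'[OF q(1)] .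
  then show ?thesis using that q(2) by (metis dist_commute dist_unorm)
qed

lemma unorm_eq_of_close:
  assumes "unorm (x - y) < unorm (x :: 'k)" shows "unorm y = unorm x"
  using unorm_add_le_max[of "x - y" y] unorm_add_le_max[of "y - x" x] assms unorm_minus[of "x - y"] by auto

text \<open>
  The rational numbers are dense and their norms are powers of \<open>p\<close>; by the ultrametric inequality
  all nonzero norms are powers of \<open>p\<close>, so there is none strictly between 1 and \<open>p\<close>.
\<close>
lemma unorm_discrete:
  assumes "unorm (x :: 'k) < real p" shows "unorm x \<le> 1"
proof (rule ccontr)
  assume "\<not> ?thesis"
  then have gt: "1 < unorm x" by simp
  then have "0 < unorm x" by simp
  then obtain a b :: int where ab: "0 < b" "unorm (x - of_int a / of_int b :: 'k) < unorm x"
    using rational_approx by metis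
  then have eq: "unorm (of_int a / of_int b :: 'k) = unorm x" using unorm_eq_of_close by blast
  have eq': "unorm (of_int a :: 'k) = unorm x * unorm (of_int b :: 'k)"
    using ab(1) by (simp flip: eq unorm_mult)
  have "a \<noteq> 0" using eq gt by (auto simp: unorm_zero)
  then obtain i where i: "unorm (of_int a :: 'k) = (1 / real p) ^ i"
    by (rule unorm_of_int_eq)
  obtain j where j: "unorm (of_int b :: 'k) = (1 / real p) ^ j"
    using unorm_of_int_eq[of b] ab(1) by auto
  have pos: "0 < (1 / real p) ^ j" using p_gt_1 by simp
  show False
  proof (cases "j \<le> i")
    case True
    then have "(1 / real p) ^ i \<le> (1 / real p) ^ j" using p_gt_1 by (intro power_decreasing) auto
    moreover have "(1 / real p) ^ j < unorm x * (1 / real p) ^ j" using gt pos by simp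
    ultimately show False using eq' i j by simp
  next
    case False
    then have "(1 / real p) ^ j \<le> (1 / real p) ^ Suc i" using p_gt_1 by (intro power_decreasing) auto
    then have "real p * (1 / real p) ^ j \<le> real p * (1 / real p) ^ Suc i" by (intro mult_left_mono) auto
    also have "\<dots> = (1 / real p) ^ i" using p_gt_1 by simp
    also have "\<dots> < real p * (1 / real p) ^ j" using eq' i j assms pos by simp
    finally show False by simp
  qed
qed

text \<open>
  The density of \<open>\<nat>\<close> in \<open>\<int>\<^sub>p\<close>. An approximating fraction \<open>a / b\<close> in lowest terms has \<open>b\<close> prime to \<open>p\<close>,
  so that modulo \<open>p\<^sup>l\<close> it agrees with the natural number \<open>a c\<close>, where \<open>c\<close> inverts \<open>b\<close> modulo \<open>p\<^sup>l\<close>.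
\<close>
lemma nat_approx:
  assumes x: "unorm (x :: 'k) \<le> 1" and e: "0 < e"
  obtains n :: nat where "unorm (x - of_nat n) < e"
proof -
  obtain l where l: "(1 / real p) ^ l < e" using real_arch_pow_inv[OF e, of "1 / real p"] p_gt_1 by auto
  have "0 < min e 1" using e by simp
  then obtain a b :: int where ab: "0 < b" "coprime a b" "unorm (x - of_int a / of_int b :: 'k) < min e 1"
    using rational_approx by metis
  let ?q = "of_int a / of_int b :: 'k"
  have "unorm (?q - x) < 1" using ab(3) unorm_minus[of "x - ?q"] by simp
  then have q: "unorm ?q \<le> 1" using unorm_add_le_max[of "?q - x" x] x by simp
  have b: "\<not> p dvd nat b"
  proof
    assume "p dvd nat b"
    then have pb: "int p dvd b" using ab(1) by (simp add: int_dvd_int_iff[symmetric] del: int_dvd_int_iff)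
    have "\<not> int p dvd a"
    proof
      assume "int p dvd a"
      then have "int p dvd 1" using coprime_common_divisor[OF ab(2)] pb by blast
      then show False using p_gt_1 by simp
    qed
    then have "\<not> p dvd nat \<bar>a\<bar>" by (simp add: dvd_nat_abs_iff)
    then have "unorm (of_int a :: 'k) = 1" by (simp only: unorm_of_int unorm_of_nat_coprime not_False_eq_True)
    moreover have "unorm (of_int b :: 'k) \<le> (1 / real p) ^ 1"
      using \<open>p dvd nat b\<close> ab(1) unfolding unorm_of_int unorm_of_nat_le_iff by simp
    moreover have "unorm (of_int a :: 'k) = unorm ?q * unorm (of_int b :: 'k)"
      using ab(1) by (simp flip: unorm_mult)
    moreover have "unorm ?q * unorm (of_int b :: 'k) \<le> unorm (of_int b :: 'k)"
      using q by (simp add: mult_left_le_one_le unorm_nonneg)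
    ultimately have "1 \<le> 1 / real p" by simp
    then show False using p_gt_1 by simp
  qed
  then have unit: "unorm (of_int b :: 'k) = 1" using ab(1) unorm_of_nat_coprime[of "nat b"] by simp
  have "coprime (nat b) p" using prime_imp_coprime[OF prime b] by (simp add: coprime_commute)
  then have "coprime (int (nat b)) (int (p ^ l))" unfolding coprime_int_iff by simp
  then have "coprime b (int p ^ l)" unfolding nat_0_le[OF less_imp_le[OF ab(1)]] by simp
  then obtain c where c: "[b * c = 1] (mod int p ^ l)" using cong_solve_coprime_int by blast
  define n where "n = nat ((a * c) mod int p ^ l)"
  have pl: "0 < int p ^ l" using p_gt_1 by simp
  have "[b * int n = a] (mod int p ^ l)"
  proof -
    have "[int n = a * c] (mod int p ^ l)" using pl by (simp add: n_def cong_def)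
    then have "[b * int n = b * (a * c)] (mod int p ^ l)" by (rule cong_scalar_left)
    moreover have "[a * (b * c) = a * 1] (mod int p ^ l)" by (rule cong_scalar_left[OF c])
    ultimately show ?thesis by (metis cong_trans mult.left_commute mult.right_neutral)
  qed
  then have "int (p ^ l) dvd a - b * int n" by (simp add: cong_iff_dvd_diff dvd_diff_commute)
  then have "p ^ l dvd nat \<bar>a - b * int n\<bar>" by (simp add: dvd_nat_abs_iff)
  then have "unorm (of_int (a - b * int n) :: 'k) \<le> (1 / real p) ^ l"
    by (simp only: unorm_of_int unorm_of_nat_le_iff)
  moreover have "of_int (a - b * int n) = (?q - of_nat n) * of_int b" using ab(1) by (simp add: field_simps)
  ultimately have qn: "unorm (?q - of_nat n) \<le> (1 / real p) ^ l" by (simp add: unorm_mult unit)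
  have "x - of_nat n = (x - ?q) + (?q - of_nat n)" by (simp add: algebra_simps)
  then have "unorm (x - of_nat n) \<le> max (unorm (x - ?q)) (unorm (?q - of_nat n))"
    by (simp only: unorm_add_le_max)
  also have "\<dots> < e" using ab(3) l qn by simp
  finally have "unorm (x - of_nat n) < e" .
  then show ?thesis by (rule that)
qed

end

section \<open>Ordered products in groups\<close>

definition (in monoid) ordered_prod :: "('i \<Rightarrow> 'a) \<Rightarrow> 'i list \<Rightarrow> 'a" where
  "ordered_prod x l = foldr (\<lambda>i y. x i \<otimes> y) l \<one>"

context group begin

lemma ordered_prod_Nil [simp]: "ordered_prod x [] = \<one>"
  and ordered_prod_Cons [simp]: "ordered_prod x (i # l) = x i \<otimes> ordered_prod x l"
  by (simp_all add: ordered_prod_def)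

lemma ordered_prod_closed: "x ` set l \<subseteq> carrier G \<Longrightarrow> ordered_prod x l \<in> carrier G"
  by (induction l) auto

lemma ordered_prod_cong: "(\<And>i. i \<in> set l \<Longrightarrow> x i = y i) \<Longrightarrow> ordered_prod x l = ordered_prod y l"
  by (induction l) auto

text \<open>
  The first case of the Hall-Petrescu formula: \<open>z\<close> is the commutator of \<open>y\<close> and \<open>x\<close>, assumed to commute with
  both. Moving the letters \<open>x\<close> to the left past \<open>y\<close> produces \<open>1 + \<dots> + (n - 1)\<close> copies of \<open>z\<close>.
\<close>
lemma pow_mult_of_central_commutator:
  assumes [simp]: "x \<in> carrier G" "y \<in> carrier G" "z \<in> carrier G"
    and yx: "y \<otimes> x = x \<otimes> y \<otimes> z" and zx: "z \<otimes> x = x \<otimes> z" and zy: "z \<otimes> y = y \<otimes> z"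
  shows "(x \<otimes> y) [^] (n :: nat) = x [^] n \<otimes> y [^] n \<otimes> z [^] (n * (n - 1) div 2)"
proof -
  have z_pow: "z [^] (k :: nat) \<otimes> u = u \<otimes> z [^] k" if "u \<in> carrier G" "z \<otimes> u = u \<otimes> z" for k u
    using pow_mult_distrib that by (induction k) (simp_all add: m_assoc, metis assms(3) m_assoc nat_pow_closed)
  have y_pow: "y [^] (k :: nat) \<otimes> x = x \<otimes> y [^] k \<otimes> z [^] k" for k
  proof (induction k)
    case (Suc k)
    have "y [^] Suc k \<otimes> x = y [^] k \<otimes> (x \<otimes> y \<otimes> z)" by (simp add: m_assoc yx)
    also have "\<dots> = (y [^] k \<otimes> x) \<otimes> y \<otimes> z" by (simp add: m_assoc)
    also have "\<dots> = x \<otimes> y [^] k \<otimes> (z [^] k \<otimes> y) \<otimes> z" by (simp add: Suc m_assoc)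
    also have "\<dots> = x \<otimes> y [^] Suc k \<otimes> z [^] Suc k" by (simp add: z_pow[OF _ zy] m_assoc)
    finally show ?case .
  qed simp
  show ?thesis
  proof (induction n)
    case (Suc n)
    define t where "t = n * (n - 1) div 2"
    have t: "Suc n * (Suc n - 1) div 2 = n + t"
      unfolding t_def by (cases n) (simp_all add: algebra_simps)
    have "(x \<otimes> y) [^] Suc n = x [^] n \<otimes> y [^] n \<otimes> (z [^] t \<otimes> x) \<otimes> y"
      by (simp add: Suc m_assoc t_def)
    also have "\<dots> = x [^] n \<otimes> (y [^] n \<otimes> x) \<otimes> (z [^] t \<otimes> y)"
      by (simp add: z_pow[OF _ zx] m_assoc)
    also have "\<dots> = x [^] n \<otimes> (x \<otimes> y [^] n) \<otimes> (z [^] n \<otimes> (y \<otimes> z [^] t))"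
      by (simp add: y_pow z_pow[OF _ zy] m_assoc)
    also have "\<dots> = x [^] n \<otimes> x \<otimes> y [^] n \<otimes> ((z [^] n \<otimes> y) \<otimes> z [^] t)" by (simp add: m_assoc)
    also have "\<dots> = x [^] Suc n \<otimes> y [^] Suc n \<otimes> (z [^] n \<otimes> z [^] t)"
      by (simp add: z_pow[OF _ zy] m_assoc)
    finally show ?case unfolding t nat_pow_mult[OF assms(3)] .
  qed simp
qed

lemma ordered_prod_pow:
  assumes K: "K \<subseteq> carrier G" "\<one> \<in> K" "\<And>x y. x \<in> K \<Longrightarrow> y \<in> K \<Longrightarrow> x \<otimes> y \<in> K"
    and pow: "\<And>x y. x \<in> K \<Longrightarrow> y \<in> K \<Longrightarrow> (x \<otimes> y) [^] n = x [^] n \<otimes> y [^] (n :: nat)"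
    and x: "x ` set l \<subseteq> K"
  shows "ordered_prod x l [^] n = ordered_prod (\<lambda>i. x i [^] n) l"
proof -
  have "ordered_prod x l \<in> K" if "x ` set l \<subseteq> K" for l
    using that by (induction l) (auto simp: K)
  then show ?thesis using x by (induction l) (simp_all add: pow)
qed

text \<open>
  A factor that commutes with every term can be moved to the term with index \<open>i\<close>.
\<close>
lemma mult_ordered_prod:
  assumes x: "x ` set l \<subseteq> carrier G" and a: "a \<in> carrier G" "\<And>j. j \<in> set l \<Longrightarrow> a \<otimes> x j = x j \<otimes> a"
    and l: "distinct l" "i \<in> set l"
  shows "a \<otimes> ordered_prod x l = ordered_prod (x(i := a \<otimes> x i)) l"
  using x a(2) l
proof (induction l)
  case (Cons j l)
  then have [simp]: "x j \<in> carrier G" "ordered_prod x l \<in> carrier G" by (auto intro: ordered_prod_closed)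
  show ?case
  proof (cases "j = i")
    case True
    then have eq: "ordered_prod (x(i := a \<otimes> x i)) l = ordered_prod x l"
      using Cons.prems(3) by (intro ordered_prod_cong) auto
    show ?thesis unfolding ordered_prod_Cons eq
      using m_assoc[of a "x j" "ordered_prod x l"] a(1) by (simp add: True[symmetric])
  next
    case False
    then have "a \<otimes> ordered_prod x l = ordered_prod (x(i := a \<otimes> x i)) l"
      using Cons.prems False by (intro Cons.IH) auto
    moreover have "a \<otimes> (x j \<otimes> ordered_prod x l) = x j \<otimes> (a \<otimes> ordered_prod x l)"
      using a(1) Cons.prems(2)[of j] by (simp flip: m_assoc)
    ultimately show ?thesis unfolding ordered_prod_Cons using False by simp
  qed
qed simp

end

lemma (in group_hom) hom_ordered_prod:
  "x ` set l \<subseteq> carrier G \<Longrightarrow> h (G.ordered_prod x l) = H.ordered_prod (h \<circ> x) l"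
  by (induction l) (auto simp: G.ordered_prod_closed)

section \<open>Saturated \<open>p\<close>-valued groups\<close>

locale saturated_subgroup = group G + padic_field p K
  for G :: "('g, 'm) monoid_scheme" (structure)
    and p :: nat and K :: "'k::{ultrametric_field,complete_space} itself" +
  fixes T :: "'g topology" and H :: "'g set" and \<omega> :: "'g \<Rightarrow> ereal"
  assumes topological_group: "topological_group G T" and Hausdorff: "Hausdorff_space T"
    and subgroup_H: "subgroup H G" and compact_H: "compactin T H"
    and p_valuation: "p_valuation p G T H \<omega>"
    and integer_valued: "integer_valued G H \<omega>" and saturated: "saturated p G H \<omega>"
begin

lemma H_carrier: "g \<in> H \<Longrightarrow> g \<in> carrier G"
  using subgroup.subset[OF subgroup_H] by blast

lemmas H_closed = subgroup.m_closed[OF subgroup_H] subgroup.m_inv_closed[OF subgroup_H]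
  subgroup.one_closed[OF subgroup_H]

lemma H_pow_closed: "g \<in> H \<Longrightarrow> g [^] (n :: nat) \<in> H"
  by (induction n) (simp_all add: H_closed)

lemma topspace_T: "topspace T = carrier G"
  using topological_group by (simp add: topological_group_def)

lemma continuous_mult:
  assumes "continuous_map X T f" "continuous_map X T g"
  shows "continuous_map X T (\<lambda>x. f x \<otimes> g x)"
proof -
  have "continuous_map (prod_topology T T) T (\<lambda>(x, y). x \<otimes> y)"
    using topological_group by (simp add: topological_group_def)
  moreover have "continuous_map X (prod_topology T T) (\<lambda>x. (f x, g x))"
    using assms by (simp add: continuous_map_pairedI)
  ultimately have "continuous_map X T ((\<lambda>(x, y). x \<otimes> y) \<circ> (\<lambda>x. (f x, g x)))"
    by (rule continuous_map_compose[rotated])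
  then show ?thesis by (simp add: o_def)
qed

lemma continuous_pow: "continuous_map T T (\<lambda>x. x [^] (n :: nat))"
  by (induction n) (simp_all add: continuous_mult topspace_T flip: id_def)

lemma val_eq_infinity: "g \<in> H \<Longrightarrow> \<omega> g = \<infinity> \<longleftrightarrow> g = \<one>"
  and val_gt: "g \<in> H \<Longrightarrow> ereal (1 / (real p - 1)) < \<omega> g"
  and val_inv_mult: "g \<in> H \<Longrightarrow> h \<in> H \<Longrightarrow> min (\<omega> g) (\<omega> h) \<le> \<omega> (inv g \<otimes> h)"
  and val_commutator: "g \<in> H \<Longrightarrow> h \<in> H \<Longrightarrow> \<omega> g + \<omega> h \<le> \<omega> (g \<otimes> h \<otimes> inv g \<otimes> inv h)"
  and val_pow_p: "g \<in> H \<Longrightarrow> \<omega> (g [^] p) = \<omega> g + 1"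
  and val_open: "openin (subtopology T H) {g \<in> H. ereal \<nu> \<le> \<omega> g}"
  and val_basis: "openin (subtopology T H) U \<Longrightarrow> \<one> \<in> U \<Longrightarrow> \<exists>\<nu>::real. {g \<in> H. ereal \<nu> \<le> \<omega> g} \<subseteq> U"
  using p_valuation by (simp_all add: p_valuation_def)

lemma val_one: "\<omega> \<one> = \<infinity>"
  using val_eq_infinity H_closed(3) by blast

lemma val_inv: assumes "g \<in> H" shows "\<omega> (inv g) = \<omega> g"
proof -
  have *: "\<omega> g \<le> \<omega> (inv g)" if "g \<in> H" for g
    using val_inv_mult[OF that H_closed(3)] that by (simp add: val_one H_closed H_carrier)
  show ?thesis using *[OF assms] *[OF H_closed(2)[OF assms]] assms by (simp add: H_carrier)
qed

lemma val_mult: assumes "g \<in> H" "h \<in> H" shows "min (\<omega> g) (\<omega> h) \<le> \<omega> (g \<otimes> h)"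
  using val_inv_mult[OF H_closed(2)[OF assms(1)] assms(2)] assms by (simp add: H_carrier val_inv)

lemma val_pow: "g \<in> H \<Longrightarrow> \<omega> g \<le> \<omega> (g [^] (n :: nat))"
proof (induction n)
  case (Suc n)
  then show ?case using val_mult[OF H_pow_closed[of g n], of g] by (simp add: min_def split: if_splits)
qed (simp add: val_one)

lemma val_pow_p_power: "g \<in> H \<Longrightarrow> \<omega> (g [^] (p ^ n)) = \<omega> g + ereal (real n)"
proof (induction n)
  case (Suc n)
  have "g [^] (p ^ Suc n) = (g [^] (p ^ n)) [^] p"
    using Suc.prems by (simp add: nat_pow_pow H_carrier mult.commute)
  then show ?case
    using Suc val_pow_p[OF H_pow_closed[of g "p ^ n"]]
    by (cases "\<omega> g") (simp_all add: one_ereal_def add_ac)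
qed (simp add: H_carrier)

lemma val_pow_dvd:
  assumes "g \<in> H" "p ^ k dvd n" shows "\<omega> g + ereal (real k) \<le> \<omega> (g [^] n)"
proof -
  obtain m where "n = p ^ k * m" using assms(2) by (elim dvdE)
  then have "g [^] n = (g [^] (p ^ k)) [^] m" using assms(1) by (simp add: nat_pow_pow H_carrier)
  then show ?thesis
    using val_pow[OF H_pow_closed[OF assms(1)], of "p ^ k" m] assms(1) by (simp add: val_pow_p_power)
qed

text \<open>
  The identity \<open>\<omega> (g\<^sup>p) = \<omega> g + 1\<close> gives one direction. Conversely, saturation extracts \<open>n\<close> successive
  \<open>p\<close>-th roots, each of which lowers the valuation by 1. Being described by \<open>\<omega>\<close>, the set of
  \<open>p\<^sup>n\<close>-th powers is a subgroup.
\<close>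
lemma mem_power_subgroup_iff:
  "g \<in> power_subgroup p G H n \<longleftrightarrow> g \<in> H \<and> ereal (real n + 1 / (real p - 1)) < \<omega> g"
proof
  assume "g \<in> power_subgroup p G H n"
  then obtain h where h: "h \<in> H" "g = h [^] (p ^ n)" by (auto simp: power_subgroup_def)
  have "ereal (real n + 1 / (real p - 1)) < \<omega> g"
    using val_gt[OF h(1)] h by (cases "\<omega> h") (simp_all add: val_pow_p_power)
  then show "g \<in> H \<and> ereal (real n + 1 / (real p - 1)) < \<omega> g" using h H_pow_closed by simp
next
  show "g \<in> power_subgroup p G H n" if "g \<in> H \<and> ereal (real n + 1 / (real p - 1)) < \<omega> g"
    using that
  proof (induction n arbitrary: g)
    case 0
    then show ?case by (auto simp: power_subgroup_def H_carrier intro!: image_eqI[of _ _ g])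
  next
    case (Suc n)
    have p: "real p / (real p - 1) = 1 + 1 / (real p - 1)" using p_gt_1 by (simp add: field_simps)
    have "ereal (real p / (real p - 1)) < \<omega> g"
      by (rule order.strict_trans1[of _ "ereal (real (Suc n) + 1 / (real p - 1))"])
        (use Suc.prems in \<open>simp_all add: p\<close>)
    then obtain h where h: "h \<in> H" "g = h [^] p" using saturated Suc.prems by (auto simp: saturated_def)
    have "ereal (real n + 1 / (real p - 1)) < \<omega> h"
      using Suc.prems h val_pow_p[OF h(1)] by (cases "\<omega> h") (simp_all add: one_ereal_def)
    then obtain k where "k \<in> H" "h = k [^] (p ^ n)" using Suc.IH[of h] h(1) by (auto simp: power_subgroup_def)
    then show ?case using h(2)
      by (auto simp: power_subgroup_def nat_pow_pow H_carrier mult.commute intro!: image_eqI[of _ _ k])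
  qed
qed

lemma subgroup_power_subgroup: "subgroup (power_subgroup p G H n) G"
proof (rule subgroupI)
  show "power_subgroup p G H n \<subseteq> carrier G" by (auto simp: mem_power_subgroup_iff H_carrier)
  have "\<one> \<in> power_subgroup p G H n" by (simp add: mem_power_subgroup_iff val_one H_closed)
  then show "power_subgroup p G H n \<noteq> {}" by blast
qed (auto simp: mem_power_subgroup_iff val_inv H_closed intro: order.strict_trans2[OF _ val_mult])

lemma power_subgroup_antimono: "n \<le> m \<Longrightarrow> power_subgroup p G H m \<subseteq> power_subgroup p G H n"
proof
  fix g assume nm: "n \<le> m" and g: "g \<in> power_subgroup p G H m"
  have "ereal (real n + 1 / (real p - 1)) \<le> ereal (real m + 1 / (real p - 1))" using nm by simp
  also have "\<dots> < \<omega> g" using g by (simp add: mem_power_subgroup_iff)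
  finally show "g \<in> power_subgroup p G H n" using g by (simp add: mem_power_subgroup_iff)
qed

lemma compactin_power_subgroup: "compactin T (power_subgroup p G H n)"
  unfolding power_subgroup_def by (rule image_compactin[OF compact_H continuous_pow])

definition N where "N \<nu> = {g \<in> H. ereal \<nu> \<le> \<omega> g}"

lemma subgroup_N: "subgroup (N \<nu>) G"
proof (rule subgroupI)
  show "N \<nu> \<subseteq> carrier G" by (auto simp: N_def H_carrier)
  have "\<one> \<in> N \<nu>" by (simp add: N_def val_one H_closed)
  then show "N \<nu> \<noteq> {}" by blast
qed (auto simp: N_def val_inv H_closed intro: order_trans[OF _ val_mult])

text \<open>
  If \<open>m k\<close> tends to \<open>n\<close> in \<open>\<int>\<^sub>p\<close>, then high powers of \<open>p\<close> divide \<open>m k - n\<close>, so the quotient of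
  \<open>g ^ (m k)\<close> and \<open>g ^ n\<close> has large valuation.
\<close>
lemma zp_pow_of_nat:
  assumes g: "g \<in> H" shows "zp_pow G T g (of_nat n :: 'k) = g [^] n"
  unfolding zp_pow_def
proof (rule the_equality)
  show "\<forall>m :: nat \<Rightarrow> nat. (\<lambda>k. of_nat (m k)) \<longlonglongrightarrow> (of_nat n :: 'k) \<longrightarrow>
      limitin T (\<lambda>k. g [^] m k) (g [^] n) sequentially"
  proof (intro allI impI)
    fix m :: "nat \<Rightarrow> nat" assume m: "(\<lambda>k. of_nat (m k)) \<longlonglongrightarrow> (of_nat n :: 'k)"
    show "limitin T (\<lambda>k. g [^] m k) (g [^] n) sequentially"
      unfolding limitin_def
    proof (intro conjI allI impI)
      show "g [^] n \<in> topspace T" using g by (simp add: topspace_T H_carrier)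
      fix U assume "openin T U \<and> g [^] n \<in> U"
      then have U: "openin T U" "g [^] n \<in> U" by auto
      have "continuous_map T T (\<lambda>h. g [^] n \<otimes> h)"
        using g by (intro continuous_mult) (simp_all add: topspace_T H_carrier flip: id_def)
      from openin_continuous_map_preimage[OF this U(1)]
      have "openin (subtopology T H) ({h \<in> topspace T. g [^] n \<otimes> h \<in> U} \<inter> H)"
        by (auto simp: openin_subtopology)
      moreover have "\<one> \<in> {h \<in> topspace T. g [^] n \<otimes> h \<in> U} \<inter> H"
        using g U(2) by (simp add: topspace_T H_carrier H_closed)
      ultimately obtain \<nu> where \<nu>: "{h \<in> H. ereal \<nu> \<le> \<omega> h} \<subseteq> {h \<in> topspace T. g [^] n \<otimes> h \<in> U} \<inter> H"
        using val_basis by meson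
      obtain l :: nat where l: "\<nu> \<le> real l" using real_arch_simple by blast
      have "0 < (1 / real p) ^ l" using p_gt_1 by simp
      then have "\<forall>\<^sub>F k in sequentially. unorm (of_nat (m k) - of_nat n :: 'k) < (1 / real p) ^ l"
        using tendstoD[OF m] by (simp add: dist_unorm)
      then show "\<forall>\<^sub>F k in sequentially. g [^] m k \<in> U"
      proof eventually_elim
        case (elim k)
        have pow: "g [^] (a - b) \<in> H" "ereal \<nu> \<le> \<omega> (g [^] (a - b))" "g [^] b \<otimes> g [^] (a - b) = g [^] a"
          if "b \<le> a" "unorm (of_nat a - of_nat b :: 'k) < (1 / real p) ^ l" for a b
        proof -
          have "unorm (of_nat (a - b) :: 'k) \<le> (1 / real p) ^ l" using that by (simp add: of_nat_diff)
          then have "p ^ l dvd a - b" by (simp only: unorm_of_nat_le_iff)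
          then have le: "\<omega> g + ereal (real l) \<le> \<omega> (g [^] (a - b))" by (rule val_pow_dvd[OF g])
          have "0 < \<omega> g" using p_gt_1 by (intro order.strict_trans[OF _ val_gt[OF g]]) simp
          then have "ereal \<nu> \<le> \<omega> g + ereal (real l)" using l by (cases "\<omega> g") auto
          then show "ereal \<nu> \<le> \<omega> (g [^] (a - b))" using le by (rule order_trans)
          show "g [^] b \<otimes> g [^] (a - b) = g [^] a" using that(1) g by (simp add: nat_pow_mult H_carrier)
        qed (rule H_pow_closed[OF g])
        define h where "h = inv (g [^] n) \<otimes> g [^] m k"
        have gc: "g [^] a \<in> carrier G" for a :: nat using g by (simp add: H_carrier)
        have "h \<in> H \<and> ereal \<nu> \<le> \<omega> h"
        proof (cases "n \<le> m k")
          case True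
          have "h = g [^] (m k - n)"
            using pow(3)[OF True elim] gc by (simp add: h_def inv_solve_left')
          then show ?thesis using pow(1,2)[OF True elim] by simp
        next
          case False
          then have le: "m k \<le> n" by simp
          have e: "unorm (of_nat n - of_nat (m k) :: 'k) < (1 / real p) ^ l"
            using elim unorm_minus[of "of_nat n - of_nat (m k) :: 'k"] by simp
          have "h = inv (g [^] (n - m k))"
            using gc unfolding h_def pow(3)[OF le e, symmetric] by (simp add: inv_mult_group m_assoc)
          then show ?thesis using pow(1,2)[OF le e] by (simp add: val_inv H_closed)
        qed
        then have "g [^] n \<otimes> h \<in> U" using \<nu> by blast
        moreover have "g [^] n \<otimes> h = g [^] m k" using gc by (simp add: h_def flip: m_assoc)
        ultimately show ?case by simp
      qed
    qed
  qed
next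
  fix y assume "\<forall>m :: nat \<Rightarrow> nat. (\<lambda>k. of_nat (m k)) \<longlonglongrightarrow> (of_nat n :: 'k) \<longrightarrow>
      limitin T (\<lambda>k. g [^] m k) y sequentially"
  then have "limitin T (\<lambda>k. g [^] n) y sequentially" by (auto dest: spec[of _ "\<lambda>_. n"])
  moreover have "limitin T (\<lambda>k. g [^] n) (g [^] n) sequentially"
    using g by (simp add: limitin_const_iff topspace_T H_carrier)
  ultimately show "y = g [^] n"
    using limitin_Hausdorff_unique Hausdorff by (metis trivial_limit_sequentially)
qed

abbreviation GH :: "('g, 'm) monoid_scheme" where "GH \<equiv> G\<lparr>carrier := H\<rparr>"
text \<open>
  Congruence modulo elements of valuation at least \<open>\<nu>\<close> is treated as equality in the quotient
  group \<open>Q \<nu>\<close>.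
\<close>
definition Q where "Q \<nu> = GH Mod N \<nu>"
definition proj where "proj \<nu> g = N \<nu> #>\<^bsub>GH\<^esub> g"

lemma N_subset: "N \<nu> \<subseteq> H"
  by (auto simp: N_def)

lemma normal_N: "N \<nu> \<lhd> GH"
proof -
  interpret GH: group GH by (rule subgroup_imp_group[OF subgroup_H])
  have "subgroup (N \<nu>) GH" by (rule subgroup_incl[OF subgroup_N subgroup_H N_subset])
  moreover have "g \<otimes> h \<otimes> inv g \<in> N \<nu>" if g: "g \<in> H" and h: "h \<in> N \<nu>" for g h
  proof -
    have hH: "h \<in> H" using h by (simp add: N_def)
    have "g \<otimes> h \<otimes> inv g = (g \<otimes> h \<otimes> inv g \<otimes> inv h) \<otimes> h"
      using g hH by (simp add: m_assoc H_carrier)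
    moreover have "\<omega> h \<le> \<omega> (g \<otimes> h \<otimes> inv g \<otimes> inv h)"
    proof -
      have "0 < \<omega> g" using p_gt_1 by (intro order.strict_trans[OF _ val_gt[OF g]]) simp
      then have "\<omega> h \<le> \<omega> g + \<omega> h" by (simp add: add_increasing)
      then show ?thesis using val_commutator[OF g hH] by (rule order_trans)
    qed
    ultimately have "\<omega> h \<le> \<omega> (g \<otimes> h \<otimes> inv g)"
      using val_mult[of "g \<otimes> h \<otimes> inv g \<otimes> inv h" h] g hH by (simp add: H_closed)
    then show ?thesis using g hH h by (auto simp: N_def H_closed)
  qed
  ultimately show ?thesis
    by (auto simp: GH.normal_inv_iff m_inv_consistent[OF subgroup_H])
qed

lemma group_hom_proj: "group_hom GH (Q \<nu>) (proj \<nu>)"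
  using subgroup_imp_group[OF subgroup_H] normal.factorgroup_is_group[OF normal_N]
    normal.r_coset_hom_Mod[OF normal_N]
  unfolding group_hom_def group_hom_axioms_def Q_def proj_def by blast

lemma group_Q: "group (Q \<nu>)"
  unfolding Q_def by (rule normal.factorgroup_is_group[OF normal_N])

lemma proj_closed: "g \<in> H \<Longrightarrow> proj \<nu> g \<in> carrier (Q \<nu>)"
  using group_hom.hom_closed[OF group_hom_proj] by simp

lemma proj_mult: "g \<in> H \<Longrightarrow> h \<in> H \<Longrightarrow> proj \<nu> (g \<otimes> h) = proj \<nu> g \<otimes>\<^bsub>Q \<nu>\<^esub> proj \<nu> h"
  using group_hom.hom_mult[OF group_hom_proj, of g h] by simp

lemma proj_pow: "g \<in> H \<Longrightarrow> proj \<nu> (g [^] (n :: nat)) = proj \<nu> g [^]\<^bsub>Q \<nu>\<^esub> n"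
  using group_hom.hom_nat_pow[OF group_hom_proj, of g] nat_pow_consistent by simp

lemma proj_eq_one: "g \<in> H \<Longrightarrow> proj \<nu> g = \<one>\<^bsub>Q \<nu>\<^esub> \<longleftrightarrow> ereal \<nu> \<le> \<omega> g"
proof -
  assume g: "g \<in> H"
  interpret GH: group GH by (rule subgroup_imp_group[OF subgroup_H])
  have "subgroup (N \<nu>) GH" by (rule subgroup_incl[OF subgroup_N subgroup_H N_subset])
  then have "proj \<nu> g = N \<nu> \<longleftrightarrow> g \<in> N \<nu>"
    unfolding proj_def using GH.coset_join1[of "N \<nu>" g] GH.coset_join2[of g "N \<nu>"] g by auto
  then show ?thesis using g by (simp add: Q_def FactGroup_def N_def)
qed

text \<open>
  The commutator of \<open>g\<close> and \<open>h\<close> has valuation at least \<open>\<omega> g + \<omega> h\<close>.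
\<close>
lemma proj_commute:
  assumes g: "g \<in> H" and h: "h \<in> H" and le: "ereal \<nu> \<le> \<omega> g + \<omega> h"
  shows "proj \<nu> g \<otimes>\<^bsub>Q \<nu>\<^esub> proj \<nu> h = proj \<nu> h \<otimes>\<^bsub>Q \<nu>\<^esub> proj \<nu> g"
proof -
  interpret Q: group "Q \<nu>" by (rule group_Q)
  define c where "c = g \<otimes> h \<otimes> inv g \<otimes> inv h"
  have c: "c \<in> H" "proj \<nu> c = \<one>\<^bsub>Q \<nu>\<^esub>"
    using g h order_trans[OF le val_commutator[OF g h]] by (simp_all add: c_def H_closed proj_eq_one)
  have "g \<otimes> h = c \<otimes> (h \<otimes> g)" using g h by (simp add: c_def m_assoc H_carrier inv_solve_left')
  then show ?thesis using g h c
    by (metis proj_mult proj_closed H_closed(1) Q.l_one)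
qed

text \<open>
  The \<open>p\<close>-th power map is multiplicative on elements of valuation at least \<open>k\<close>, modulo valuation
  \<open>k + 2\<close>. The commutator \<open>z\<close> of two such elements has valuation at least \<open>2 k\<close>; it commutes with
  both as \<open>3 k \<ge> k + 2\<close>, so \<open>(x y)\<^sup>p = x\<^sup>p y\<^sup>p z\<^sup>p\<^sup>(\<^sup>p\<^sup>-\<^sup>1\<^sup>)\<^sup>/\<^sup>2\<close> modulo valuation \<open>k + 2\<close>. The last factor disappears:
  for odd \<open>p\<close> because its exponent is divisible by \<open>p\<close>, which raises the valuation to at least
  \<open>2 k + 1\<close>, and for \<open>p = 2\<close> because \<open>k \<ge> 2\<close>.
\<close>
lemma proj_pow_mult:
  assumes k: "1 / (real p - 1) < real k" and x: "x \<in> H" "ereal (real k) \<le> \<omega> x"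
    and y: "y \<in> H" "ereal (real k) \<le> \<omega> y" and \<nu>: "\<nu> = real (k + 2)"
  shows "(proj \<nu> x \<otimes>\<^bsub>Q \<nu>\<^esub> proj \<nu> y) [^]\<^bsub>Q \<nu>\<^esub> p = proj \<nu> x [^]\<^bsub>Q \<nu>\<^esub> p \<otimes>\<^bsub>Q \<nu>\<^esub> proj \<nu> y [^]\<^bsub>Q \<nu>\<^esub> p"
proof -
  interpret Q: group "Q \<nu>" by (rule group_Q)
  have k1: "1 \<le> k" and k2: "p = 2 \<Longrightarrow> 2 \<le> k"
    using k p_gt_1 by (auto simp: not_less_eq_eq[symmetric] less_Suc_eq_le intro!: Suc_leI gr0I)
  define z where "z = inv y \<otimes> inv x \<otimes> inv (inv y) \<otimes> inv (inv x)"
  have zH: "z \<in> H" using x y by (simp add: z_def H_closed)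
  have "\<omega> (inv y) + \<omega> (inv x) \<le> \<omega> z"
    unfolding z_def by (rule val_commutator) (use x y in \<open>simp_all add: H_closed\<close>)
  then have "\<omega> y + \<omega> x \<le> \<omega> z" using x y by (simp add: val_inv)
  moreover have "ereal (real k) + ereal (real k) \<le> \<omega> y + \<omega> x" using x y by (intro add_mono)
  ultimately have z: "ereal (real (2 * k)) \<le> \<omega> z" by simp
  have comm: "proj \<nu> z \<otimes>\<^bsub>Q \<nu>\<^esub> proj \<nu> u = proj \<nu> u \<otimes>\<^bsub>Q \<nu>\<^esub> proj \<nu> z"
    if "u \<in> H" "ereal (real k) \<le> \<omega> u" for u
  proof (rule proj_commute[OF zH that(1)])
    have "ereal \<nu> \<le> ereal (real (2 * k)) + ereal (real k)" using k1 by (simp add: \<nu>)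
    also have "\<dots> \<le> \<omega> z + \<omega> u" by (intro add_mono z that)
    finally show "ereal \<nu> \<le> \<omega> z + \<omega> u" .
  qed
  have cancel: "a \<otimes> (inv a \<otimes> c) = c" if "a \<in> carrier G" "c \<in> carrier G" for a c
    using that by (simp flip: m_assoc)
  have "y \<otimes> x = x \<otimes> y \<otimes> z"
    using x y by (simp add: z_def m_assoc H_carrier cancel)
  then have yx: "proj \<nu> y \<otimes>\<^bsub>Q \<nu>\<^esub> proj \<nu> x = proj \<nu> x \<otimes>\<^bsub>Q \<nu>\<^esub> proj \<nu> y \<otimes>\<^bsub>Q \<nu>\<^esub> proj \<nu> z"
    using x y zH by (metis proj_mult H_closed(1))
  have "ereal \<nu> \<le> \<omega> (z [^] (p * (p - 1) div 2))"
  proof (cases "p = 2")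
    case True
    then have "ereal \<nu> \<le> ereal (real (2 * k))" using k2 by (simp add: \<nu>)
    then have "ereal \<nu> \<le> \<omega> z" using z by (rule order_trans)
    then show ?thesis using True zH by (simp add: H_carrier)
  next
    case False
    then have "odd p" using prime primes_dvd_imp_eq two_is_prime_nat by blast
    then have "2 dvd p - 1" by simp
    then have "p * (p - 1) div 2 = p * ((p - 1) div 2)" by (rule div_mult_swap[symmetric])
    then have "p ^ 1 dvd p * (p - 1) div 2" by simp
    then have "\<omega> z + ereal (real 1) \<le> \<omega> (z [^] (p * (p - 1) div 2))" by (rule val_pow_dvd[OF zH])
    moreover have "ereal \<nu> \<le> ereal (real (2 * k)) + ereal (real 1)" using k1 by (simp add: \<nu>)
    moreover have "ereal (real (2 * k)) + ereal (real 1) \<le> \<omega> z + ereal (real 1)" using z by (intro add_mono) auto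
    ultimately show ?thesis by (meson order_trans)
  qed
  then have "proj \<nu> z [^]\<^bsub>Q \<nu>\<^esub> (p * (p - 1) div 2) = \<one>\<^bsub>Q \<nu>\<^esub>"
    using proj_eq_one[OF H_pow_closed[OF zH]] proj_pow[OF zH] by metis
  then show ?thesis
    using Q.pow_mult_of_central_commutator[OF _ _ _ yx comm[OF x] comm[OF y], of p] x y zH
    by (simp add: proj_closed)
qed

end

section \<open>Coordinates of an ordered basis\<close>

locale based_subgroup = saturated_subgroup G p K T H \<omega>
  for G :: "('g, 'm) monoid_scheme" (structure)
    and p :: nat and K :: "'k::{ultrametric_field,complete_space} itself"
    and T :: "'g topology" and H :: "'g set" and \<omega> :: "'g \<Rightarrow> ereal" +
  fixes d :: nat and b :: "nat \<Rightarrow> 'g"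
  assumes basis: "ordered_basis K p G T H \<omega> d b"
begin

abbreviation coords :: "(nat \<Rightarrow> 'k) \<Rightarrow> 'g" where "coords \<equiv> basis_product G T d b"
abbreviation unit_box :: "(nat \<Rightarrow> 'k) set" where "unit_box \<equiv> Zp_box d"

lemma b_H: "i < d \<Longrightarrow> b i \<in> H" and b_neq_one: "i < d \<Longrightarrow> b i \<noteq> \<one>"
  and homeomorphic_coords: "homeomorphic_map (subtopology (affine_space d) unit_box) (subtopology T H) coords"
  and val_coords: "x \<in> unit_box \<Longrightarrow> \<omega> (coords x) = (INF i\<in>{..<d}. \<omega> (b i) + padic_val p (x i))"
  using basis by (auto simp: ordered_basis_def)

lemma coords_cong: "(\<And>i. i < d \<Longrightarrow> x i = y i) \<Longrightarrow> coords x = coords y"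
  unfolding basis_product_def by (rule foldr_cong) auto

lemma topspace_box: "topspace (subtopology (affine_space d) unit_box) = unit_box"
  by (auto simp: affine_space_def Zp_box_def)

lemma coords_onto: "coords ` unit_box = H"
  using homeomorphic_imp_surjective_map[OF homeomorphic_coords] compactin_subset_topspace[OF compact_H]
  unfolding topspace_box by (simp add: Int_absorb1)

lemma val_coords_le: "x \<in> unit_box \<Longrightarrow> i < d \<Longrightarrow> \<omega> (coords x) \<le> \<omega> (b i) + padic_val p (x i)"
  unfolding val_coords by (rule INF_lower) simp

definition nat_prod :: "(nat \<Rightarrow> nat) \<Rightarrow> 'g" where
  "nat_prod e = ordered_prod (\<lambda>i. b i [^] e i) [0..<d]"

lemma coords_of_nat: "coords (\<lambda>i. of_nat (e i)) = nat_prod e"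
proof -
  have "coords (\<lambda>i. of_nat (e i)) = ordered_prod (\<lambda>i. zp_pow G T (b i) (of_nat (e i) :: 'k)) [0..<d]"
    by (simp add: basis_product_def ordered_prod_def)
  also have "\<dots> = nat_prod e"
    unfolding nat_prod_def by (rule ordered_prod_cong) (simp add: zp_pow_of_nat b_H)
  finally show ?thesis .
qed

lemma of_nat_box: "restrict (\<lambda>i. of_nat (e i)) {..<d} \<in> unit_box"
  by (auto simp: Zp_box_def unorm_of_nat_le_1)

lemma coords_of_nat_restrict: "coords (restrict (\<lambda>i. of_nat (e i)) {..<d}) = nat_prod e"
  unfolding coords_of_nat[symmetric] by (rule coords_cong) simp

lemma nat_prod_H: "nat_prod e \<in> H"
  using coords_onto of_nat_box coords_of_nat_restrict by (metis imageI)

lemma val_nat_prod_le: "i < d \<Longrightarrow> \<omega> (nat_prod e) \<le> \<omega> (b i) + padic_val p (of_nat (e i) :: 'k)"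
  using val_coords_le[OF of_nat_box, of i e] by (simp add: coords_of_nat_restrict)

lemma val_pow_ge: "g \<in> H \<Longrightarrow> \<omega> g + padic_val p (of_nat e :: 'k) \<le> \<omega> (g [^] e)"
proof (cases "e = 0")
  case False
  assume g: "g \<in> H"
  obtain k where k: "p ^ k dvd e" "unorm (of_nat e :: 'k) = (1 / real p) ^ k"
    using unorm_of_nat_eq False by blast
  have "padic_val p (of_nat e :: 'k) = ereal (real k)"
    using False p_gt_1 by (simp add: padic_val_def k(2) power_one_over log_inverse log_nat_power flip: inverse_eq_divide)
  then show ?thesis using val_pow_dvd[OF g k(1)] by simp
qed (simp add: val_one)

text \<open>
  The coordinates form a homeomorphism and \<open>\<nat>\<close> is dense in \<open>\<int>\<^sub>p\<close>, so finite products of natural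
  powers of the basis are dense. Working with them avoids calculating with \<open>p\<close>-adic powers.
\<close>
lemma nat_prod_dense:
  assumes U: "openin (subtopology T H) U" and h: "h \<in> U"
  obtains e where "nat_prod e \<in> U"
proof -
  have "h \<in> H" using openin_subset[OF U] h by auto
  then obtain x where x: "x \<in> unit_box" "coords x = h" using coords_onto by blast
  have "continuous_map (subtopology (affine_space d) unit_box) (subtopology T H) coords"
    using homeomorphic_coords by (rule homeomorphic_imp_continuous_map)
  from openin_continuous_map_preimage[OF this U]
  obtain V where V: "openin (affine_space d :: (nat \<Rightarrow> 'k) topology) V" "{x \<in> unit_box. coords x \<in> U} = V \<inter> unit_box"
    unfolding topspace_box openin_subtopology by blast
  have "x \<in> V" using V(2) x h by blast
  from product_topology_open_contains_basis[OF V(1)[unfolded affine_space_def] this]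
  obtain W where W': "x \<in> Pi\<^sub>E {..<d} W" "\<forall>i. openin euclidean (W i)" "Pi\<^sub>E {..<d} W \<subseteq> V"
    by (elim exE conjE)
  then have W: "\<And>i. open (W i)" "x \<in> Pi\<^sub>E {..<d} W" "Pi\<^sub>E {..<d} W \<subseteq> V"
    by simp_all
  have "\<exists>n :: nat. of_nat n \<in> W i" if i: "i < d" for i
  proof -
    have "x i \<in> W i" using W(2) i by auto
    then obtain r where r: "0 < r" "\<forall>y. dist y (x i) < r \<longrightarrow> y \<in> W i"
      using W(1)[of i] unfolding open_dist by blast
    have "unorm (x i) \<le> 1" using x(1) i by (auto simp: Zp_box_def)
    then obtain n where "unorm (x i - of_nat n) < r" using nat_approx r(1) by blast
    then show ?thesis using r(2) by (metis dist_commute dist_unorm)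
  qed
  then obtain e where e: "\<And>i. i < d \<Longrightarrow> of_nat (e i) \<in> W i" by metis
  then have "restrict (\<lambda>i. of_nat (e i)) {..<d} \<in> Pi\<^sub>E {..<d} W" by (simp add: restrict_PiE_iff)
  then have "restrict (\<lambda>i. of_nat (e i)) {..<d} \<in> V" using W(3) by blast
  then have "coords (restrict (\<lambda>i. of_nat (e i)) {..<d}) \<in> U" using V(2) of_nat_box by blast
  then show ?thesis using that by (simp add: coords_of_nat_restrict)
qed

text \<open>
  Otherwise saturation yields \<open>h\<close> with \<open>b i = h\<^sup>p\<close> and \<open>\<omega> h = k\<close>, hence \<open>\<omega> (b i) = k + 1\<close>. Approximate
  \<open>h\<close> up to valuation \<open>k + 1\<close> by a product \<open>g\<close> of the powers \<open>b j ^ e j\<close>. By \<open>proj_pow_mult\<close>, raising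
  to the \<open>p\<close>-th power gives, modulo valuation \<open>k + 2\<close>, that \<open>b i\<close> is the product of the powers
  \<open>b j ^ (p * e j)\<close>. Multiplying by the power \<open>b i ^ (p - 1)\<close> turns the left-hand side into
  \<open>b i ^ p\<close>, of valuation \<open>k + 2\<close>, and the right-hand side into a product in which the exponent of
  \<open>b i\<close> is prime to \<open>p\<close>. The formula for \<open>\<omega>\<close> in coordinates bounds the valuation of this product by
  \<open>\<omega> (b i) = k + 1\<close>, a contradiction.
\<close>
lemma basis_val_le:
  assumes i: "i < d"
  shows "\<omega> (b i) \<le> ereal (real p / (real p - 1))"
proof (rule ccontr)
  assume "\<not> ?thesis"
  then obtain h where h: "h \<in> H" "b i = h [^] p" using saturated b_H[OF i] by (auto simp: saturated_def)
  have h1: "h \<noteq> \<one>" using h b_neq_one[OF i] by auto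
  then obtain k' :: int where k': "\<omega> h = ereal (of_int k')"
    using integer_valued h(1) by (auto simp: integer_valued_def)
  have gt: "1 / (real p - 1) < real_of_int k'" using val_gt[OF h(1)] k' by simp
  moreover have "0 < 1 / (real p - 1)" using p_gt_1 by simp
  ultimately have "0 < real_of_int k'" by linarith
  then obtain k where "k' = int k" by (metis of_int_0_less_iff zero_less_imp_eq_int)
  then have val_h: "\<omega> h = ereal (real k)" and k: "1 / (real p - 1) < real k" using k' gt by simp_all
  have val_b: "\<omega> (b i) = ereal (real (k + 1))" using h val_pow_p[OF h(1)] val_h by (simp add: one_ereal_def)
  define \<nu> where "\<nu> = real (k + 2)"
  interpret Q: group "Q \<nu>" by (rule group_Q)
  define L where "L = proj \<nu> ` N (real k)"
  have one_L: "\<one>\<^bsub>Q \<nu>\<^esub> \<in> L"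
    using proj_eq_one[OF H_closed(3), of \<nu>] by (auto simp: L_def N_def val_one H_closed intro!: image_eqI[of _ _ \<one>])
  have mult_L: "x \<otimes>\<^bsub>Q \<nu>\<^esub> y \<in> L" if xy: "x \<in> L" "y \<in> L" for x y
  proof -
    obtain u v where uv: "u \<in> N (real k)" "v \<in> N (real k)" "x = proj \<nu> u" "y = proj \<nu> v"
      using xy unfolding L_def by blast
    then have "x \<otimes>\<^bsub>Q \<nu>\<^esub> y = proj \<nu> (u \<otimes> v)" using N_subset by (simp add: proj_mult subset_iff)
    then show ?thesis using uv subgroup.m_closed[OF subgroup_N] by (auto simp: L_def)
  qed
  have pow_L: "(x \<otimes>\<^bsub>Q \<nu>\<^esub> y) [^]\<^bsub>Q \<nu>\<^esub> p = x [^]\<^bsub>Q \<nu>\<^esub> p \<otimes>\<^bsub>Q \<nu>\<^esub> y [^]\<^bsub>Q \<nu>\<^esub> p" if "x \<in> L" "y \<in> L" for x y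
    using that proj_pow_mult[OF k _ _ _ _ \<nu>_def] by (auto simp: L_def N_def)
  have L_sub: "L \<subseteq> carrier (Q \<nu>)" using N_subset by (auto simp: L_def intro!: proj_closed)
  define U where "U = {g \<in> H. ereal (real (k + 1)) \<le> \<omega> (inv h \<otimes> g)}"
  have "continuous_map (subtopology T H) (subtopology T H) (\<lambda>g. inv h \<otimes> g)"
    unfolding continuous_map_in_subtopology
    using h(1) compactin_subset_topspace[OF compact_H]
    by (auto simp: topspace_T H_carrier H_closed intro!: continuous_mult continuous_map_from_subtopology
        simp flip: id_def)
  from openin_continuous_map_preimage[OF this val_open[of "real (k + 1)"]]
  have "openin (subtopology T H) {g \<in> topspace (subtopology T H).
      inv h \<otimes> g \<in> {g \<in> H. ereal (real (k + 1)) \<le> \<omega> g}}" .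
  also have "{g \<in> topspace (subtopology T H). inv h \<otimes> g \<in> {g \<in> H. ereal (real (k + 1)) \<le> \<omega> g}} = U"
    using compactin_subset_topspace[OF compact_H] h(1) by (auto simp: U_def H_closed)
  finally have "openin (subtopology T H) U" .
  moreover have "h \<in> U" using h(1) by (simp add: U_def H_carrier val_one)
  ultimately obtain e where "nat_prod e \<in> U" using nat_prod_dense by blast
  define g where "g = nat_prod e"
  define u where "u = inv h \<otimes> g"
  have gU: "g \<in> U" using \<open>nat_prod e \<in> U\<close> by (simp add: g_def)
  have g: "g \<in> H" "u \<in> H" "ereal (real (k + 1)) \<le> \<omega> u" "g = h \<otimes> u"
    using gU h(1) by (auto simp: U_def u_def H_closed H_carrier simp flip: m_assoc)
  have val_u: "ereal (real k) \<le> \<omega> u" using g(3) by (rule order_trans[rotated]) simp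
  have val_g: "ereal (real k) \<le> \<omega> g"
    using val_mult[OF h(1) g(2)] val_u unfolding g(4) val_h by (simp add: min_def split: if_splits)
  have "ereal \<nu> \<le> \<omega> (u [^] p)"
    using val_pow_p[OF g(2)] g(3) by (cases "\<omega> u") (simp_all add: \<nu>_def one_ereal_def)
  then have "proj \<nu> u [^]\<^bsub>Q \<nu>\<^esub> p = \<one>\<^bsub>Q \<nu>\<^esub>"
    using proj_eq_one[OF H_pow_closed[OF g(2)]] proj_pow[OF g(2)] by metis
  moreover have "proj \<nu> g [^]\<^bsub>Q \<nu>\<^esub> p = proj \<nu> h [^]\<^bsub>Q \<nu>\<^esub> p \<otimes>\<^bsub>Q \<nu>\<^esub> proj \<nu> u [^]\<^bsub>Q \<nu>\<^esub> p"
    unfolding g(4) proj_mult[OF h(1) g(2)]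
    by (rule pow_L) (use h(1) g(2) val_h val_u in \<open>auto simp: L_def N_def\<close>)
  ultimately have proj_b: "proj \<nu> (b i) = proj \<nu> g [^]\<^bsub>Q \<nu>\<^esub> p"
    using h by (simp add: proj_pow proj_closed)
  have val_e: "ereal (real k) \<le> \<omega> (b j [^] e j)" if "j < d" for j
    using order_trans[OF order_trans[OF val_g[unfolded g_def] val_nat_prod_le[OF that]] val_pow_ge[OF b_H[OF that]]] .
  interpret hom: group_hom GH "Q \<nu>" "proj \<nu>" by (rule group_hom_proj)
  have GH_prod: "monoid.ordered_prod GH x l = ordered_prod x l" for x :: "nat \<Rightarrow> 'g" and l
    by (induction l) simp_all
  have pow_H: "(\<lambda>j. b j [^] (f j :: nat)) ` set [0..<d] \<subseteq> H" for f using b_H H_pow_closed by auto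
  have proj_prod: "proj \<nu> (nat_prod f) = Q.ordered_prod (\<lambda>j. proj \<nu> (b j [^] f j)) [0..<d]" for f
    using hom.hom_ordered_prod[of "\<lambda>j. b j [^] f j" "[0..<d]"] pow_H[of f]
    by (simp add: GH_prod nat_prod_def o_def)
  have "proj \<nu> g [^]\<^bsub>Q \<nu>\<^esub> p = Q.ordered_prod (\<lambda>j. proj \<nu> (b j [^] e j) [^]\<^bsub>Q \<nu>\<^esub> p) [0..<d]"
    unfolding g_def proj_prod
    by (rule Q.ordered_prod_pow[OF L_sub one_L mult_L pow_L])
      (use val_e b_H H_pow_closed in \<open>auto simp: L_def N_def\<close>)
  also have "\<dots> = Q.ordered_prod (\<lambda>j. proj \<nu> (b j [^] (e j * p))) [0..<d]"
    by (rule Q.ordered_prod_cong) (simp add: b_H H_pow_closed nat_pow_pow H_carrier flip: proj_pow)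
  finally have b_prod: "proj \<nu> (b i) = Q.ordered_prod (\<lambda>j. proj \<nu> (b j [^] (e j * p))) [0..<d]"
    using proj_b by simp
  \<comment> \<open>the exponents of \<open>b i ^ (p - 1)\<close> times the product of the \<open>b j ^ (e j * p)\<close>\<close>
  define m where "m = (\<lambda>j. e j * p)(i := (p - 1) + e i * p)"
  have bi: "b i \<in> H" "b i [^] n \<in> H" for n :: nat using b_H[OF i] H_pow_closed by auto
  have "proj \<nu> (b i [^] (p - 1)) \<otimes>\<^bsub>Q \<nu>\<^esub> proj \<nu> (b i)
      = Q.ordered_prod ((\<lambda>j. proj \<nu> (b j [^] (e j * p)))
          (i := proj \<nu> (b i [^] (p - 1)) \<otimes>\<^bsub>Q \<nu>\<^esub> proj \<nu> (b i [^] (e i * p)))) [0..<d]"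
    unfolding b_prod
  proof (rule Q.mult_ordered_prod)
    fix j assume "j \<in> set [0..<d]"
    then have j: "j < d" by simp
    have "ereal (real k) + 1 \<le> \<omega> (b j [^] e j) + 1" using val_e[OF j] by (intro add_right_mono)
    also have "\<dots> = \<omega> (b j [^] (e j * p))"
      using val_pow_p[OF H_pow_closed[OF b_H[OF j]], of "e j"] b_H[OF j] by (simp add: nat_pow_pow H_carrier)
    finally have "ereal (real k) + 1 \<le> \<omega> (b j [^] (e j * p))" .
    moreover have "ereal (real k) + 1 \<le> \<omega> (b i [^] (p - 1))"
      using val_pow[OF bi(1), of "p - 1"] by (simp add: val_b one_ereal_def add.commute)
    ultimately have "(ereal (real k) + 1) + (ereal (real k) + 1) \<le> \<omega> (b i [^] (p - 1)) + \<omega> (b j [^] (e j * p))"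
      by (intro add_mono)
    moreover have "ereal \<nu> \<le> (ereal (real k) + 1) + (ereal (real k) + 1)" by (simp add: \<nu>_def one_ereal_def)
    ultimately have "ereal \<nu> \<le> \<omega> (b i [^] (p - 1)) + \<omega> (b j [^] (e j * p))" by (rule order_trans[rotated])
    then show "proj \<nu> (b i [^] (p - 1)) \<otimes>\<^bsub>Q \<nu>\<^esub> proj \<nu> (b j [^] (e j * p))
        = proj \<nu> (b j [^] (e j * p)) \<otimes>\<^bsub>Q \<nu>\<^esub> proj \<nu> (b i [^] (p - 1))"
      by (intro proj_commute bi H_pow_closed[OF b_H[OF j]])
  qed (use i bi b_H H_pow_closed in \<open>auto intro!: proj_closed\<close>)
  also have "\<dots> = Q.ordered_prod (\<lambda>j. proj \<nu> (b j [^] m j)) [0..<d]"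
    by (rule Q.ordered_prod_cong)
      (use bi in \<open>auto simp: m_def H_carrier nat_pow_mult[symmetric] simp flip: proj_mult\<close>)
  also have "\<dots> = proj \<nu> (nat_prod m)" by (simp add: proj_prod)
  finally have "proj \<nu> (nat_prod m) = proj \<nu> (b i [^] (p - 1) \<otimes> b i)" using bi by (simp add: proj_mult)
  also have "b i [^] (p - 1) \<otimes> b i = b i [^] p"
    using p_gt_1 nat_pow_Suc[of "b i" "p - 1"] by simp
  also have "proj \<nu> (b i [^] p) = \<one>\<^bsub>Q \<nu>\<^esub>"
    using val_pow_p[OF bi(1)] bi by (subst proj_eq_one) (simp_all add: val_b \<nu>_def one_ereal_def)
  finally have "ereal \<nu> \<le> \<omega> (nat_prod m)" by (simp add: proj_eq_one nat_prod_H)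
  also have "\<dots> \<le> \<omega> (b i) + padic_val p (of_nat (m i) :: 'k)" by (rule val_nat_prod_le[OF i])
  also have "padic_val p (of_nat (m i) :: 'k) = 0"
  proof -
    have "\<not> p dvd m i"
    proof
      assume "p dvd m i"
      then have "p dvd p - 1" by (simp add: m_def dvd_add_left_iff)
      then show False using p_gt_1 by (auto dest: dvd_imp_le)
    qed
    then show ?thesis using unorm_of_nat_coprime[of "m i"] 
      by (cases "m i = 0") (auto simp: padic_val_def zero_ereal_def)
  qed
  finally show False by (simp add: val_b \<nu>_def)
qed

lemma coords_power_subgroup:
  assumes "x \<in> unit_box" shows "coords (\<lambda>i. of_nat (p ^ n) * x i) \<in> power_subgroup p G H n"
proof -
  define y where "y = restrict (\<lambda>i. of_nat (p ^ n) * x i) {..<d}"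
  have y_le: "unorm (y i) \<le> (1 / real p) ^ n" if i: "i < d" for i
  proof -
    have "unorm (x i) \<le> 1" using assms i by (auto simp: Zp_box_def)
    then have "(1 / real p) ^ n * unorm (x i) \<le> (1 / real p) ^ n" by (intro mult_left_le) simp_all
    then show ?thesis using i unfolding y_def by (simp add: unorm_mult unorm_power unorm_p)
  qed
  have "(1 / real p) ^ n \<le> 1" using p_gt_1 by (intro power_le_one) simp_all
  then have "unorm (y i) \<le> 1" if "i < d" for i by (rule order_trans[OF y_le[OF that]])
  then have y: "y \<in> unit_box" unfolding Zp_box_def by (intro PiE_I) (simp_all, simp add: y_def)
  have eq: "coords (\<lambda>i. of_nat (p ^ n) * x i) = coords y" by (rule coords_cong) (simp add: y_def)
  have val: "ereal (real n) \<le> padic_val p (y i)" if i: "i < d" for i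
  proof (cases "y i = 0")
    case False
    have "log (real p) (unorm (y i)) \<le> log (real p) ((1 / real p) ^ n)"
      using y_le[OF i] unorm_pos[OF False] p_gt_1 by (subst log_le_cancel_iff) simp_all
    also have "\<dots> = - real n"
      using p_gt_1 by (simp add: power_one_over log_inverse log_nat_power flip: inverse_eq_divide)
    finally show ?thesis using False by (simp add: padic_val_def)
  qed (simp add: padic_val_def)
  have "ereal (real n + 1 / (real p - 1)) < \<omega> (coords y)"
  proof (cases "d = 0")
    case False
    then have "\<omega> (coords y) = Min ((\<lambda>i. \<omega> (b i) + padic_val p (y i)) ` {..<d})"
      unfolding val_coords[OF y] by (subst Min_Inf) auto
    also have "\<dots> \<in> (\<lambda>i. \<omega> (b i) + padic_val p (y i)) ` {..<d}" using False by (intro Min_in) auto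
    finally obtain i where i: "i < d" "\<omega> (coords y) = \<omega> (b i) + padic_val p (y i)" by auto
    then show ?thesis using val_gt[OF b_H[OF i(1)]] val[OF i(1)]
      by (cases "\<omega> (b i)"; cases "padic_val p (y i)") auto
  next
    case True
    then have "\<omega> (coords y) = \<infinity>" unfolding val_coords[OF y] by (simp add: top_ereal_def)
    then show ?thesis by simp
  qed
  moreover have "coords y \<in> H" using coords_onto y by blast
  ultimately show ?thesis unfolding eq mem_power_subgroup_iff by blast
qed

text \<open>
  If \<open>\<omega> g > n + 1/(p - 1)\<close>, then each coordinate \<open>y i\<close> of \<open>g\<close> has \<open>\<omega> (b i) + v (y i) > n + 1/(p - 1)\<close>.
  By \<open>basis_val_le\<close> this forces \<open>v (y i) > n - 1\<close>, and valuations in \<open>\<rat>\<^sub>p\<close> are integers.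
\<close>
lemma power_subgroup_coords:
  assumes "g \<in> power_subgroup p G H n"
  obtains x where "x \<in> unit_box" "g = coords (\<lambda>i. of_nat (p ^ n) * x i)"
proof -
  have g: "g \<in> H" "ereal (real n + 1 / (real p - 1)) < \<omega> g" using assms by (auto simp: mem_power_subgroup_iff)
  then obtain y where y: "y \<in> unit_box" "g = coords y" using coords_onto by blast
  define x where "x = restrict (\<lambda>i. y i / of_nat (p ^ n)) {..<d}"
  have p0: "(of_nat (p ^ n) :: 'k) \<noteq> 0" using p_gt_1 by simp
  have p: "real p / (real p - 1) = 1 + 1 / (real p - 1)" using p_gt_1 by (simp add: field_simps)
  have "unorm (x i) \<le> 1" if i: "i < d" for i
  proof (rule unorm_discrete, cases "y i = 0")
    case False
    have "ereal (real n + 1 / (real p - 1)) < \<omega> (b i) + padic_val p (y i)"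
      using g(2) val_coords_le[OF y(1) i] unfolding y(2) by (rule order.strict_trans2)
    also have "\<dots> \<le> ereal (1 + 1 / (real p - 1)) + padic_val p (y i)"
      using basis_val_le[OF i] by (intro add_right_mono) (simp add: p)
    finally have "log (real p) (unorm (y i)) < 1 - real n" using False by (simp add: padic_val_def)
    then have "unorm (y i) < real p powr (1 - real n)"
      using unorm_pos[OF False] p_gt_1 by (subst (asm) log_less_iff) simp_all
    also have "\<dots> = real p / real p ^ n" using p_gt_1 by (simp add: powr_diff powr_realpow)
    finally have "unorm (y i) * real p ^ n < real p" using p_gt_1 by (simp add: field_simps)
    moreover have "unorm (x i) * (1 / real p) ^ n = unorm (y i)"
      using i p0 by (simp add: x_def flip: unorm_of_nat_p_power unorm_mult del: of_nat_power)
    ultimately show "unorm (x i) < real p" using p_gt_1 by (auto simp: power_one_over field_simps)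
  qed (use i p_gt_1 in \<open>simp add: x_def unorm_zero\<close>)
  then have "x \<in> unit_box" by (auto simp: Zp_box_def x_def)
  moreover have "g = coords (\<lambda>i. of_nat (p ^ n) * x i)"
    unfolding y(2) by (rule coords_cong) (use p0 in \<open>simp add: x_def del: of_nat_power\<close>)
  ultimately show ?thesis by (rule that)
qed

end

section \<open>Power series on the unit box\<close>

lemma unorm_prod: "unorm (\<Prod>i\<in>I. f i :: 'k::ultrametric_field) = (\<Prod>i\<in>I. unorm (f i))"
  by (induction I rule: infinite_finite_induct) (simp_all add: unorm_one unorm_mult)

lemma Zp_box_unorm: "x \<in> Zp_box d \<Longrightarrow> i < d \<Longrightarrow> unorm (x i) \<le> 1"
  unfolding Zp_box_def by (drule PiE_mem[of _ _ _ i]) simp_all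

lemma unorm_monomial_le_1:
  assumes x: "x \<in> Zp_box d" shows "unorm (monomial d \<alpha> x) \<le> 1"
  unfolding monomial_def unorm_prod unorm_power
  by (rule prod_le_1) (use Zp_box_unorm[OF x] in \<open>simp add: power_le_one unorm_nonneg\<close>)

lemma monomial_scale:
  "monomial d \<alpha> (\<lambda>i. c * x i :: 'k::comm_ring_1) = c ^ (\<Sum>i<d. \<alpha> i) * monomial d \<alpha> x"
  by (simp add: monomial_def power_mult_distrib prod.distrib power_sum)

lemma unorm_has_sum_le:
  assumes f: "(f has_sum s) A" and le: "\<And>\<alpha>. \<alpha> \<in> A \<Longrightarrow> unorm (f \<alpha> :: 'a::ultrametric_group) \<le> r" and r: "0 \<le> r"
  shows "unorm s \<le> r"
proof -
  have "unorm (sum f X) \<le> r" if "finite X" "X \<subseteq> A" for X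
    using that
  proof (induction X rule: finite_induct)
    case (insert \<alpha> X)
    then show ?case using unorm_add_le_max[of "f \<alpha>" "sum f X"] le[of \<alpha>] by auto
  qed (simp add: unorm_zero r)
  then have "\<forall>\<^sub>F X in finite_subsets_at_top A. sum f X \<in> cball 0 r"
    by (intro eventually_finite_subsets_at_top_weakI) (simp add: unorm_dist dist_commute)
  then have "s \<in> cball 0 r"
    using f unfolding has_sum_def
    by (intro Lim_in_closed_set[OF closed_cball _ finite_subsets_at_top_neq_bot])
  then show ?thesis by (simp add: unorm_dist dist_commute)
qed

section \<open>Cohomology with analytic coefficients\<close>

locale banach_representation_setting = based_subgroup G p K T H \<omega> d b
  for G :: "('g, 'm) monoid_scheme" (structure)
    and p :: nat and K :: "'k::{ultrametric_field,complete_space} itself"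
    and T :: "'g topology" and H :: "'g set" and \<omega> :: "'g \<Rightarrow> ereal"
    and d :: nat and b :: "nat \<Rightarrow> 'g" +
  fixes smul :: "'k \<Rightarrow> 'w::{ultrametric_group,complete_space} \<Rightarrow> 'w" and \<rho> :: "'g \<Rightarrow> 'w \<Rightarrow> 'w"
  assumes representation: "banach_representation G T smul \<rho>"
begin

abbreviation "S n \<equiv> power_subgroup p G H n"
abbreviation "F n \<equiv> analytic_functions p G T H d b n :: ('g \<Rightarrow> 'k) set"
abbreviation "NF n \<equiv> analytic_norm p G T d b n :: ('g \<Rightarrow> 'k) \<Rightarrow> real"
abbreviation "W_an n \<equiv> W_analytic p G T H d b smul n"
abbreviation "NW n \<equiv> W_analytic_norm p G T H d b smul n"
abbreviation "act n \<equiv> diagonal_action G \<rho> (S n)"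
abbreviation "Co n i \<equiv> cochains T (S n) (W_an n) (NW n) i"
abbreviation "Cy n i \<equiv> cocycles G T (S n) (W_an n) (NW n) (act n) i"
abbreviation "Bo n i \<equiv> coboundaries G T (S n) (W_an n) (NW n) (act n) i"
abbreviation "\<delta> n i \<equiv> coboundary G (S n) (act n) i"
abbreviation "res n i \<equiv> restrict_cochain (S n) i :: ((nat \<Rightarrow> 'g) \<Rightarrow> 'g \<Rightarrow> 'w) \<Rightarrow> _"

lemma expansion_bounded:
  assumes "analytic_expansion p G T d b n f (a :: _ \<Rightarrow> 'k)"
  obtains r where "\<forall>\<alpha>\<in>multi_indices d. unorm (a \<alpha>) \<le> r"
proof -
  define I where "I = {\<alpha> \<in> multi_indices d. 1 \<le> \<bar>unorm (a \<alpha>)\<bar>}"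
  have "finite I" using assms by (auto simp: I_def analytic_expansion_def null_family_def)
  then have "unorm (a \<alpha>) \<le> Max (insert 1 ((\<lambda>\<alpha>. unorm (a \<alpha>)) ` I))" if "\<alpha> \<in> multi_indices d" for \<alpha>
  proof (cases "\<alpha> \<in> I")
    case False
    then have "unorm (a \<alpha>) \<le> 1" using that by (auto simp: I_def)
    then show ?thesis using \<open>finite I\<close> by (simp add: Max_ge_iff)
  qed (simp add: Max_ge)
  then show ?thesis using that by blast
qed

text \<open>
  Every point of \<open>G\<^sub>n\<close> has coordinates in \<open>p\<^sup>n\<int>\<^sub>p\<close>, so that the value of \<open>f\<close> there is a sum of terms of
  norm at most \<open>r\<close>.
\<close>
lemma expansion_dominates:
  assumes a: "analytic_expansion p G T d b n f (a :: _ \<Rightarrow> 'k)"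
    and r: "\<forall>\<alpha>\<in>multi_indices d. unorm (a \<alpha>) \<le> r" and x: "x \<in> S n"
  shows "unorm (f x) \<le> r"
proof -
  obtain y where y: "y \<in> unit_box" "x = coords (\<lambda>i. of_nat (p ^ n) * y i)" using power_subgroup_coords[OF x] .
  \<comment> \<open>\<open>r\<close> bounds the norm of a coefficient, so it is not negative\<close>
  have "restrict (\<lambda>i. 0) {..<d} \<in> multi_indices d" by (simp add: multi_indices_def)
  then have "unorm (a (restrict (\<lambda>i. 0) {..<d})) \<le> r" using r by blast
  then have r0: "0 \<le> r" by (rule order_trans[OF unorm_nonneg])
  have "((\<lambda>\<alpha>. a \<alpha> * monomial d \<alpha> y) has_sum f x) (multi_indices d)"
    using a y by (simp add: analytic_expansion_def)
  then show ?thesis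
  proof (rule unorm_has_sum_le[OF _ _ r0])
    fix \<alpha> assume "\<alpha> \<in> multi_indices d"
    then have "unorm (a \<alpha>) \<le> r" using r by blast
    moreover have "unorm (a \<alpha>) * unorm (monomial d \<alpha> y) \<le> unorm (a \<alpha>)"
      by (intro mult_left_le unorm_monomial_le_1 y(1) unorm_nonneg)
    ultimately show "unorm (a \<alpha> * monomial d \<alpha> y) \<le> r" by (simp add: unorm_mult)
  qed
qed

lemma one_S: "\<one> \<in> S n"
  by (rule subgroup.one_closed[OF subgroup_power_subgroup])

lemma analytic_norm_set_nonempty:
  assumes "f \<in> F n"
  shows "{r. \<exists>a :: _ \<Rightarrow> 'k. analytic_expansion p G T d b n f a \<and> (\<forall>\<alpha>\<in>multi_indices d. unorm (a \<alpha>) \<le> r)} \<noteq> {}"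
proof -
  obtain a :: "_ \<Rightarrow> 'k" where a: "analytic_expansion p G T d b n f a"
    using assms by (auto simp: analytic_functions_def)
  obtain r where "\<forall>\<alpha>\<in>multi_indices d. unorm (a \<alpha>) \<le> r" using expansion_bounded[OF a] .
  then show ?thesis using a by auto
qed

lemma analytic_dominated:
  assumes f: "f \<in> F n" shows "unorm (f x) \<le> NF n f"
  unfolding analytic_norm_def
proof (rule cInf_greatest[OF analytic_norm_set_nonempty[OF f]])
  fix r assume "r \<in> {r. \<exists>a :: _ \<Rightarrow> 'k. analytic_expansion p G T d b n f a \<and> (\<forall>\<alpha>\<in>multi_indices d. unorm (a \<alpha>) \<le> r)}"
  then obtain a :: "_ \<Rightarrow> 'k" where a: "analytic_expansion p G T d b n f a" "\<forall>\<alpha>\<in>multi_indices d. unorm (a \<alpha>) \<le> r"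
    by blast
  show "unorm (f x) \<le> r"
  proof (cases "x \<in> S n")
    case False
    then have "f x = 0" using f by (simp add: analytic_functions_def)
    moreover have "0 \<le> r" using expansion_dominates[OF a one_S] by (rule order_trans[OF unorm_nonneg])
    ultimately show ?thesis by (simp add: unorm_zero)
  qed (rule expansion_dominates[OF a])
qed

text \<open>
  On \<open>G\<^sub>m\<close> the coordinates are rescaled by \<open>p\<^sup>m = p\<^sup>n p\<^sup>m\<^sup>-\<^sup>n\<close>; substituting \<open>p\<^sup>m\<^sup>-\<^sup>n x\<close> for \<open>x\<close> multiplies
  the coefficient of index \<open>\<alpha>\<close> by the power of \<open>p\<^sup>m\<^sup>-\<^sup>n\<close> with exponent \<open>|\<alpha>|\<close>.
\<close>
lemma restrict_expansion:
  assumes a: "analytic_expansion p G T d b n f (a :: _ \<Rightarrow> 'k)" and nm: "n \<le> m"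
  shows "analytic_expansion p G T d b m (restrict_zero (S m) f)
    (\<lambda>\<alpha>. a \<alpha> * of_nat (p ^ (m - n)) ^ (\<Sum>i<d. \<alpha> i))" (is "analytic_expansion _ _ _ _ _ _ _ ?a'")
  and "unorm (a \<alpha> * of_nat (p ^ (m - n)) ^ (\<Sum>i<d. \<alpha> i)) \<le> unorm (a \<alpha>)"
proof -
  let ?c = "of_nat (p ^ (m - n)) :: 'k"
  show le: "unorm (a \<alpha> * ?c ^ (\<Sum>i<d. \<alpha> i)) \<le> unorm (a \<alpha>)" for \<alpha>
    unfolding unorm_mult unorm_power
    by (intro mult_left_le power_le_one unorm_nonneg unorm_of_nat_le_1)
  have "null_family (multi_indices d) (\<lambda>\<alpha>. unorm (?a' \<alpha>))"
    unfolding null_family_def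
  proof (intro allI impI)
    fix e :: real assume "0 < e"
    then have "finite {\<alpha> \<in> multi_indices d. e \<le> \<bar>unorm (a \<alpha>)\<bar>}"
      using a by (simp add: analytic_expansion_def null_family_def)
    then show "finite {\<alpha> \<in> multi_indices d. e \<le> \<bar>unorm (?a' \<alpha>)\<bar>}"
      by (rule rev_finite_subset) (use le in \<open>auto simp: unorm_nonneg intro: order_trans\<close>)
  qed
  moreover have "((\<lambda>\<alpha>. ?a' \<alpha> * monomial d \<alpha> x) has_sum
      restrict_zero (S m) f (coords (\<lambda>i. of_nat (p ^ m) * x i))) (multi_indices d)" if x: "x \<in> unit_box" for x
  proof -
    define y where "y = restrict (\<lambda>i. ?c * x i) {..<d}"
    have "unorm (?c * x i) \<le> 1" if "i < d" for i
      unfolding unorm_mult by (intro mult_le_one unorm_nonneg unorm_of_nat_le_1 Zp_box_unorm[OF x that])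
    then have y: "y \<in> unit_box" unfolding Zp_box_def y_def by (simp add: restrict_PiE_iff)
    have mono: "monomial d \<alpha> y = ?c ^ (\<Sum>i<d. \<alpha> i) * monomial d \<alpha> x" for \<alpha>
      unfolding monomial_scale[symmetric] by (simp add: monomial_def y_def)
    have eq: "coords (\<lambda>i. of_nat (p ^ n) * y i) = coords (\<lambda>i. of_nat (p ^ m) * x i)"
      by (rule coords_cong) (use nm in \<open>simp add: y_def flip: power_add mult.assoc\<close>)
    have "((\<lambda>\<alpha>. a \<alpha> * monomial d \<alpha> y) has_sum f (coords (\<lambda>i. of_nat (p ^ n) * y i))) (multi_indices d)"
      using a y by (simp add: analytic_expansion_def)
    then show ?thesis
      unfolding eq mono restrict_zero_apply using coords_power_subgroup[OF x, of m] by (simp add: mult.assoc)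
  qed
  ultimately show "analytic_expansion p G T d b m (restrict_zero (S m) f) ?a'"
    by (simp add: analytic_expansion_def)
qed

lemma restrict_analytic:
  assumes f: "f \<in> F n" and nm: "n \<le> m"
  shows "restrict_zero (S m) f \<in> F m" "NF m (restrict_zero (S m) f) \<le> NF n f"
proof -
  obtain a :: "_ \<Rightarrow> 'k" where "analytic_expansion p G T d b n f a"
    using f by (auto simp: analytic_functions_def)
  from restrict_expansion(1)[OF this nm] show "restrict_zero (S m) f \<in> F m"
    by (auto simp: analytic_functions_def restrict_zero_def)
  show "NF m (restrict_zero (S m) f) \<le> NF n f"
    unfolding analytic_norm_def
  proof (rule cInf_superset_mono[OF analytic_norm_set_nonempty[OF f]])
    show "bdd_below {r. \<exists>a :: _ \<Rightarrow> 'k. analytic_expansion p G T d b m (restrict_zero (S m) f) a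
        \<and> (\<forall>\<alpha>\<in>multi_indices d. unorm (a \<alpha>) \<le> r)}"
      by (rule bdd_belowI[of _ 0])
        (use expansion_dominates[OF _ _ one_S] order_trans[OF unorm_nonneg] in blast)
    show "{r. \<exists>a :: _ \<Rightarrow> 'k. analytic_expansion p G T d b n f a \<and> (\<forall>\<alpha>\<in>multi_indices d. unorm (a \<alpha>) \<le> r)}
      \<subseteq> {r. \<exists>a :: _ \<Rightarrow> 'k. analytic_expansion p G T d b m (restrict_zero (S m) f) a
        \<and> (\<forall>\<alpha>\<in>multi_indices d. unorm (a \<alpha>) \<le> r)}"
    proof (intro subsetI, clarify)
      fix r and a :: "_ \<Rightarrow> 'k"
      assume a: "analytic_expansion p G T d b n f a" and r: "\<forall>\<alpha>\<in>multi_indices d. unorm (a \<alpha>) \<le> r"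
      have "\<forall>\<alpha>\<in>multi_indices d. unorm (a \<alpha> * of_nat (p ^ (m - n)) ^ (\<Sum>i<d. \<alpha> i)) \<le> r"
        using r order_trans[OF restrict_expansion(2)[OF a nm]] by blast
      then show "\<exists>a :: _ \<Rightarrow> 'k. analytic_expansion p G T d b m (restrict_zero (S m) f) a
          \<and> (\<forall>\<alpha>\<in>multi_indices d. unorm (a \<alpha>) \<le> r)"
        using restrict_expansion(1)[OF a nm] by blast
    qed
  qed
qed

lemma banach_W: "banach_space smul"
  using representation by (simp add: banach_representation_def)

sublocale W: dominated_tensor smul "F n" "NF n" for n
  by unfold_locales (use banach_W analytic_dominated in blast)+

lemma tensor_restriction: "n \<le> m \<Longrightarrow> tensor_restriction smul (F n) (NF n) (F m) (NF m) (S m)"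
  using W.dominated_tensor_axioms restrict_analytic
  by (simp add: tensor_restriction_def tensor_restriction_axioms_def)

lemma restrict_W_analytic:
  assumes "n \<le> m" "h \<in> W_an n"
  shows "restrict_zero (S m) h \<in> W_an m" "NW m (restrict_zero (S m) h) \<le> NW n h"
  using assms tensor_restriction.restrict_V[OF tensor_restriction[OF assms(1)]]
    tensor_restriction.restrict_NV[OF tensor_restriction[OF assms(1)]]
  by (simp_all add: W_analytic_def W_analytic_norm_def)

abbreviation "fscale \<equiv> \<lambda>a (h :: 'g \<Rightarrow> 'w) x. smul a (h x)"
abbreviation "cscale \<equiv> \<lambda>a (f :: (nat \<Rightarrow> 'g) \<Rightarrow> 'g \<Rightarrow> 'w) \<sigma>. fscale a (f \<sigma>)"

lemma banach_W_analytic: "banach_subspace fscale (W_an n) (NW n)"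
  unfolding W_analytic_def W_analytic_norm_def by (rule W.banach_subspace_V)

sublocale Co: compact_cochains fscale "W_an n" "NW n" T "S n" i for n i
proof (rule compact_cochains.intro[OF banach_W_analytic])
  show "compact_cochains_axioms T (S n)"
    using compactin_power_subgroup one_S by unfold_locales auto
qed

abbreviation "NC n i \<equiv> sup_norm (NW n) (tuples (S n) i)"

lemma unorm_le_NC:
  assumes "f \<in> Co n i" shows "unorm (f \<sigma> x) \<le> NC n i f"
proof -
  have "unorm (f \<sigma> x) \<le> NW n (f \<sigma>)"
    using W.unorm_le_NV Co.cochain_mem[OF assms] by (simp add: W_analytic_def W_analytic_norm_def)
  then show ?thesis using Co.norm_le_sup_norm[OF assms] by (rule order_trans)
qed

text \<open>
  Convergence in the supremum norm implies convergence of all values. This reduces the closedness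
  of cocycles and of the coboundary relation to continuity of the action on \<open>W\<close>.
\<close>
lemma tendsto_pointwise:
  assumes s: "\<And>k. s k \<in> Co n i" and f: "f \<in> Co n i" and lim: "(\<lambda>k. NC n i (s k - f)) \<longlonglongrightarrow> 0"
  shows "(\<lambda>k. s k \<sigma> x) \<longlonglongrightarrow> f \<sigma> x"
proof (subst tendsto_dist_iff, rule real_tendsto_sandwich[OF _ _ tendsto_const lim])
  show "\<forall>\<^sub>F k in sequentially. dist (s k \<sigma> x) (f \<sigma> x) \<le> NC n i (s k - f)"
    using unorm_le_NC[OF Co.cochain_diff[OF s f], of _ \<sigma> x] by (simp add: dist_unorm)
qed simp

lemma S_carrier: "g \<in> S n \<Longrightarrow> g \<in> carrier G"
  using subgroup.mem_carrier[OF subgroup_power_subgroup] .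

lemma rho_linear: "g \<in> carrier G \<Longrightarrow> Vector_Spaces.linear smul smul (\<rho> g)"
  using representation by (simp add: banach_representation_def)

lemma rho_add: "g \<in> carrier G \<Longrightarrow> \<rho> g (u + v) = \<rho> g u + \<rho> g v"
  and rho_scale: "g \<in> carrier G \<Longrightarrow> \<rho> g (smul a u) = smul a (\<rho> g u)"
  using rho_linear[of g] by (simp_all add: Vector_Spaces.linear_iff)

lemma rho_zero: "g \<in> carrier G \<Longrightarrow> \<rho> g 0 = 0"
  using rho_add[of g 0 0] by simp

lemma rho_tendsto:
  assumes g: "g \<in> carrier G" and u: "u \<longlonglongrightarrow> w" shows "(\<lambda>k. \<rho> g (u k)) \<longlonglongrightarrow> \<rho> g w"
proof -
  have "continuous_map euclidean (prod_topology T euclidean) (\<lambda>w. (g, w))"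
    using g by (simp add: continuous_map_pairedI topspace_T flip: id_def)
  moreover have "continuous_map (prod_topology T euclidean) euclidean (\<lambda>(g, w). \<rho> g w)"
    using representation by (simp add: banach_representation_def)
  ultimately have "continuous_map euclidean euclidean ((\<lambda>(g, w). \<rho> g w) \<circ> (\<lambda>w. (g, w)))"
    by (rule continuous_map_compose)
  then have "continuous_on UNIV (\<rho> g)" by (simp add: o_def)
  then show ?thesis using u by (simp add: continuous_on_tendsto_compose)
qed

lemma coboundary_add: "\<delta> n i (f + g) = \<delta> n i f + \<delta> n i g"
proof (intro ext)
  fix \<sigma> x show "\<delta> n i (f + g) \<sigma> x = (\<delta> n i f + \<delta> n i g) \<sigma> x"
    using rho_add[OF S_carrier[OF tuple_faces(1)[OF subgroup_power_subgroup, of \<sigma> n i]]]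
    by (simp add: coboundary_apply alternate_add sum.distrib)
qed

lemma alternate_smul: "alternate k (smul a w) = smul a (alternate k w)"
  by (simp add: alternate_def W.scale_minus_right)

lemma coboundary_scale: "\<delta> n i (cscale a f) = cscale a (\<delta> n i f)"
proof (intro ext)
  fix \<sigma> x show "\<delta> n i (cscale a f) \<sigma> x = cscale a (\<delta> n i f) \<sigma> x"
    using rho_scale[OF S_carrier[OF tuple_faces(1)[OF subgroup_power_subgroup, of \<sigma> n i]]]
    by (simp add: coboundary_apply alternate_smul W.scale_right_distrib W.scale_sum_right)
qed

lemma coboundary_zero: "\<delta> n i 0 = 0"
  using coboundary_add[of n i 0 0] by simp

lemma coboundary_tendsto:
  assumes lim: "\<And>\<sigma> x. (\<lambda>k. s k \<sigma> x) \<longlonglongrightarrow> f \<sigma> x"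
  shows "(\<lambda>k. \<delta> n i (s k) \<sigma> x) \<longlonglongrightarrow> \<delta> n i f \<sigma> x"
proof (cases "\<sigma> \<in> tuples (S n) (Suc i)")
  case True
  have "(\<lambda>k. alternate j (s k \<tau> y)) \<longlonglongrightarrow> alternate j (f \<tau> y)" for j \<tau> y
    unfolding alternate_def by (simp add: lim tendsto_minus)
  moreover have "\<sigma> 0 \<in> carrier G" using tuple_faces(1)[OF subgroup_power_subgroup True] S_carrier by blast
  ultimately show ?thesis
    using True by (simp add: coboundary_apply) (intro conjI impI tendsto_intros rho_tendsto lim)
qed (simp add: coboundary_apply)

lemma banach_cocycles: "banach_subspace cscale (Cy n i) (NC n i)"
proof (rule banach_subspace.closed_subspace[OF Co.banach_subspace_cochains])
  fix s f assume s: "\<And>k. s k \<in> Cy n i" and f: "f \<in> Co n i" and lim: "(\<lambda>k. NC n i (s k - f)) \<longlonglongrightarrow> 0"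
  have s': "s k \<in> Co n i" "\<delta> n i (s k) = 0" for k using s[of k] by (simp_all add: cocycles_def)
  have "\<delta> n i f = 0"
  proof (intro ext)
    fix \<sigma> x
    have "(\<lambda>k. \<delta> n i (s k) \<sigma> x) \<longlonglongrightarrow> \<delta> n i f \<sigma> x"
      by (rule coboundary_tendsto) (rule tendsto_pointwise[OF s'(1) f lim])
    then show "\<delta> n i f \<sigma> x = 0 \<sigma> x" by (simp add: s'(2) LIMSEQ_const_iff)
  qed
  then show "f \<in> Cy n i" using f by (simp add: cocycles_def)
qed (auto simp: cocycles_def coboundary_add coboundary_scale coboundary_zero fun_eq_iff
    intro: Co.cochain_zero Co.cochain_add Co.cochain_scale)

lemma restrict_cochain_Co:
  assumes "n \<le> m" "f \<in> Co n i" shows "res m i f \<in> Co m i"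
proof (rule restrict_cochain_mem[OF assms(2) power_subgroup_antimono[OF assms(1)]])
  show "restrict_zero (S m) h \<in> W_an m" if "h \<in> W_an n" for h by (rule restrict_W_analytic[OF assms(1) that])
  show "NW m (restrict_zero (S m) (h - h')) \<le> NW n (h - h')" if "h \<in> W_an n" "h' \<in> W_an n" for h h'
    by (intro restrict_W_analytic(2)[OF assms(1)] banach_subspace.diff_mem[OF banach_W_analytic] that)
qed

lemma restrict_add: "res m i (f + g) = res m i f + res m i g"
  and restrict_scale: "res m i (cscale a f) = cscale a (res m i f)"
  by (auto simp: fun_eq_iff restrict_cochain_apply)

lemma restrict_delta: "n \<le> m \<Longrightarrow> res m (Suc i) (\<delta> n i f) = \<delta> m i (res m i f)"
  by (intro restrict_coboundary subgroup_power_subgroup power_subgroup_antimono rho_zero S_carrier)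

lemma coboundaries_Suc: "Bo n (Suc i) = \<delta> n i ` Co n i"
  by (simp add: coboundaries_def)

lemma Bo_zero: "0 \<in> Bo n (Suc i)"
  unfolding coboundaries_Suc using Co.cochain_zero coboundary_zero by (metis image_eqI)

lemma Bo_add: "u \<in> Bo n (Suc i) \<Longrightarrow> v \<in> Bo n (Suc i) \<Longrightarrow> u + v \<in> Bo n (Suc i)"
  unfolding coboundaries_Suc by (auto simp: coboundary_add[symmetric] intro!: imageI Co.cochain_add)

lemma Bo_diff:
  assumes "u \<in> Bo n (Suc i)" "v \<in> Bo n (Suc i)" shows "u - v \<in> Bo n (Suc i)"
proof -
  obtain f g where fg: "f \<in> Co n i" "g \<in> Co n i" "u = \<delta> n i f" "v = \<delta> n i g"
    using assms by (auto simp: coboundaries_Suc)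
  have "\<delta> n i (f - g) + \<delta> n i g = \<delta> n i f" by (simp flip: coboundary_add)
  then have "u - v = \<delta> n i (f - g)" using fg by (simp add: algebra_simps)
  then show ?thesis using Co.cochain_diff[OF fg(1,2)] by (simp add: coboundaries_Suc)
qed

lemma restrict_Bo: "n \<le> m \<Longrightarrow> u \<in> Bo n (Suc i) \<Longrightarrow> res m (Suc i) u \<in> Bo m (Suc i)"
  by (auto simp: coboundaries_Suc restrict_delta intro!: imageI restrict_cochain_Co)

text \<open>
  The closed relations are \<open>R m\<close>: the cocycle \<open>z\<close> restricts to the coboundary of \<open>c\<close> at level \<open>n + m\<close>.
  The shift by \<open>n\<close> lets the index run over all natural numbers.
\<close>
lemma uniform_vanishing:
  assumes "\<And>z. z \<in> Cy n (Suc j) \<Longrightarrow> \<exists>m\<ge>n. res m (Suc j) z \<in> Bo m (Suc j)"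
  shows "\<exists>m\<ge>n. \<forall>z\<in>Cy n (Suc j). res m (Suc j) z \<in> Bo m (Suc j)"
proof -
  define R where "R m z c \<longleftrightarrow> res (n + m) (Suc j) z = \<delta> (n + m) j c" for m z c
  have "\<exists>m. \<forall>z\<in>Cy n (Suc j). \<exists>c\<in>Co (n + m) j. R m z c"
  proof (rule closed_relations_cover_imp_onto[OF banach_cocycles Co.banach_subspace_cochains])
    show "(of_nat p :: 'k) \<noteq> 0" using p_gt_1 by simp
    show "unorm (of_nat p :: 'k) < 1" using p_gt_1 by (simp add: unorm_p)
    show "R m (z + z') (c + c')" if "R m z c" "R m z' c'" for m z z' c c'
      using that by (simp add: R_def restrict_add coboundary_add)
    show "R m (cscale a z) (cscale a c)" if "R m z c" for m a z c
      using that by (simp add: R_def restrict_scale coboundary_scale)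
    show "R m 0 0" for m
      using restrict_add[of "n + m" "Suc j" 0 0] by (simp add: R_def coboundary_zero)
    show "\<exists>m. \<exists>c\<in>Co (n + m) j. R m z c" if z: "z \<in> Cy n (Suc j)" for z
    proof -
      obtain m where m: "n \<le> m" "res m (Suc j) z \<in> Bo m (Suc j)" using assms[OF z] by blast
      then show ?thesis by (intro exI[of _ "m - n"]) (auto simp: R_def coboundaries_Suc)
    qed
    fix m f g z c
    assume f: "\<And>k. f k \<in> Cy n (Suc j)" and g: "\<And>k. g k \<in> Co (n + m) j" and R: "\<And>k. R m (f k) (g k)"
      and z: "z \<in> Cy n (Suc j)" and c: "c \<in> Co (n + m) j"
      and fz: "(\<lambda>k. NC n (Suc j) (f k - z)) \<longlonglongrightarrow> 0" and gc: "(\<lambda>k. NC (n + m) j (g k - c)) \<longlonglongrightarrow> 0"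
    have fz': "f k \<in> Co n (Suc j)" "z \<in> Co n (Suc j)" for k using f[of k] z by (simp_all add: cocycles_def)
    have f_lim: "(\<lambda>k. f k \<sigma> x) \<longlonglongrightarrow> z \<sigma> x" for \<sigma> x by (rule tendsto_pointwise[OF fz' fz])
    have g_lim: "(\<lambda>k. g k \<sigma> x) \<longlonglongrightarrow> c \<sigma> x" for \<sigma> x by (rule tendsto_pointwise[OF g c gc])
    show "R m z c"
      unfolding R_def
    proof (intro ext)
      fix \<sigma> x
      have "(\<lambda>k. res (n + m) (Suc j) (f k) \<sigma> x) \<longlonglongrightarrow> res (n + m) (Suc j) z \<sigma> x"
        using f_lim by (cases "\<sigma> \<in> tuples (S (n + m)) (Suc j) \<and> x \<in> S (n + m)")
          (auto simp: restrict_cochain_apply)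
      moreover have "(\<lambda>k. res (n + m) (Suc j) (f k) \<sigma> x) \<longlonglongrightarrow> \<delta> (n + m) j c \<sigma> x"
        using coboundary_tendsto[OF g_lim] R by (simp add: R_def)
      ultimately show "res (n + m) (Suc j) z \<sigma> x = \<delta> (n + m) j c \<sigma> x" by (rule LIMSEQ_unique)
    qed
  qed
  then obtain m where "\<forall>z\<in>Cy n (Suc j). \<exists>c\<in>Co (n + m) j. R m z c" ..
  then show ?thesis by (intro exI[of _ "n + m"]) (auto simp: R_def coboundaries_Suc)
qed

abbreviation "coh i n \<equiv> la_cohomology p G T H d b smul \<rho> i n"
abbreviation "tr i \<equiv> la_transition p G T H d b smul \<rho> i"

lemma one_coh: "\<one>\<^bsub>coh i n\<^esub> = Bo n i"
  by (simp add: la_cohomology_def continuous_cohomology_def FactGroup_def)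

lemma carrier_coh: "carrier (coh i n) = (\<lambda>z. {u + z | u. u \<in> Bo n i}) ` Cy n i"
  by (auto simp: la_cohomology_def continuous_cohomology_def FactGroup_def RCOSETS_def r_coset_def
      additive_group_def image_def)

lemma mem_trans_iff: "u \<in> tr i n m X \<longleftrightarrow> (\<exists>z\<in>X. \<exists>c\<in>Bo m i. u = res m i z + c)"
  by (auto simp: la_transition_def)

lemma trans_eq_one:
  assumes nm: "n \<le> m" and z: "res m (Suc j) z \<in> Bo m (Suc j)"
  shows "tr (Suc j) n m {u + z | u. u \<in> Bo n (Suc j)} = Bo m (Suc j)"
proof (intro equalityI subsetI)
  fix v assume "v \<in> tr (Suc j) n m {u + z | u. u \<in> Bo n (Suc j)}"
  then show "v \<in> Bo m (Suc j)"
    using z restrict_Bo[OF nm] by (auto simp: mem_trans_iff restrict_add intro!: Bo_add)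
next
  fix v assume v: "v \<in> Bo m (Suc j)"
  have "v = res m (Suc j) (0 + z) + (v - res m (Suc j) z)" by simp
  then show "v \<in> tr (Suc j) n m {u + z | u. u \<in> Bo n (Suc j)}"
    using Bo_diff[OF v z] Bo_zero unfolding mem_trans_iff by blast
qed

text \<open>
  The class of \<open>z\<close> agrees with the zero class of level 0 in the direct limit, so both have the same
  image at some level \<open>m\<close>; the image of the zero class consists of coboundaries.
\<close>
lemma eventually_coboundary:
  assumes lim: "direct_limit (coh (Suc j)) (tr (Suc j)) = {direct_limit_zero (coh (Suc j)) (tr (Suc j))}"
    and z: "z \<in> Cy n (Suc j)"
  shows "\<exists>m\<ge>n. res m (Suc j) z \<in> Bo m (Suc j)"
proof -
  let ?rel = "direct_limit_rel (coh (Suc j)) (tr (Suc j))"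
  define X where "X = {u + z | u. u \<in> Bo n (Suc j)}"
  have X: "X \<in> carrier (coh (Suc j) n)" using z by (auto simp: carrier_coh X_def)
  then have "?rel `` {(n, X)} \<in> direct_limit (coh (Suc j)) (tr (Suc j))"
    unfolding direct_limit_def by (intro quotientI) simp
  then have "?rel `` {(n, X)} = ?rel `` {(0, \<one>\<^bsub>coh (Suc j) 0\<^esub>)}" using lim by (simp add: direct_limit_zero_def)
  moreover have "(n, X) \<in> ?rel `` {(n, X)}" using X by (auto simp: direct_limit_rel_def)
  ultimately obtain m where m: "n \<le> m" "tr (Suc j) 0 m (Bo 0 (Suc j)) = tr (Suc j) n m X"
    by (auto simp: direct_limit_rel_def one_coh)
  have "z \<in> X" using Bo_zero by (auto simp: X_def intro!: exI[of _ 0])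
  then have "res m (Suc j) z \<in> tr (Suc j) n m X" unfolding mem_trans_iff using Bo_zero by force
  then obtain u c where "u \<in> Bo 0 (Suc j)" "c \<in> Bo m (Suc j)" "res m (Suc j) z = res m (Suc j) u + c"
    unfolding m(2)[symmetric] mem_trans_iff by blast
  then show ?thesis using m(1) Bo_add restrict_Bo[of 0 m u] by auto
qed

lemma LA_acyclic_imp_strongly:
  assumes "LA_acyclic p G T H d b smul \<rho>" shows "strongly_LA_acyclic p G T H d b smul \<rho>"
  unfolding strongly_LA_acyclic_def
proof (intro allI impI)
  fix i n :: nat assume "1 \<le> i"
  then obtain j where i: "i = Suc j" by (cases i) auto
  have lim: "direct_limit (coh (Suc j)) (tr (Suc j)) = {direct_limit_zero (coh (Suc j)) (tr (Suc j))}"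
    using assms by (simp add: LA_acyclic_def)
  obtain m where m: "n \<le> m" "\<And>z. z \<in> Cy n (Suc j) \<Longrightarrow> res m (Suc j) z \<in> Bo m (Suc j)"
    using uniform_vanishing[OF eventually_coboundary[OF lim]] by blast
  show "\<exists>m\<ge>n. \<forall>X\<in>carrier (coh i n). tr i n m X = \<one>\<^bsub>coh i m\<^esub>"
    unfolding i one_coh carrier_coh using trans_eq_one[OF m(1) m(2)] m(1) by auto
qed

end

theorem proposition2p3p6:
  fixes p d :: nat
    and G :: "('g, 'm) monoid_scheme"
    and T :: "'g topology"
    and G0 :: "'g set"
    and \<omega> :: "'g \<Rightarrow> ereal"
    and b :: "nat \<Rightarrow> 'g"
    and smul :: "'k::{ultrametric_field,complete_space} \<Rightarrow>
      'w::{ultrametric_group,complete_space} \<Rightarrow> 'w"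
    and \<rho> :: "'g \<Rightarrow> 'w \<Rightarrow> 'w"
  assumes "is_Qp p TYPE('k)"
    and "padic_lie_group TYPE('k) G T"
    and "subgroup G0 G" and "compactin T G0" and "openin T G0"
    and "p_valuation p G T G0 \<omega>" and "integer_valued G G0 \<omega>" and "saturated p G G0 \<omega>"
    and "ordered_basis TYPE('k) p G T G0 \<omega> d b"
    and "banach_representation G T smul \<rho>"
    and "LA_acyclic p G T G0 d b smul \<rho>"
  shows "strongly_LA_acyclic p G T G0 d b smul \<rho>"
proof -
  have "topological_group G T" "Hausdorff_space T" "group G"
    using assms(2) by (simp_all add: padic_lie_group_def topological_group_def)
  then interpret banach_representation_setting G p "TYPE('k)" T G0 \<omega> d b smul \<rho>
    using assms
    by (intro banach_representation_setting.intro based_subgroup.intro saturated_subgroup.intro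
        padic_field.intro saturated_subgroup_axioms.intro based_subgroup_axioms.intro
        banach_representation_setting_axioms.intro)
  show ?thesis by (rule LA_acyclic_imp_strongly) fact
qed

end
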